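(* Let $C_0,C_1,L,m>0$ and $T>L/C_0$, and let $\mathcal A:\mathcal D(\mathcal A)\subset X\to Y$, $\mathcal A(c)=\Lambda$, be the map taking a wave speed $c$ to its Neumann-to-Dirichlet operator $\Lambda$. Then $\mathcal A$ is invertible onto its range $Ran(\mathcal A)=\mathcal A(\mathcal D(\mathcal A))$, and the inverse map $$\mathcal A^{-1}: Ran(\mathcal A)\subset Y\to \mathcal D(\mathcal A)\subset X,\qquad \mathcal A^{-1}(\Lambda)=c,$$ is continuous, where $Ran(\mathcal A)$ and $\mathcal D(\mathcal A)$ are equipped with the topologies of $Y$ and $X$, respectively.
   Context: $M=[0,\infty)$. $X=L^\infty(M)$, and $Y=\mathcal L(L^2(0,2T))$ is the Banach space of bounded linear operators on $L^2(0,2T)$ with the operator norm. The set of velocity functions is $$\mathcal D(\mathcal A)=\{c\in L^\infty(M):\ C_0\le c(x)\le C_1,\ \|c\|_{C^2(M)}\le m,\ c-1\in C_0^2(0,L)\},$$ where $C_0^2(0,L)$ denotes the $C^2$ functions compactly supported in $(0,L)$ (extended by zero to $M$). For $c\in\mathcal D(\mathcal A)$ and $f\in L^2(0,2T)$, $u^f\in H^1((0,2T)\times M)$ denotes the unique solution of $$(\partial_t^2-c(x)^2\partial_x^2)u(t,x)=0 \text{ in } (0,2T)\times M,\quad \partial_xu(t,0)=f(t),\quad u|_{t=0}=\partial_tu|_{t=0}=0.$$ The Neumann-to-Dirichlet operator of $c$ is $\Lambda:L^2(0,2T)\to L^2(0,2T)$, $\Lambda f=u^f|_{x=0}$; it is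 bounded, and $\mathcal A(c)=\Lambda$. *)

theory Defs
  imports "HOL-Analysis.Analysis" "HOL-Probability.Essential_Supremum"
begin

section \<open>Lebesgue spaces as spaces of almost-everywhere classes\<close>

definition ae_class :: "'a measure \<Rightarrow> ('a \<Rightarrow> real) \<Rightarrow> ('a \<Rightarrow> real) set" where
  "ae_class M f = {g \<in> borel_measurable M. AE x in M. g x = f x}"

definition ae_rep :: "('a \<Rightarrow> real) set \<Rightarrow> 'a \<Rightarrow> real" where
  "ae_rep F = (SOME f. f \<in> F)"

definition ae_add :: "'a measure \<Rightarrow> ('a \<Rightarrow> real) set \<Rightarrow> ('a \<Rightarrow> real) set \<Rightarrow> ('a \<Rightarrow> real) set" where
  "ae_add M F G = ae_class M (\<lambda>x. ae_rep F x + ae_rep G x)"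

definition ae_scale :: "'a measure \<Rightarrow> real \<Rightarrow> ('a \<Rightarrow> real) set \<Rightarrow> ('a \<Rightarrow> real) set" where
  "ae_scale M a F = ae_class M (\<lambda>x. a * ae_rep F x)"

definition Linf_space :: "'a measure \<Rightarrow> ('a \<Rightarrow> real) set set" where
  "Linf_space M = ae_class M ` {f \<in> borel_measurable M. \<exists>K. AE x in M. \<bar>f x\<bar> \<le> K}"

definition Linf_dist :: "'a measure \<Rightarrow> ('a \<Rightarrow> real) set \<Rightarrow> ('a \<Rightarrow> real) set \<Rightarrow> real" where
  "Linf_dist M F G = real_of_ereal (esssup M (\<lambda>x. ereal \<bar>ae_rep F x - ae_rep G x\<bar>))"

definition square_integrable :: "'a measure \<Rightarrow> ('a \<Rightarrow> real) \<Rightarrow> bool" where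
  "square_integrable M f \<longleftrightarrow> f \<in> borel_measurable M \<and> integrable M (\<lambda>x. (f x)\<^sup>2)"

definition L2_space :: "'a measure \<Rightarrow> ('a \<Rightarrow> real) set set" where
  "L2_space M = ae_class M ` {f. square_integrable M f}"

definition L2_norm :: "'a measure \<Rightarrow> ('a \<Rightarrow> real) set \<Rightarrow> real" where
  "L2_norm M F = sqrt (LINT x|M. (ae_rep F x)\<^sup>2)"

definition L2_dist :: "'a measure \<Rightarrow> ('a \<Rightarrow> real) set \<Rightarrow> ('a \<Rightarrow> real) set \<Rightarrow> real" where
  "L2_dist M F G = sqrt (LINT x|M. (ae_rep F x - ae_rep G x)\<^sup>2)"

definition L2_operators ::
    "'a measure \<Rightarrow> (('a \<Rightarrow> real) set \<Rightarrow> ('a \<Rightarrow> real) set) set" where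
  "L2_operators M = {B \<in> L2_space M \<rightarrow>\<^sub>E L2_space M.
     (\<forall>F\<in>L2_space M. \<forall>G\<in>L2_space M. B (ae_add M F G) = ae_add M (B F) (B G)) \<and>
     (\<forall>a. \<forall>F\<in>L2_space M. B (ae_scale M a F) = ae_scale M a (B F)) \<and>
     (\<exists>K. \<forall>F\<in>L2_space M. L2_norm M (B F) \<le> K * L2_norm M F)}"

(* The operator norm of A - B. The supremum is taken in [0,\<infinity>] so that the function is
   nonnegative on all arguments, as locale Metric_space demands; on L2_operators it is finite.
   The class 0 contributes 0 / 0 = 0. *)
definition op_dist :: "'a measure \<Rightarrow> (('a \<Rightarrow> real) set \<Rightarrow> ('a \<Rightarrow> real) set)
    \<Rightarrow> (('a \<Rightarrow> real) set \<Rightarrow> ('a \<Rightarrow> real) set) \<Rightarrow> real" where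
  "op_dist M A B =
     enn2real (SUP F\<in>L2_space M. ennreal (L2_dist M (A F) (B F) / L2_norm M F))"


section \<open>Domains\<close>

(* Borel measurable representatives suffice, since every Lebesgue measurable function is
   almost everywhere equal to a Borel measurable one. *)

definition halfline :: "real measure" where
  "halfline = restrict_space lborel {0..}"

definition time_interval :: "real \<Rightarrow> real measure" where
  "time_interval T = restrict_space lborel {0<..<2 * T}"

definition strip :: "real \<Rightarrow> (real \<times> real) measure" where
  "strip T = restrict_space lborel ({0<..<2 * T} \<times> {0<..})"


section \<open>Velocity functions\<close>

definition half_deriv :: "(real \<Rightarrow> real) \<Rightarrow> real \<Rightarrow> real" where
  "half_deriv g x = vector_derivative g (at x within {0..})"

definition C2_halfline :: "(real \<Rightarrow> real) set" where
  "C2_halfline = {g. g differentiable_on {0..} \<and> half_deriv g differentiable_on {0..} \<and>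
     continuous_on {0..} (half_deriv (half_deriv g)) \<and>
     (\<forall>k\<le>2. bounded ((half_deriv ^^ k) g ` {0..}))}"

definition C2_norm :: "(real \<Rightarrow> real) \<Rightarrow> real" where
  "C2_norm g = (\<Sum>k\<le>2. SUP x\<in>{0..}. \<bar>(half_deriv ^^ k) g x\<bar>)"

definition C2_compact :: "real \<Rightarrow> (real \<Rightarrow> real) set" where
  "C2_compact L = {g \<in> C2_halfline. \<exists>K. compact K \<and> K \<subseteq> {0<..<L} \<and> (\<forall>x\<in>{0..} - K. g x = 0)}"

definition wave_speeds :: "real \<Rightarrow> real \<Rightarrow> real \<Rightarrow> real \<Rightarrow> (real \<Rightarrow> real) set set" where
  "wave_speeds C0 C1 L m = {F \<in> Linf_space halfline. \<exists>c. F = ae_class halfline c \<and>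
     (\<forall>x\<ge>0. C0 \<le> c x \<and> c x \<le> C1) \<and> c \<in> C2_halfline \<and> C2_norm c \<le> m \<and>
     (\<lambda>x. c x - 1) \<in> C2_compact L}"


section \<open>The Sobolev space on the space-time strip and traces\<close>

definition part_t :: "(real \<times> real \<Rightarrow> real) \<Rightarrow> real \<times> real \<Rightarrow> real" where
  "part_t \<phi> = (\<lambda>(t, x). deriv (\<lambda>s. \<phi> (s, x)) t)"

definition part_x :: "(real \<times> real \<Rightarrow> real) \<Rightarrow> real \<times> real \<Rightarrow> real" where
  "part_x \<phi> = (\<lambda>(t, x). deriv (\<lambda>y. \<phi> (t, y)) x)"

definition C1_test :: "(real \<times> real) set \<Rightarrow> (real \<times> real \<Rightarrow> real) set" where
  "C1_test U = {\<phi>. \<phi> differentiable_on UNIV \<and> continuous_on UNIV (part_t \<phi>) \<and>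
     continuous_on UNIV (part_x \<phi>) \<and> (\<exists>K. compact K \<and> K \<subseteq> U \<and> (\<forall>z. z \<notin> K \<longrightarrow> \<phi> z = 0))}"

(* u is in H^1((0,2T) x M) with weak derivatives ut, ux. *)
definition H1_strip :: "real \<Rightarrow> (real \<times> real \<Rightarrow> real) \<Rightarrow> (real \<times> real \<Rightarrow> real)
    \<Rightarrow> (real \<times> real \<Rightarrow> real) \<Rightarrow> bool" where
  "H1_strip T u ut ux \<longleftrightarrow>
     square_integrable (strip T) u \<and> square_integrable (strip T) ut \<and>
     square_integrable (strip T) ux \<and>
     (\<forall>\<phi>\<in>C1_test ({0<..<2 * T} \<times> {0<..}).
        (LINT z|strip T. u z * part_t \<phi> z) = - (LINT z|strip T. ut z * \<phi> z) \<and>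
        (LINT z|strip T. u z * part_x \<phi> z) = - (LINT z|strip T. ux z * \<phi> z))"

(* The trace operator is the continuous extension, from H^1 to L^2 of the edge parametrized
   by e, of restriction of functions that are smooth up to the boundary. *)
definition has_trace :: "real \<Rightarrow> (real \<times> real \<Rightarrow> real) \<Rightarrow> (real \<times> real \<Rightarrow> real)
    \<Rightarrow> (real \<times> real \<Rightarrow> real) \<Rightarrow> real measure \<Rightarrow> (real \<Rightarrow> real \<times> real) \<Rightarrow> (real \<Rightarrow> real) \<Rightarrow> bool" where
  "has_trace T u ut ux E e g \<longleftrightarrow> H1_strip T u ut ux \<and> square_integrable E g \<and>
     (\<exists>\<phi> :: nat \<Rightarrow> real \<times> real \<Rightarrow> real. (\<forall>n. \<phi> n \<in> C1_test UNIV) \<and>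
        (\<lambda>n. LINT z|strip T. (\<phi> n z - u z)\<^sup>2 + (part_t (\<phi> n) z - ut z)\<^sup>2
                              + (part_x (\<phi> n) z - ux z)\<^sup>2) \<longlonglongrightarrow> 0 \<and>
        (\<lambda>n. LINT s|E. (\<phi> n (e s) - g s)\<^sup>2) \<longlonglongrightarrow> 0)"


section \<open>The wave equation and the Neumann-to-Dirichlet operator\<close>

(* Weak form of  c^{-2} u_tt - u_xx = 0,  u_x(t,0) = f(t),  u(0,x) = u_t(0,x) = 0.
   Multiply by a test function that vanishes near t = 2T but not necessarily at t = 0 or x = 0
   and integrate by parts: the boundary integral at x = 0 carries f, the one at t = 0 drops out
   because u_t(0,x) = 0. The condition u(0,x) = 0 is imposed as a trace. *)
definition wave_solution :: "real \<Rightarrow> (real \<Rightarrow> real) \<Rightarrow> (real \<Rightarrow> real) \<Rightarrow> (real \<times> real \<Rightarrow> real)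
    \<Rightarrow> (real \<times> real \<Rightarrow> real) \<Rightarrow> (real \<times> real \<Rightarrow> real) \<Rightarrow> bool" where
  "wave_solution T c f u ut ux \<longleftrightarrow> H1_strip T u ut ux \<and>
     has_trace T u ut ux halfline (\<lambda>x. (0, x)) (\<lambda>x. 0) \<and>
     (\<forall>\<phi>\<in>C1_test ({..<2 * T} \<times> UNIV).
        (LINT z|strip T. ux z * part_x \<phi> z - ut z * part_t \<phi> z / (c (snd z))\<^sup>2)
        + (LINT t|time_interval T. f t * \<phi> (t, 0)) = 0)"

definition nd_operator :: "real \<Rightarrow> (real \<Rightarrow> real) \<Rightarrow> (real \<Rightarrow> real) set \<Rightarrow> (real \<Rightarrow> real) set" where
  "nd_operator T c = (\<lambda>F\<in>L2_space (time_interval T).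
     THE G. \<exists>u ut ux g. wave_solution T c (ae_rep F) u ut ux \<and>
       has_trace T u ut ux (time_interval T) (\<lambda>t. (t, 0)) g \<and> G = ae_class (time_interval T) g)"

(* The weak form sees c only under an integral, so the choice of representative is immaterial. *)
definition nd_map :: "real \<Rightarrow> (real \<Rightarrow> real) set \<Rightarrow> (real \<Rightarrow> real) set \<Rightarrow> (real \<Rightarrow> real) set" where
  "nd_map T C = nd_operator T (ae_rep C)"


section \<open>The metric spaces\<close>

lemma ae_rep_class:
  assumes "f \<in> borel_measurable M"
  shows "ae_rep (ae_class M f) \<in> borel_measurable M"
    and "AE x in M. ae_rep (ae_class M f) x = f x"
proof -
  have "f \<in> ae_class M f"
    using assms by (simp add: ae_class_def)
  then have "ae_rep (ae_class M f) \<in> ae_class M f"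
    unfolding ae_rep_def by (metis someI)
  then show "ae_rep (ae_class M f) \<in> borel_measurable M"
    and "AE x in M. ae_rep (ae_class M f) x = f x"
    by (auto simp: ae_class_def)
qed

lemma ae_class_eq_iff:
  assumes "f \<in> borel_measurable M" "g \<in> borel_measurable M"
  shows "ae_class M f = ae_class M g \<longleftrightarrow> (AE x in M. f x = g x)"
proof
  assume "ae_class M f = ae_class M g"
  moreover have "f \<in> ae_class M f"
    using assms by (simp add: ae_class_def)
  ultimately show "AE x in M. f x = g x"
    by (auto simp: ae_class_def)
next
  assume "AE x in M. f x = g x"
  then show "ae_class M f = ae_class M g"
    unfolding ae_class_def by (auto elim!: AE_mp)
qed

lemma Linf_spaceD:
  assumes "F \<in> Linf_space M"
  obtains K where "ae_rep F \<in> borel_measurable M" "AE x in M. \<bar>ae_rep F x\<bar> \<le> K"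
    "F = ae_class M (ae_rep F)"
proof -
  obtain f K where f: "f \<in> borel_measurable M" "AE x in M. \<bar>f x\<bar> \<le> K" "F = ae_class M f"
    using assms by (auto simp: Linf_space_def)
  note r = ae_rep_class[OF f(1)]
  show thesis
  proof
    show "ae_rep F \<in> borel_measurable M" using r f by simp
    show "AE x in M. \<bar>ae_rep F x\<bar> \<le> K"
      using r(2) f(2) unfolding f(3) by eventually_elim simp
    have "ae_class M (ae_rep F) = ae_class M f"
      using r f by (subst ae_class_eq_iff) auto
    then show "F = ae_class M (ae_rep F)" using f(3) by simp
  qed
qed

lemma Linf_dist_nonneg: "0 \<le> Linf_dist M F G"
proof (cases "emeasure M (space M) = 0")
  case True
  have "Linf_dist M F G = 0"
  proof (cases "(\<lambda>x. ereal \<bar>ae_rep F x - ae_rep G x\<bar>) \<in> borel_measurable M")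
    case True
    with \<open>emeasure M (space M) = 0\<close> show ?thesis
      by (simp add: Linf_dist_def esssup_zero_space)
  next
    case False
    then show ?thesis
      by (simp add: Linf_dist_def esssup_non_measurable top_ereal_def)
  qed
  then show ?thesis by simp
next
  case False
  have "esssup M (\<lambda>x. 0 :: ereal) \<le> esssup M (\<lambda>x. ereal \<bar>ae_rep F x - ae_rep G x\<bar>)"
    by (rule esssup_mono) auto
  with False show ?thesis
    unfolding Linf_dist_def by (intro real_of_ereal_pos) (simp add: esssup_const)
qed

lemma Linf_dist_bound:
  assumes "F \<in> Linf_space M" "G \<in> Linf_space M"
  shows "AE x in M. \<bar>ae_rep F x - ae_rep G x\<bar> \<le> Linf_dist M F G"
proof -
  obtain K1 where F: "ae_rep F \<in> borel_measurable M" "AE x in M. \<bar>ae_rep F x\<bar> \<le> K1"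
    using assms Linf_spaceD by metis
  obtain K2 where G: "ae_rep G \<in> borel_measurable M" "AE x in M. \<bar>ae_rep G x\<bar> \<le> K2"
    using assms Linf_spaceD by metis
  define e where "e = esssup M (\<lambda>x. ereal \<bar>ae_rep F x - ae_rep G x\<bar>)"
  have "AE x in M. ereal \<bar>ae_rep F x - ae_rep G x\<bar> \<le> ereal (K1 + K2)"
    using F(2) G(2) by eventually_elim simp
  then have "e \<le> ereal (K1 + K2)"
    unfolding e_def using F G by (intro esssup_I) auto
  moreover have ae: "AE x in M. ereal \<bar>ae_rep F x - ae_rep G x\<bar> \<le> e"
    unfolding e_def by (rule esssup_AE)
  ultimately show ?thesis
    using ae unfolding Linf_dist_def e_def[symmetric] by (cases e) auto
qed

lemma Linf_dist_le:
  assumes "F \<in> Linf_space M" "G \<in> Linf_space M" "0 \<le> K"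
    and "AE x in M. \<bar>ae_rep F x - ae_rep G x\<bar> \<le> K"
  shows "Linf_dist M F G \<le> K"
proof -
  have "ae_rep F \<in> borel_measurable M" "ae_rep G \<in> borel_measurable M"
    using assms Linf_spaceD by metis+
  then have "esssup M (\<lambda>x. ereal \<bar>ae_rep F x - ae_rep G x\<bar>) \<le> ereal K"
    using assms(4) by (intro esssup_I) auto
  then show ?thesis
    unfolding Linf_dist_def using assms(3) by (simp add: real_le_ereal_iff real_of_ereal_le_0
      ereal_real' flip: real_of_ereal.simps(1))
qed

lemma Metric_space_Linf: "Metric_space (Linf_space M) (Linf_dist M)"
proof
  show "0 \<le> Linf_dist M F G" for F G
    by (rule Linf_dist_nonneg)
  show "Linf_dist M F G = Linf_dist M G F" for F G
    by (simp add: Linf_dist_def abs_minus_commute)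
next
  fix F G assume FG: "F \<in> Linf_space M" "G \<in> Linf_space M"
  obtain K1 where F: "ae_rep F \<in> borel_measurable M" "F = ae_class M (ae_rep F)"
    using FG Linf_spaceD by metis
  obtain K2 where G: "ae_rep G \<in> borel_measurable M" "G = ae_class M (ae_rep G)"
    using FG Linf_spaceD by metis
  show "Linf_dist M F G = 0 \<longleftrightarrow> F = G"
  proof
    assume "Linf_dist M F G = 0"
    then have "AE x in M. ae_rep F x = ae_rep G x"
      using Linf_dist_bound[OF FG] by (auto elim: AE_mp)
    then show "F = G"
      using F G ae_class_eq_iff by metis
  next
    assume "F = G"
    then have "Linf_dist M F G \<le> 0"
      using FG by (intro Linf_dist_le) auto
    then show "Linf_dist M F G = 0"
      using Linf_dist_nonneg[of M F G] by simp
  qed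
next
  fix F G H assume A: "F \<in> Linf_space M" "G \<in> Linf_space M" "H \<in> Linf_space M"
  show "Linf_dist M F H \<le> Linf_dist M F G + Linf_dist M G H"
  proof (rule Linf_dist_le[OF A(1,3)])
    show "0 \<le> Linf_dist M F G + Linf_dist M G H"
      by (simp add: Linf_dist_nonneg)
    show "AE x in M. \<bar>ae_rep F x - ae_rep H x\<bar> \<le> Linf_dist M F G + Linf_dist M G H"
      using Linf_dist_bound[OF A(1,2)] Linf_dist_bound[OF A(2,3)]
      by eventually_elim linarith
  qed
qed

lemma square_integrable_mult:
  assumes "square_integrable M f" "square_integrable M g"
  shows "integrable M (\<lambda>x. f x * g x)"
proof (rule Bochner_Integration.integrable_bound)
  show "integrable M (\<lambda>x. (f x)\<^sup>2 + (g x)\<^sup>2)"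
    using assms by (simp add: square_integrable_def)
  show "(\<lambda>x. f x * g x) \<in> borel_measurable M"
    using assms by (auto simp: square_integrable_def)
  have "\<bar>f x * g x\<bar> \<le> (f x)\<^sup>2 + (g x)\<^sup>2" for x
  proof -
    have "2 * \<bar>f x\<bar> * \<bar>g x\<bar> \<le> \<bar>f x\<bar>\<^sup>2 + \<bar>g x\<bar>\<^sup>2"
      by (rule sum_squares_bound)
    moreover have "0 \<le> \<bar>f x\<bar> * \<bar>g x\<bar>" by simp
    ultimately have "\<bar>f x\<bar> * \<bar>g x\<bar> \<le> (f x)\<^sup>2 + (g x)\<^sup>2" unfolding power2_abs by linarith
    then show ?thesis by (simp add: abs_mult)
  qed
  then show "AE x in M. norm (f x * g x) \<le> norm ((f x)\<^sup>2 + (g x)\<^sup>2)"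
    by simp
qed

lemma square_integrable_add:
  assumes "square_integrable M f" "square_integrable M g"
  shows "square_integrable M (\<lambda>x. f x + g x)"
  using square_integrable_mult[OF assms] assms
  by (auto simp: square_integrable_def power2_sum mult.assoc)

lemma square_integrable_diff:
  assumes "square_integrable M f" "square_integrable M g"
  shows "square_integrable M (\<lambda>x. f x - g x)"
  using square_integrable_mult[OF assms] assms
  by (auto simp: square_integrable_def power2_diff mult.assoc)

lemma L2_triangle:
  assumes f: "square_integrable M f" and g: "square_integrable M g"
  shows "sqrt (LINT x|M. (f x + g x)\<^sup>2) \<le> sqrt (LINT x|M. (f x)\<^sup>2) + sqrt (LINT x|M. (g x)\<^sup>2)"
proof -
  define a b d where "a = (LINT x|M. (f x)\<^sup>2)" and "b = (LINT x|M. (g x)\<^sup>2)"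
    and "d = (LINT x|M. f x * g x)"
  have int: "integrable M (\<lambda>x. (f x)\<^sup>2)" "integrable M (\<lambda>x. (g x)\<^sup>2)"
    "integrable M (\<lambda>x. f x * g x)"
    using f g square_integrable_mult by (auto simp: square_integrable_def)
  have ab: "0 \<le> a" "0 \<le> b"
    unfolding a_def b_def by auto
  have quad: "0 \<le> s\<^sup>2 * a - 2 * s * r * d + r\<^sup>2 * b" for s r
  proof -
    have "0 \<le> (LINT x|M. (s * f x - r * g x)\<^sup>2)" by simp
    also have "\<dots> = (LINT x|M. s\<^sup>2 * (f x)\<^sup>2 - 2 * s * r * (f x * g x) + r\<^sup>2 * (g x)\<^sup>2)"
      by (rule arg_cong[where f = "integral\<^sup>L M"]) (simp add: power2_eq_square algebra_simps fun_eq_iff)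
    also have "\<dots> = s\<^sup>2 * a - 2 * s * r * d + r\<^sup>2 * b"
      unfolding a_def b_def d_def using int by simp
    finally show ?thesis .
  qed
  have "d \<le> sqrt a * sqrt b"
  proof (cases "a = 0 \<or> b = 0")
    case True
    have "d \<le> 0"
    proof (rule ccontr)
      assume "\<not> d \<le> 0"
      then have d: "d > 0" by simp
      define s r where "s = (b + 1) / d" and "r = (a + 1) / d"
      have cancel: "s * d = b + 1" "r * d = a + 1" using d by (simp_all add: s_def r_def)
      from True show False
      proof
        assume "a = 0"
        then show False
          using quad[of s 1] cancel ab by (simp add: mult.assoc)
      next
        assume "b = 0"
        then show False
          using quad[of 1 r] cancel ab by (simp add: mult.assoc)
      qed
    qed
    with True show ?thesis using ab by auto
  next
    case False
    then have pos: "0 < sqrt a" "0 < sqrt b" using ab by auto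
    have "0 \<le> 2 * (sqrt a * sqrt b) * (sqrt a * sqrt b - d)"
      using quad[of "sqrt b" "sqrt a"] ab by (simp add: algebra_simps)
    then show ?thesis
      using mult_pos_pos[OF pos] by (simp add: zero_le_mult_iff)
  qed
  moreover have "(LINT x|M. (f x + g x)\<^sup>2) = a + 2 * d + b"
  proof -
    have "(LINT x|M. (f x + g x)\<^sup>2) = (LINT x|M. (f x)\<^sup>2 + 2 * (f x * g x) + (g x)\<^sup>2)"
      by (rule arg_cong[where f = "integral\<^sup>L M"]) (simp add: power2_eq_square algebra_simps fun_eq_iff)
    then show ?thesis
      unfolding a_def b_def d_def using int by simp
  qed
  ultimately have "(LINT x|M. (f x + g x)\<^sup>2) \<le> (sqrt a + sqrt b)\<^sup>2"
    using ab by (simp add: power2_sum)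
  then show ?thesis
    unfolding a_def[symmetric] b_def[symmetric] using ab by (intro real_le_lsqrt) auto
qed

lemma L2_spaceD:
  assumes "F \<in> L2_space M"
  shows "square_integrable M (ae_rep F)" "F = ae_class M (ae_rep F)"
proof -
  obtain f where f: "square_integrable M f" "F = ae_class M f"
    using assms by (auto simp: L2_space_def)
  then have m: "f \<in> borel_measurable M" by (simp add: square_integrable_def)
  note r = ae_rep_class[OF m]
  have "integrable M (\<lambda>x. (ae_rep F x)\<^sup>2) \<longleftrightarrow> integrable M (\<lambda>x. (f x)\<^sup>2)"
    using r m unfolding f(2) by (intro integrable_cong_AE) auto
  then show "square_integrable M (ae_rep F)"
    using f r by (simp add: square_integrable_def)
  have "ae_class M (ae_rep F) = ae_class M f"
    using r m f by (subst ae_class_eq_iff) auto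
  then show "F = ae_class M (ae_rep F)" using f(2) by simp
qed

lemma L2_dist_eq_0:
  assumes "F \<in> L2_space M" "G \<in> L2_space M"
  shows "L2_dist M F G = 0 \<longleftrightarrow> F = G"
proof -
  note F = L2_spaceD[OF assms(1)] and G = L2_spaceD[OF assms(2)]
  have "L2_dist M F G = 0 \<longleftrightarrow> (LINT x|M. (ae_rep F x - ae_rep G x)\<^sup>2) = 0"
    by (simp add: L2_dist_def)
  also have "\<dots> \<longleftrightarrow> (AE x in M. (ae_rep F x - ae_rep G x)\<^sup>2 = 0)"
    using square_integrable_diff[OF F(1) G(1)]
    by (intro integral_nonneg_eq_0_iff_AE) (auto simp: square_integrable_def)
  also have "\<dots> \<longleftrightarrow> ae_class M (ae_rep F) = ae_class M (ae_rep G)"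
    using F(1) G(1) by (subst ae_class_eq_iff) (auto simp: square_integrable_def)
  finally show ?thesis using F(2) G(2) by simp
qed

lemma L2_dist_triangle:
  assumes "F \<in> L2_space M" "G \<in> L2_space M" "H \<in> L2_space M"
  shows "L2_dist M F H \<le> L2_dist M F G + L2_dist M G H"
proof -
  note s = assms[THEN L2_spaceD(1)]
  show ?thesis
    using L2_triangle[OF square_integrable_diff[OF s(1,2)] square_integrable_diff[OF s(2,3)]]
    by (simp add: L2_dist_def)
qed

lemma L2_dist_le_norms:
  assumes "F \<in> L2_space M" "G \<in> L2_space M"
  shows "L2_dist M F G \<le> L2_norm M F + L2_norm M G"
proof -
  note s = assms[THEN L2_spaceD(1)]
  have "square_integrable M (\<lambda>x. - ae_rep G x)"
    using s(2) by (simp add: square_integrable_def)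
  from L2_triangle[OF s(1) this] show ?thesis
    by (simp add: L2_dist_def L2_norm_def)
qed

lemma L2_dist_nonneg [simp]: "0 \<le> L2_dist M F G"
  by (simp add: L2_dist_def)

lemma L2_norm_nonneg [simp]: "0 \<le> L2_norm M F"
  by (simp add: L2_norm_def)

lemma op_bound_finite:
  assumes "A \<in> L2_operators M" "B \<in> L2_operators M"
  shows "(SUP F\<in>L2_space M. ennreal (L2_dist M (A F) (B F) / L2_norm M F)) < top"
proof -
  obtain K1 where K1: "\<forall>F\<in>L2_space M. L2_norm M (A F) \<le> K1 * L2_norm M F"
    using assms(1) by (auto simp: L2_operators_def)
  obtain K2 where K2: "\<forall>F\<in>L2_space M. L2_norm M (B F) \<le> K2 * L2_norm M F"
    using assms(2) by (auto simp: L2_operators_def)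
  have "(SUP F\<in>L2_space M. ennreal (L2_dist M (A F) (B F) / L2_norm M F)) \<le> ennreal \<bar>K1 + K2\<bar>"
  proof (rule SUP_least, rule ennreal_leI)
    fix F assume F: "F \<in> L2_space M"
    then have "A F \<in> L2_space M" "B F \<in> L2_space M"
      using assms by (auto simp: L2_operators_def)
    from L2_dist_le_norms[OF this] bspec[OF K1 F] bspec[OF K2 F]
    have "L2_dist M (A F) (B F) \<le> (K1 + K2) * L2_norm M F"
      by (simp add: distrib_right)
    also have "\<dots> \<le> \<bar>K1 + K2\<bar> * L2_norm M F"
      by (intro mult_right_mono) auto
    finally show "L2_dist M (A F) (B F) / L2_norm M F \<le> \<bar>K1 + K2\<bar>"
      by (cases "L2_norm M F = 0") (auto simp: pos_divide_le_eq less_le)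
  qed
  then show ?thesis
    by (rule le_less_trans) simp
qed

lemma L2_norm_eq_0_operator:
  assumes "A \<in> L2_operators M" "F \<in> L2_space M" "L2_norm M F = 0"
  shows "L2_norm M (A F) = 0"
proof -
  obtain K where "L2_norm M (A F) \<le> K * L2_norm M F"
    using assms by (auto simp: L2_operators_def)
  then show ?thesis
    using assms(3) L2_norm_nonneg[of M "A F"] by simp
qed

lemma op_dist_bound:
  assumes A: "A \<in> L2_operators M" and B: "B \<in> L2_operators M" and F: "F \<in> L2_space M"
  shows "L2_dist M (A F) (B F) \<le> op_dist M A B * L2_norm M F"
proof (cases "L2_norm M F = 0")
  case True
  have "A F \<in> L2_space M" "B F \<in> L2_space M"
    using assms by (auto simp: L2_operators_def)
  from L2_dist_le_norms[OF this] True show ?thesis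
    using L2_norm_eq_0_operator[OF A F True] L2_norm_eq_0_operator[OF B F True] by simp
next
  case False
  then have pos: "0 < L2_norm M F"
    using L2_norm_nonneg[of M F] by linarith
  have "ennreal (L2_dist M (A F) (B F) / L2_norm M F)
      \<le> (SUP F\<in>L2_space M. ennreal (L2_dist M (A F) (B F) / L2_norm M F))"
    using F by (rule SUP_upper)
  from enn2real_mono[OF this op_bound_finite[OF A B]]
  have "L2_dist M (A F) (B F) / L2_norm M F \<le> op_dist M A B"
    using pos by (simp add: op_dist_def)
  then show ?thesis
    using pos by (simp add: pos_divide_le_eq)
qed

lemma op_dist_le:
  assumes "0 \<le> K" "\<And>F. F \<in> L2_space M \<Longrightarrow> L2_dist M (A F) (B F) \<le> K * L2_norm M F"
  shows "op_dist M A B \<le> K"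
proof -
  have "(SUP F\<in>L2_space M. ennreal (L2_dist M (A F) (B F) / L2_norm M F)) \<le> ennreal K"
  proof (rule SUP_least, rule ennreal_leI)
    fix F assume "F \<in> L2_space M"
    from assms(2)[OF this] show "L2_dist M (A F) (B F) / L2_norm M F \<le> K"
      using assms(1) by (cases "L2_norm M F = 0") (auto simp: pos_divide_le_eq less_le)
  qed
  then show ?thesis
    unfolding op_dist_def using assms(1) by (metis enn2real_leI)
qed

lemma Metric_space_L2_operators: "Metric_space (L2_operators M) (op_dist M)"
proof
  show "0 \<le> op_dist M A B" for A B
    by (simp add: op_dist_def)
  have "L2_dist M F G = L2_dist M G F" for F G
    by (simp add: L2_dist_def power2_commute)
  then show "op_dist M A B = op_dist M B A" for A B
    by (simp add: op_dist_def)
next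
  fix A B assume AB: "A \<in> L2_operators M" "B \<in> L2_operators M"
  then have mem: "A F \<in> L2_space M" "B F \<in> L2_space M" if "F \<in> L2_space M" for F
    using that by (auto simp: L2_operators_def)
  show "op_dist M A B = 0 \<longleftrightarrow> A = B"
  proof
    assume 0: "op_dist M A B = 0"
    show "A = B"
    proof (rule PiE_ext)
      show "A \<in> L2_space M \<rightarrow>\<^sub>E L2_space M" "B \<in> L2_space M \<rightarrow>\<^sub>E L2_space M"
        using AB by (auto simp: L2_operators_def)
      fix F assume F: "F \<in> L2_space M"
      have "L2_dist M (A F) (B F) = 0"
        using op_dist_bound[OF AB F] 0 by (simp add: antisym)
      then show "A F = B F"
        using L2_dist_eq_0 mem[OF F] by metis
    qed
  next
    assume "A = B"
    then have "op_dist M A B \<le> 0"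
      by (intro op_dist_le) (auto simp: L2_dist_def)
    then show "op_dist M A B = 0"
      by (simp add: op_dist_def antisym)
  qed
next
  fix A B D assume ABD: "A \<in> L2_operators M" "B \<in> L2_operators M" "D \<in> L2_operators M"
  show "op_dist M A D \<le> op_dist M A B + op_dist M B D"
  proof (rule op_dist_le)
    show "0 \<le> op_dist M A B + op_dist M B D"
      by (simp add: op_dist_def)
    fix F assume F: "F \<in> L2_space M"
    then have "A F \<in> L2_space M" "B F \<in> L2_space M" "D F \<in> L2_space M"
      using ABD by (auto simp: L2_operators_def)
    from L2_dist_triangle[OF this] op_dist_bound[OF ABD(1,2) F] op_dist_bound[OF ABD(2,3) F]
    show "L2_dist M (A F) (D F) \<le> (op_dist M A B + op_dist M B D) * L2_norm M F"
      by (simp add: distrib_right)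
  qed
qed

definition X_topology :: "(real \<Rightarrow> real) set topology" where
  "X_topology = Metric_space.mtopology (Linf_space halfline) (Linf_dist halfline)"

definition Y_topology :: "real \<Rightarrow> ((real \<Rightarrow> real) set \<Rightarrow> (real \<Rightarrow> real) set) topology" where
  "Y_topology T = Metric_space.mtopology (L2_operators (time_interval T)) (op_dist (time_interval T))"

end

theory Submission
  imports Defs
begin

text \<open>Let \<open>\<theta>(x)\<close> be the travel time from the boundary to \<open>x\<close>, \<open>\<kappa> = sqrt c\<close> and \<open>a = \<partial>\<^sub>y ln c\<close> with
  \<open>y = \<theta>(x)\<close>. In the coordinates \<open>(\<xi>, y) = (t - \<theta>(x), \<theta>(x))\<close> the rescaled Riemann invariants
  \<open>W\<^sub>\<plusminus> = (u\<^sub>t \<plusminus> u\<^sub>y) / \<kappa>\<close> solve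
  \<open>\<partial>\<^sub>y W\<^sub>- = - a W\<^sub>+ / 2\<close>, \<open>(\<partial>\<^sub>y - 2 \<partial>\<^sub>\<xi>) W\<^sub>+ = - a W\<^sub>- / 2\<close> with \<open>W\<^sub>+ - W\<^sub>- = 2 f\<close> at \<open>y = 0\<close>. Since \<open>a\<close> does
  not depend on time, the causal solution is a convolution in \<open>\<xi>\<close>, \<open>W\<^sub>+ = G * f\<close> and
  \<open>W\<^sub>- = - 2 f + H * f\<close>, where the kernels solve a Volterra equation in \<open>\<xi>\<close> and \<open>G(0, y) = - a(y) / 2\<close>.
  This gives the weak solution for square integrable data, while testing with the time-reversed
  regular solutions shows that its boundary trace is unique.

  The operator \<open>\<Lambda>\<close> determines \<open>s = G(\<sqdot>, 0)\<close> on \<open>(0, 2T)\<close>: the second derivative of \<open>\<Lambda> 1\<close> is \<open>s\<close>, and \<open>s\<close> has a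
  Lipschitz constant that is uniform over the wave speeds, so \<open>s\<close> depends uniformly continuously on \<open>\<Lambda>\<close>.
  Continuing the kernels sideways, in the direction of \<open>y\<close>, from their common boundary values \<open>s\<close>
  recovers \<open>a\<close> from \<open>G(0, y) = - a(y) / 2\<close>; Gronwall's inequality in \<open>y\<close> bounds \<open>a\<^sub>1 - a\<^sub>2\<close> by
  \<open>s\<^sub>1 - s\<^sub>2\<close> on \<open>[0, 2L/C\<^sub>0]\<close>, and there \<open>2L/C\<^sub>0 < 2T\<close>. This is a modulus of continuity for the inverse map,
  which also yields injectivity.\<close>

section \<open>Calculus for oriented integrals with parameters\<close>

text \<open>The topology of Y controls only L2 sizes, while the boundary trace of the kernel lies
  two derivatives beyond \<open>\<Lambda> 1\<close>. The a priori bounds pay for these derivatives: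
  \<open>G\<close> is Lipschitz in time with a constant built from C0, C1, L, m and T alone, so
  smallness of an iterated primitive of the difference of two kernels forces smallness of the
  difference itself, through a third difference of step h. Reading the coefficient at depth y takes
  boundary values up to time 2y, and the third difference needs room 3h after that; the strict
  inequality T > L/C0 provides it. The kernel is only as regular as \<open>a\<close>, for which only
  a Lipschitz constant is uniform. Its equations are therefore kept as integral equations along
  characteristics, and every derivative of a solution falls on the data or on an endpoint of an
  integral. Hence regular data come first and square integrable data follow by density. Uniqueness
  is shown for the trace, which is all that the definition of the operator asks for; pairing with a
  dense set of data takes the place of an energy estimate.\<close>

abbreviation cont2 :: "('a::topological_space \<Rightarrow> 'b::topological_space \<Rightarrow> 'c::topological_space) \<Rightarrow> bool" where
  "cont2 k \<equiv> continuous_on UNIV (\<lambda>z. k (fst z) (snd z))"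

lemma cont2_compose:
  assumes "cont2 k" "continuous_on S f" "continuous_on S g"
  shows "continuous_on S (\<lambda>x. k (f x) (g x))"
proof -
  have "continuous_on S (\<lambda>x. (f x, g x))"
    using assms by (intro continuous_intros)
  from continuous_on_compose2[OF assms(1) this] show ?thesis by simp
qed

lemma cont2_compose1:
  fixes g :: "real \<Rightarrow> real"
  shows "continuous_on UNIV g \<Longrightarrow> continuous_on S f \<Longrightarrow> continuous_on S (\<lambda>x. g (f x))"
  by (rule continuous_on_compose2) auto

text \<open>Continuity of one partial derivative together with existence of the other gives a total
  derivative. This lets functions be differentiated along a characteristic, where both arguments
  move.\<close>

lemma has_derivative_pair:
  fixes F Fu Fv :: "real \<Rightarrow> real \<Rightarrow> real"
  assumes Fu: "\<And>u v. ((\<lambda>u. F u v) has_real_derivative Fu u v) (at u)"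
    and Fv: "\<And>u v. (F u has_real_derivative Fv u v) (at v)"
    and c: "cont2 Fv"
  shows "((\<lambda>z. F (fst z) (snd z)) has_derivative
      (\<lambda>z. Fu r s * fst z + Fv r s * snd z)) (at (r, s))"
proof -
  have "((\<lambda>(x, y). F x y) has_derivative
      (\<lambda>(tx, ty). Fu r s * tx + blinfun_apply (blinfun_mult_right (Fv r s)) ty))
      (at (r, s) within UNIV \<times> UNIV)"
  proof (rule has_derivative_partialsI)
    show "((\<lambda>x. F x s) has_derivative (*) (Fu r s)) (at r within UNIV)"
      using Fu[of s r] by (simp add: has_field_derivative_def)
    show "(F x has_derivative blinfun_apply (blinfun_mult_right (Fv x y))) (at y within UNIV)"
      for x y
      using Fv[of x y] by (simp add: has_field_derivative_def)
    have "continuous (at (r, s)) (\<lambda>z. Fv (fst z) (snd z))"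
      using c by (simp add: continuous_on_eq_continuous_at)
    then have "continuous (at (r, s)) (\<lambda>z. blinfun_mult_right (Fv (fst z) (snd z)))"
      by (rule bounded_linear.continuous[OF bounded_linear_blinfun_mult_right])
    then show "continuous (at (r, s) within UNIV \<times> UNIV) (\<lambda>(x, y). blinfun_mult_right (Fv x y))"
      by (simp add: case_prod_unfold)
  qed auto
  then show ?thesis
    by (simp add: case_prod_unfold)
qed

lemma chain2:
  fixes F Fu Fv :: "real \<Rightarrow> real \<Rightarrow> real"
  assumes Fu: "\<And>u v. ((\<lambda>u. F u v) has_real_derivative Fu u v) (at u)"
    and Fv: "\<And>u v. (F u has_real_derivative Fv u v) (at v)"
    and c: "cont2 Fv"
    and u: "(u has_real_derivative u') (at r)" and v: "(v has_real_derivative v') (at r)"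
  shows "((\<lambda>r. F (u r) (v r)) has_real_derivative Fu (u r) (v r) * u' + Fv (u r) (v r) * v') (at r)"
proof -
  have "((\<lambda>r. (u r, v r)) has_derivative (\<lambda>h. (u' * h, v' * h))) (at r)"
    using u v by (intro has_derivative_Pair) (auto simp: has_field_derivative_def)
  from has_derivative_compose[OF this has_derivative_pair[OF Fu Fv c]]
  have "((\<lambda>r. F (u r) (v r)) has_derivative
      (\<lambda>h. Fu (u r) (v r) * (u' * h) + Fv (u r) (v r) * (v' * h))) (at r)"
    by simp
  then show ?thesis
    unfolding has_field_derivative_def
    by (rule has_derivative_eq_rhs) (auto simp: algebra_simps)
qed

text \<open>The oriented integral of \<open>g\<close> from \<open>0\<close> to \<open>y\<close>, rescaled to a fixed interval so that the library
  theorems on parameter integrals also apply to a variable endpoint.\<close>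

definition prim :: "(real \<Rightarrow> real) \<Rightarrow> real \<Rightarrow> real" where
  "prim g y = integral {0..1} (\<lambda>\<theta>. y * g (y * \<theta>))"

lemma prim_continuous_on:
  fixes k :: "'p::topological_space \<Rightarrow> real \<Rightarrow> real"
  assumes k: "continuous_on (U \<times> UNIV) (\<lambda>z. k (fst z) (snd z))" and v: "continuous_on U v"
  shows "continuous_on U (\<lambda>p. prim (k p) (v p))"
proof -
  have v': "continuous_on (U \<times> cbox 0 (1::real)) (\<lambda>z. v (fst z))"
    by (rule continuous_on_compose2[OF v]) (auto intro!: continuous_intros)
  have p: "continuous_on (U \<times> cbox 0 1) (\<lambda>z. (fst z, v (fst z) * snd z))"
    by (intro continuous_intros v')
  have "(\<lambda>z. (fst z, v (fst z) * snd z)) ` (U \<times> cbox 0 1) \<subseteq> U \<times> UNIV"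
    by auto
  from continuous_on_compose2[OF k p this]
  have "continuous_on (U \<times> cbox 0 1) (\<lambda>z. k (fst z) (v (fst z) * snd z))"
    by simp
  with v' have "continuous_on (U \<times> cbox 0 1) (\<lambda>(p, \<theta>). v p * k p (v p * \<theta>))"
    unfolding case_prod_unfold by (intro continuous_intros)
  from integral_continuous_on_param[OF this] show ?thesis
    by (simp add: prim_def)
qed

text \<open>Both signs of y are covered by one formula. Every derivative is integrable in the
  Henstock-Kurzweil sense, so \<open>g\<close> may be any derivative.\<close>

lemma prim_FTC:
  assumes "\<And>s. (P has_real_derivative g s) (at s)"
  shows "prim g y = P y - P 0"
proof -
  have "((\<lambda>\<theta>. y * g (y * \<theta>)) has_integral (P (y * 1) - P (y * 0))) {0..1}"
  proof (rule fundamental_theorem_of_calculus)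
    fix \<theta> :: real assume "\<theta> \<in> {0..1}"
    have "((\<lambda>\<theta>. P (y * \<theta>)) has_real_derivative g (y * \<theta>) * y) (at \<theta>)"
      by (rule DERIV_chain2[OF assms]) (auto intro!: derivative_eq_intros)
    then show "((\<lambda>\<theta>. P (y * \<theta>)) has_vector_derivative y * g (y * \<theta>)) (at \<theta> within {0..1})"
      by (simp add: has_real_derivative_iff_has_vector_derivative[symmetric] mult.commute
        has_field_derivative_at_within)
  qed auto
  then show ?thesis
    unfolding prim_def by (simp only: mult_1_right mult_zero_right integral_unique)
qed

lemma prim_eq_integral:
  assumes g: "continuous_on {0..y} g" and "0 \<le> y"
  shows "prim g y = integral {0..y} g"
proof -
  have "((\<lambda>\<theta>. y *\<^sub>R g (y * \<theta>)) has_integral integral {y * 0..y * 1} g) {0..1}"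
  proof (rule has_integral_substitution)
    show "((\<lambda>\<theta>. y * \<theta>) has_field_derivative y) (at \<theta> within {0..1})" for \<theta>
      by (auto intro!: derivative_eq_intros)
    show "(\<lambda>\<theta>. y * \<theta>) ` {0..1} \<subseteq> {0..y}"
      using assms by (auto simp: mult_left_le)
  qed (use assms in auto)
  then have "((\<lambda>\<theta>. y * g (y * \<theta>)) has_integral integral {0..y} g) {0..1}"
    by simp
  then show ?thesis
    unfolding prim_def by (rule integral_unique)
qed

lemma prim_0 [simp]: "prim g 0 = 0"
  by (simp add: prim_def)

lemma prim_cong:
  assumes "\<And>s. s \<in> closed_segment 0 y \<Longrightarrow> g s = h s"
  shows "prim g y = prim h y"
  unfolding prim_def
proof (rule Henstock_Kurzweil_Integration.integral_cong)
  fix \<theta> :: real assume \<theta>: "\<theta> \<in> {0..1}"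
  have "y * \<theta> \<in> closed_segment 0 y"
    unfolding in_segment using \<theta> by (intro exI[of _ \<theta>]) auto
  then show "y * g (y * \<theta>) = y * h (y * \<theta>)"
    using assms by simp
qed

lemma prim_minus_arg: "prim g (- y) = - prim (\<lambda>s. g (- s)) y"
  by (simp add: prim_def)

lemma has_derivative_prim:
  assumes g: "continuous_on UNIV g"
  shows "(prim g has_real_derivative g y) (at y)"
proof -
  define R where "R = \<bar>y\<bar> + 1"
  have cont: "continuous_on S g" for S
    using g continuous_on_subset by blast
  \<comment> \<open>Moving the base point to -R puts y in the interior of one interval of
    integration, whatever its sign.\<close>
  have eq: "prim g z = integral {-R..z} g - integral {-R..0} g" if "z \<in> {-R<..<R}" for z
  proof (cases "0 \<le> z")
    case True
    have "integral {-R..0} g + integral {0..z} g = integral {-R..z} g"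
      using True by (intro Henstock_Kurzweil_Integration.integral_combine integrable_continuous_real cont)
        (auto simp: R_def)
    then show ?thesis using prim_eq_integral[OF cont True] by simp
  next
    case False
    have "integral {-R..z} g + integral {z..0} g = integral {-R..0} g"
      using False that by (intro Henstock_Kurzweil_Integration.integral_combine integrable_continuous_real cont) auto
    moreover have "prim g z = - prim (\<lambda>s. g (- s)) (- z)"
      using prim_minus_arg[of g "- z"] by simp
    moreover have "prim (\<lambda>s. g (- s)) (- z) = integral {0..-z} (\<lambda>s. g (- s))"
      using False by (intro prim_eq_integral continuous_on_compose2[OF g] continuous_intros) auto
    moreover have "integral {0..-z} (\<lambda>s. g (- s)) = integral {z..0} g"
      using Henstock_Kurzweil_Integration.integral_reflect_real[of 0 z g] by simp
    ultimately show ?thesis by simp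
  qed
  have "((\<lambda>z. integral {-R..z} g - integral {-R..0} g) has_real_derivative g y - 0) (at y within {-R..R})"
    by (intro derivative_intros integral_has_real_derivative cont) (auto simp: R_def)
  then have "((\<lambda>z. integral {-R..z} g - integral {-R..0} g) has_real_derivative g y) (at y)"
    by (subst (asm) at_within_interior) (auto simp: R_def)
  then show ?thesis
    by (rule has_field_derivative_transform_within_open[where S = "{-R<..<R}"])
       (auto simp: eq R_def)
qed

lemma has_derivative_prim_param:
  assumes k: "\<And>s. continuous_on UNIV (k s)"
    and d: "\<And>p s. ((\<lambda>p. k p s) has_real_derivative k' p s) (at p)" and c: "cont2 k'"
  shows "((\<lambda>p. prim (k p) y) has_real_derivative prim (k' p) y) (at p)"
proof -
  have "((\<lambda>p. integral (cbox 0 1) (\<lambda>\<theta>. y * k p (y * \<theta>))) has_real_derivative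
      integral (cbox 0 1) (\<lambda>\<theta>. y * k' p (y * \<theta>))) (at p within UNIV)"
  proof (rule leibniz_rule_field_derivative)
    show "((\<lambda>p. y * k p (y * \<theta>)) has_real_derivative y * k' p (y * \<theta>)) (at p within UNIV)" for p \<theta>
      by (intro DERIV_cmult) (simp add: d)
    show "(\<lambda>\<theta>. y * k p (y * \<theta>)) integrable_on cbox 0 1" for p
      by (intro integrable_continuous continuous_intros continuous_on_compose2[OF k]) auto
    show "continuous_on (UNIV \<times> cbox 0 1) (\<lambda>(p, \<theta>). y * k' p (y * \<theta>))"
      unfolding case_prod_unfold by (intro continuous_intros cont2_compose[OF c])
  qed auto
  then show ?thesis by (simp add: prim_def)
qed

lemma prim_add:
  assumes "continuous_on UNIV g" "continuous_on UNIV h"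
  shows "prim (\<lambda>s. g s + h s) y = prim g y + prim h y"
  using prim_FTC[of "\<lambda>y. prim g y + prim h y" "\<lambda>s. g s + h s" y]
    has_derivative_prim[OF assms(1)] has_derivative_prim[OF assms(2)]
  by (auto intro!: derivative_eq_intros)

lemma prim_cmult: "prim (\<lambda>s. c * g s) y = c * prim g y"
  unfolding prim_def by (simp add: mult.left_commute[of _ c])

lemma prim_uminus: "prim (\<lambda>s. - g s) y = - prim g y"
  using prim_cmult[of "-1" g y] by simp

lemma prim_diff:
  assumes "continuous_on UNIV g" "continuous_on UNIV h"
  shows "prim (\<lambda>s. g s - h s) y = prim g y - prim h y"
  using prim_add[of g "\<lambda>s. - h s" y] assms by (simp add: prim_uminus continuous_intros)

lemma prim_zero [simp]: "prim (\<lambda>s. 0) y = 0"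
  by (simp add: prim_def)

text \<open>Substitution in an oriented integral, with the factor on the left so that nothing is
  divided. \<open>b = 1\<close> translates, \<open>b = -1\<close> reflects, and \<open>b = 2\<close>
  or \<open>b = 1 / 2\<close> passes between time and depth along a characteristic.\<close>

lemma prim_affine:
  assumes g: "continuous_on UNIV g"
  shows "b * prim (\<lambda>s. g (b * s + c)) y = prim g (b * y + c) - prim g c"
proof -
  have "prim (\<lambda>s. b * g (b * s + c)) y = prim g (b * y + c) - prim g (b * 0 + c)"
  proof (rule prim_FTC)
    show "((\<lambda>s. prim g (b * s + c)) has_real_derivative b * g (b * s + c)) (at s)" for s
    proof -
      have "((\<lambda>s. b * s + c) has_real_derivative b) (at s)"
        by (auto intro!: derivative_eq_intros)
      from DERIV_chain2[OF has_derivative_prim[OF g, of "b * s + c"] this] show ?thesis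
        by (simp add: mult.commute)
    qed
  qed
  then show ?thesis by (simp add: prim_cmult)
qed

lemma prim_abs_le:
  assumes g: "continuous_on UNIV g" and h: "continuous_on UNIV h" and "0 \<le> y"
    and le: "\<And>s. 0 \<le> s \<Longrightarrow> s \<le> y \<Longrightarrow> \<bar>g s\<bar> \<le> h s"
  shows "\<bar>prim g y\<bar> \<le> prim h y"
proof -
  have c: "continuous_on S g" "continuous_on S h" for S
    using g h continuous_on_subset by blast+
  show ?thesis
    using integral_norm_bound_integral[of g "{0..y}" h] assms c
    by (simp add: prim_eq_integral integrable_continuous_real)
qed

lemma prim_const [simp]: "prim (\<lambda>s. c) y = c * y"
  by (simp add: prim_def)

lemma prim_abs_le_const:
  assumes g: "continuous_on UNIV g" and le: "\<And>s. s \<in> closed_segment 0 y \<Longrightarrow> \<bar>g s\<bar> \<le> N"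
  shows "\<bar>prim g y\<bar> \<le> N * \<bar>y\<bar>"
proof (cases "0 \<le> y")
  case True
  then have "\<bar>prim g y\<bar> \<le> prim (\<lambda>s. N) y"
    using g le by (intro prim_abs_le) (auto simp: closed_segment_eq_real_ivl)
  with True show ?thesis by simp
next
  case False
  then have "\<bar>prim (\<lambda>s. g (- s)) (- y)\<bar> \<le> prim (\<lambda>s. N) (- y)"
    using g le by (intro prim_abs_le cont2_compose1[OF g]) (auto simp: closed_segment_eq_real_ivl intro!: continuous_intros)
  with False show ?thesis
    using prim_minus_arg[of g "- y"] by simp
qed

lemma prim_exp:
  assumes "l \<noteq> 0"
  shows "prim (\<lambda>s. exp (l * s)) y = (exp (l * y) - 1) / l"
proof -
  have "((\<lambda>s. exp (l * s) / l) has_real_derivative exp (l * s)) (at s)" for s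
    using assms by (auto intro!: derivative_eq_intros)
  from prim_FTC[OF this] show ?thesis
    by (simp add: diff_divide_distrib)
qed

section \<open>Interchange of oriented integrals\<close>

lemma prim_swap:
  assumes g: "cont2 g"
  shows "prim (\<lambda>s. prim (g s) y) x = prim (\<lambda>t. prim (\<lambda>s. g s t) x) y"
proof -
  have "integral (cbox 0 1) (\<lambda>\<theta>. integral (cbox 0 1) (\<lambda>\<tau>. x * (y * g (x * \<theta>) (y * \<tau>)))) =
     integral (cbox 0 1) (\<lambda>\<tau>. integral (cbox 0 1) (\<lambda>\<theta>. x * (y * g (x * \<theta>) (y * \<tau>))))"
    by (rule integral_swap_continuous)
       (auto simp: case_prod_unfold intro!: continuous_intros cont2_compose[OF g])
  then show ?thesis
    by (simp add: prim_def mult.left_commute[of x y])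
qed

lemma cont2_swap: "cont2 g \<Longrightarrow> cont2 (\<lambda>s t. g t s)"
  by (rule cont2_compose) (auto intro!: continuous_intros)

lemma cont2_section:
  assumes "cont2 g"
  shows "continuous_on UNIV (g s)" "continuous_on UNIV (\<lambda>s. g s t)"
  by (rule cont2_compose[OF assms]; auto intro!: continuous_intros)+

text \<open>Fubini on the triangle \<rho> \<le> \<sigma> \<le> M; the difference on the right is the
  integral from \<rho> to M. The rectangle integral \<open>S\<close> is differentiated along its
  diagonal, where its two partial derivatives are the two slices through the corner.\<close>

lemma prim_triangle:
  assumes g: "cont2 g"
  shows "prim (\<lambda>\<sigma>. prim (\<lambda>\<rho>. g \<rho> \<sigma>) \<sigma>) M = prim (\<lambda>\<rho>. prim (g \<rho>) M - prim (g \<rho>) \<rho>) M"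
proof -
  have c1: "continuous_on UNIV (\<lambda>\<sigma>. prim (\<lambda>\<rho>. g \<rho> \<sigma>) \<sigma>)"
    and c2: "continuous_on UNIV (\<lambda>\<rho>. prim (g \<rho>) \<rho>)"
    and c3: "cont2 (\<lambda>u v. prim (\<lambda>\<rho>. g \<rho> v) u)" and c4: "cont2 (\<lambda>u v. prim (g u) v)"
    by (intro prim_continuous_on cont2_compose[OF g] continuous_intros)+
  define S where "S u v = prim (\<lambda>\<rho>. prim (g \<rho>) v) u" for u v
  have Su: "((\<lambda>u. S u v) has_real_derivative prim (g u) v) (at u)" for u v
    unfolding S_def by (rule has_derivative_prim[OF cont2_section(2)[OF c4]])
  have Sv: "(S u has_real_derivative prim (\<lambda>\<rho>. g \<rho> v) u) (at v)" for u v
    unfolding S_def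
  proof (rule has_derivative_prim_param)
    show "continuous_on UNIV (\<lambda>\<rho>. prim (g \<rho>) s)" for s
      by (rule cont2_section(2)[OF c4])
    show "((\<lambda>p. prim (g s) p) has_real_derivative g s p) (at p)" for p s
      by (rule has_derivative_prim[OF cont2_section(1)[OF g]])
  qed (rule cont2_swap[OF g])
  have "((\<lambda>r. S r r) has_real_derivative prim (g r) r * 1 + prim (\<lambda>\<rho>. g \<rho> r) r * 1) (at r)" for r
    by (rule chain2[OF Su Sv c3]) (auto intro!: derivative_eq_intros)
  then have "prim (\<lambda>r. prim (g r) r + prim (\<lambda>\<rho>. g \<rho> r) r) M = S M M - S 0 0"
    by (intro prim_FTC) simp
  moreover have "prim (\<lambda>\<rho>. prim (g \<rho>) M - prim (g \<rho>) \<rho>) M = S M M - prim (\<lambda>\<rho>. prim (g \<rho>) \<rho>) M"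
    unfolding S_def by (intro prim_diff c2 cont2_section(2)[OF c4])
  ultimately show ?thesis
    using prim_add[OF c2 c1, of M] by (simp add: S_def)
qed

text \<open>Replaces Gronwall's inequality: \<open>P N\<close> stands for an estimate with constant \<open>N\<close> in a weighted
  supremum norm in which the integral operator has norm at most one half.\<close>

lemma halving_bound:
  fixes P :: "real \<Rightarrow> bool" and e :: real
  assumes step: "\<And>N. 0 \<le> N \<Longrightarrow> P N \<Longrightarrow> P (e + N / 2)" and "P N0" "0 \<le> N0" "0 \<le> e"
    and closed: "\<And>X N. (\<And>k. P (X k)) \<Longrightarrow> X \<longlonglongrightarrow> N \<Longrightarrow> P N"
  shows "P (2 * e)"
proof -
  \<comment> \<open>Closed form of the iterates of N -> e + N / 2 started at N0; they converge to
    the fixed point 2 e.\<close>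
  define X where "X k = 2 * e + (N0 - 2 * e) / 2 ^ k" for k :: nat
  have pos: "0 \<le> X k" for k
  proof -
    have "X k = 2 * e * (1 - 1 / 2 ^ k) + N0 / 2 ^ k"
      by (simp add: X_def algebra_simps diff_divide_distrib)
    then show ?thesis using assms by simp
  qed
  have "P (X k)" for k
  proof (induction k)
    case (Suc k)
    have "X (Suc k) = e + X k / 2" by (simp add: X_def field_simps)
    with step[OF pos Suc] show ?case by simp
  qed (use assms in \<open>simp add: X_def\<close>)
  moreover have "X \<longlonglongrightarrow> 2 * e + (N0 - 2 * e) * 0"
    unfolding X_def divide_inverse
    by (intro tendsto_intros LIMSEQ_inverse_realpow_zero) auto
  ultimately show ?thesis using closed[of X] by simp
qed

section \<open>The reflection kernel\<close>

lemma prim_cutoff: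
  assumes g: "continuous_on UNIV g" and z: "\<And>s. b \<le> s \<Longrightarrow> g s = 0" and "b \<le> y"
  shows "prim g y = prim g b"
proof -
  have "1 * prim (\<lambda>s. g (1 * s + b)) (y - b) = prim g (1 * (y - b) + b) - prim g b"
    by (rule prim_affine[OF g])
  moreover have "prim (\<lambda>s. g (1 * s + b)) (y - b) = prim (\<lambda>s. 0) (y - b)"
    using assms by (intro prim_cong) (auto simp: closed_segment_eq_real_ivl)
  ultimately show ?thesis by simp
qed

lemma prim_vanish:
  assumes "\<And>s. s \<in> closed_segment 0 y \<Longrightarrow> g s = 0"
  shows "prim g y = 0"
  using prim_cong[of y g "\<lambda>s. 0"] assms by simp

lemma prim_exp_decay:
  assumes "0 < l"
  shows "prim (\<lambda>s. N * exp (- l * s)) x = N * ((1 - exp (- l * x)) / l)"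
proof -
  have "prim (\<lambda>s. exp (- l * s)) x = (1 - exp (- l * x)) / l"
    using prim_exp[of "- l" x] assms by (simp add: field_simps)
  then show ?thesis unfolding prim_cmult by simp
qed

text \<open>\<open>a\<close> stands for the logarithmic derivative of the speed in travel time. That
  it vanishes beyond Y keeps depth integrals bounded; that it vanishes for y \<le> 0 lets solutions
  be continued across the boundary.\<close>

locale profile =
  fixes a :: "real \<Rightarrow> real" and A Y :: real
  assumes a_cont: "continuous_on UNIV a"
    and a_bound: "\<bar>a y\<bar> \<le> A"
    and a_zero: "y \<le> 0 \<or> Y \<le> y \<Longrightarrow> a y = 0"
    and A_pos: "0 < A" and Y_pos: "0 < Y"
begin

text \<open>Integrates the equation for \<open>W\<^sub>-\<close> from the boundary into the depth.
  The start value is the condition \<open>W\<^sub>+ - W\<^sub>- = 2 f\<close> without its source, so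
  \<open>B\<close> maps \<open>W\<^sub>+\<close> to the part of \<open>W\<^sub>-\<close> beyond
  \<open>- 2 f\<close>.\<close>

definition B :: "(real \<Rightarrow> real) \<Rightarrow> real \<Rightarrow> real" where
  "B g y = g 0 - prim (\<lambda>r. a r * g r) y / 2"

text \<open>Bounds the norm of \<open>B\<close> on bounded functions: the integral in
  \<open>B\<close> sees \<open>a\<close> only on an interval of length Y.\<close>

definition \<beta> :: real where "\<beta> = 1 + A * Y / 2"

text \<open>Rate of the weight exp (- \<mu> \<xi>). It makes A \<beta> / (4 \<mu>) equal to 1 / 2,
  the contraction factor of the kernel equation.\<close>

definition \<mu> :: real where "\<mu> = A * \<beta> / 2"

lemma \<beta>_ge: "1 \<le> \<beta>" and \<mu>_pos: "0 < \<mu>"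
  using A_pos Y_pos by (auto simp: \<beta>_def \<mu>_def intro!: mult_pos_pos add_pos_pos)

lemma a_cont_on: "continuous_on S f \<Longrightarrow> continuous_on S (\<lambda>x. a (f x))"
  by (rule cont2_compose1[OF a_cont])

lemma B_bound:
  assumes g: "continuous_on UNIV g" and N: "\<And>y. \<bar>g y\<bar> \<le> N"
  shows "\<bar>B g y\<bar> \<le> \<beta> * N"
proof -
  have c: "continuous_on UNIV (\<lambda>r. a r * g r)"
    by (intro continuous_intros a_cont g)
  have le: "\<bar>a r * g r\<bar> \<le> A * N" for r
    unfolding abs_mult using a_bound N A_pos by (intro mult_mono) auto
  have N0: "0 \<le> N" using N[of 0] by linarith
  have base: "\<bar>prim (\<lambda>r. a r * g r) z\<bar> \<le> A * N * Y" if "0 \<le> z" "z \<le> Y" for z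
  proof -
    have "\<bar>prim (\<lambda>r. a r * g r) z\<bar> \<le> A * N * \<bar>z\<bar>"
      by (rule prim_abs_le_const[OF c]) (rule le)
    also have "\<dots> \<le> A * N * Y"
      using that A_pos N0 by (intro mult_left_mono) auto
    finally show ?thesis .
  qed
  have "\<bar>prim (\<lambda>r. a r * g r) y\<bar> \<le> A * N * Y"
  proof -
    consider "y \<le> 0" | "0 \<le> y" "y \<le> Y" | "Y \<le> y" by linarith
    then show ?thesis
    proof cases
      case 1
      then have "prim (\<lambda>r. a r * g r) y = 0"
        by (intro prim_vanish) (auto simp: closed_segment_eq_real_ivl a_zero split: if_splits)
      then show ?thesis using A_pos Y_pos N0 by simp
    next
      case 3
      then have "prim (\<lambda>r. a r * g r) y = prim (\<lambda>r. a r * g r) Y"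
        by (intro prim_cutoff[OF c]) (auto simp: a_zero)
      then show ?thesis using base[of Y] Y_pos by simp
    qed (use base in auto)
  qed
  then have "\<bar>B g y\<bar> \<le> N + A * N * Y / 2"
    unfolding B_def using N[of 0] by linarith
  then show ?thesis by (simp add: \<beta>_def algebra_simps)
qed

lemma B_diff:
  assumes "continuous_on UNIV g" "continuous_on UNIV h"
  shows "B (\<lambda>r. g r - h r) y = B g y - B h y"
  using prim_diff[of "\<lambda>r. a r * g r" "\<lambda>r. a r * h r" y] assms a_cont
  by (simp add: B_def algebra_simps continuous_intros)

lemma B_cmult: "B (\<lambda>r. c * g r) y = c * B g y"
  using prim_cmult[of c "\<lambda>r. a r * g r" y] by (simp add: B_def algebra_simps)

lemma B_continuous_on:
  fixes k :: "'p::topological_space \<Rightarrow> real \<Rightarrow> real"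
  assumes k: "cont2 k" and p: "continuous_on U p" and v: "continuous_on U v"
  shows "continuous_on U (\<lambda>x. B (k (p x)) (v x))"
proof -
  have "cont2 (\<lambda>q y. B (k q) y)"
    unfolding B_def
    by (intro continuous_intros prim_continuous_on cont2_compose[OF k] a_cont_on) auto
  from cont2_compose[OF this p v] show ?thesis .
qed

text \<open>The equation for \<open>W\<^sub>+\<close> is integrated along constant \<xi> + 2 y from
  depths where \<open>a\<close> vanishes, and \<open>W\<^sub>- = - 2 f + H * f\<close> is inserted.
  The source - 2 f gives the leading term - a / 2; the factor 1 / 4 combines the 1 / 2 of the
  equation with ds = d\<sigma> / 2. At negative \<xi> only continuity and the bound constrain
  \<open>G\<close>.\<close>

definition is_kernel :: "(real \<Rightarrow> real \<Rightarrow> real) \<Rightarrow> bool" where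
  "is_kernel G \<longleftrightarrow> cont2 G \<and>
     (\<forall>\<xi> y. \<bar>G \<xi> y\<bar> \<le> A * exp (\<mu> * max 0 \<xi>)) \<and>
     (\<forall>\<xi>\<ge>0. \<forall>y. G \<xi> y = - a (y + \<xi> / 2) / 2
        + prim (\<lambda>\<sigma>. a (y + \<sigma> / 2) * B (G (\<xi> - \<sigma>)) (y + \<sigma> / 2)) \<xi> / 4)"

text \<open>Banach's fixed point theorem for V = exp (- \<mu> \<xi>) G among the bounded continuous
  functions on the plane; in this weight the Volterra operator contracts.\<close>

lemma kernel_exists: "\<exists>G. is_kernel G"
proof -
  \<comment> \<open>\<open>max 0 \<xi>\<close> continues the unknown constantly to negative times,
    which makes it a bounded continuous function on the whole plane. The integral meets only
    arguments between 0 and \<xi>.\<close>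
  define op :: "((real \<times> real) \<Rightarrow>\<^sub>C real) \<Rightarrow> real \<times> real \<Rightarrow> real" where
    "op V z = - (exp (- (\<mu> * max 0 (fst z))) * a (snd z + max 0 (fst z) / 2)) / 2 +
       prim (\<lambda>\<sigma>. exp (- \<mu> * \<sigma>) * a (snd z + \<sigma> / 2) *
         B (\<lambda>r. apply_bcontfun V (max 0 (fst z) - \<sigma>, r)) (snd z + \<sigma> / 2)) (max 0 (fst z)) / 4" for V z
  have V2: "cont2 (\<lambda>x r. apply_bcontfun V (x, r))" for V :: "(real \<times> real) \<Rightarrow>\<^sub>C real"
    by simp
  have Vs: "continuous_on UNIV (\<lambda>r. apply_bcontfun V (x, r))" for V :: "(real \<times> real) \<Rightarrow>\<^sub>C real" and x
    by (rule cont2_section(1)[OF V2])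
  have int: "continuous_on UNIV (\<lambda>\<sigma>. exp (- \<mu> * \<sigma>) * a (y + \<sigma> / 2) *
         B (\<lambda>r. apply_bcontfun V (x - \<sigma>, r)) (y + \<sigma> / 2))" for V :: "(real \<times> real) \<Rightarrow>\<^sub>C real" and x y
    by (intro continuous_intros a_cont_on B_continuous_on[OF V2]) auto
  have opc: "continuous_on UNIV (op V)" for V
    unfolding op_def
    by (intro continuous_intros a_cont_on prim_continuous_on B_continuous_on[OF V2]) auto
  have decay: "prim (\<lambda>\<sigma>. N * exp (- \<mu> * \<sigma>)) x \<le> N / \<mu>" if "0 \<le> N" for N x
  proof -
    have "prim (\<lambda>\<sigma>. N * exp (- \<mu> * \<sigma>)) x = N * ((1 - exp (- \<mu> * x)) / \<mu>)"
      by (rule prim_exp_decay[OF \<mu>_pos])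
    also have "\<dots> \<le> N * (1 / \<mu>)"
      using that \<mu>_pos by (intro mult_left_mono divide_right_mono) auto
    finally show ?thesis by simp
  qed
  \<comment> \<open>The integrand contributes A \<beta> N and the exponential weight 1 / \<mu>. The
    choice of \<mu> turns the product into 2 N, and division by 4 leaves N / 2.\<close>
  have est: "\<bar>prim (\<lambda>\<sigma>. exp (- \<mu> * \<sigma>) * a (y + \<sigma> / 2) * k \<sigma>) x / 4\<bar> \<le> N / 2"
    if "\<And>\<sigma>. \<bar>k \<sigma>\<bar> \<le> \<beta> * N" "continuous_on UNIV (\<lambda>\<sigma>. exp (- \<mu> * \<sigma>) * a (y + \<sigma> / 2) * k \<sigma>)"
      "0 \<le> x" "0 \<le> N" for k x y N
  proof -
    have "\<bar>prim (\<lambda>\<sigma>. exp (- \<mu> * \<sigma>) * a (y + \<sigma> / 2) * k \<sigma>) x\<bar> \<le> prim (\<lambda>\<sigma>. A * \<beta> * N * exp (- \<mu> * \<sigma>)) x"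
    proof (rule prim_abs_le)
      fix \<sigma>
      have "\<bar>a (y + \<sigma> / 2)\<bar> * \<bar>k \<sigma>\<bar> \<le> A * (\<beta> * N)"
        using that(1) a_bound A_pos by (intro mult_mono) auto
      then have "exp (- \<mu> * \<sigma>) * (\<bar>a (y + \<sigma> / 2)\<bar> * \<bar>k \<sigma>\<bar>) \<le> exp (- \<mu> * \<sigma>) * (A * (\<beta> * N))"
        by (intro mult_left_mono) auto
      then show "\<bar>exp (- \<mu> * \<sigma>) * a (y + \<sigma> / 2) * k \<sigma>\<bar> \<le> A * \<beta> * N * exp (- \<mu> * \<sigma>)"
        by (simp add: abs_mult mult_ac)
    qed (use that in \<open>auto intro!: continuous_intros\<close>)
    also have "\<dots> \<le> A * \<beta> * N / \<mu>"
      using that A_pos \<beta>_ge by (intro decay) auto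
    also have "\<dots> = 2 * N"
      using A_pos \<beta>_ge by (simp add: \<mu>_def)
    finally show ?thesis by simp
  qed
  have lead: "\<bar>- (exp (- (\<mu> * max 0 \<xi>)) * a w) / 2\<bar> \<le> A / 2" for \<xi> w
  proof -
    have "exp (- (\<mu> * max 0 \<xi>)) * \<bar>a w\<bar> \<le> 1 * A"
      using a_bound \<mu>_pos by (intro mult_mono) auto
    then show ?thesis by (simp add: abs_mult)
  qed
  have Vb: "\<bar>apply_bcontfun V z\<bar> \<le> norm V" for V :: "(real \<times> real) \<Rightarrow>\<^sub>C real" and z
    using norm_bounded[of V z] by simp
  have opb: "\<bar>op V z\<bar> \<le> A / 2 + norm V / 2" for V z
  proof -
    have "\<bar>prim (\<lambda>\<sigma>. exp (- \<mu> * \<sigma>) * a (snd z + \<sigma> / 2) *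
         B (\<lambda>r. apply_bcontfun V (max 0 (fst z) - \<sigma>, r)) (snd z + \<sigma> / 2)) (max 0 (fst z)) / 4\<bar> \<le> norm V / 2"
      by (intro est B_bound Vs Vb int) auto
    then show ?thesis
      unfolding op_def using lead[of "fst z" "snd z + max 0 (fst z) / 2"]
      by (intro order_trans[OF abs_triangle_ineq] add_mono) auto
  qed
  have mem: "op V \<in> bcontfun" for V
    using opc opb by (intro bcontfun_normI[where b = "A / 2 + norm V / 2"]) auto
  define Op where "Op V = Bcontfun (op V)" for V
  have Op: "apply_bcontfun (Op V) = op V" for V
    unfolding Op_def using mem by (simp add: Bcontfun_inverse)
  have "\<exists>!V. Op V = V"
  proof (rule banach_fix_type[where c = "1 / 2"])
    show "\<forall>V W. dist (Op V) (Op W) \<le> 1 / 2 * dist V W"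
    proof (intro allI dist_bound)
      fix V W :: "(real \<times> real) \<Rightarrow>\<^sub>C real" and z :: "real \<times> real"
      define x y where "x = max 0 (fst z)" and "y = snd z"
      define k where "k U \<sigma> = B (\<lambda>r. apply_bcontfun U (x - \<sigma>, r)) (y + \<sigma> / 2)" for U :: "(real \<times> real) \<Rightarrow>\<^sub>C real" and \<sigma>
      have ci: "continuous_on UNIV (\<lambda>\<sigma>. exp (- \<mu> * \<sigma>) * a (y + \<sigma> / 2) * k U \<sigma>)" for U
        unfolding k_def by (rule int)
      have "op V z - op W z = prim (\<lambda>\<sigma>. exp (- \<mu> * \<sigma>) * a (y + \<sigma> / 2) * k V \<sigma>) x / 4
          - prim (\<lambda>\<sigma>. exp (- \<mu> * \<sigma>) * a (y + \<sigma> / 2) * k W \<sigma>) x / 4"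
        by (simp add: op_def x_def y_def k_def)
      also have "\<dots> = prim (\<lambda>\<sigma>. exp (- \<mu> * \<sigma>) * a (y + \<sigma> / 2) * (k V \<sigma> - k W \<sigma>)) x / 4"
        using prim_diff[OF ci[of V] ci[of W], of x] by (simp add: right_diff_distrib diff_divide_distrib)
      also have "\<bar>\<dots>\<bar> \<le> dist V W / 2"
      proof (rule est)
        fix \<sigma>
        have "k V \<sigma> - k W \<sigma> = B (\<lambda>r. apply_bcontfun V (x - \<sigma>, r) - apply_bcontfun W (x - \<sigma>, r)) (y + \<sigma> / 2)"
          unfolding k_def using B_diff[OF Vs Vs] by simp
        also have "\<bar>\<dots>\<bar> \<le> \<beta> * dist V W"
          using dist_bounded[of V _ W] by (intro B_bound continuous_intros Vs) (auto simp: dist_real_def)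
        finally show "\<bar>k V \<sigma> - k W \<sigma>\<bar> \<le> \<beta> * dist V W" .
        show "continuous_on UNIV (\<lambda>\<sigma>. exp (- \<mu> * \<sigma>) * a (y + \<sigma> / 2) * (k V \<sigma> - k W \<sigma>))"
          using ci[of V] ci[of W] by (simp add: right_diff_distrib continuous_on_diff)
      qed (auto simp: x_def)
      finally show "dist (apply_bcontfun (Op V) z) (apply_bcontfun (Op W) z) \<le> 1 / 2 * dist V W"
        by (simp add: Op dist_real_def)
    qed
  qed auto
  then obtain V where V: "Op V = V" by blast
  then have V_eq: "apply_bcontfun V z = op V z" for z
    using Op by metis
  \<comment> \<open>The fixed point satisfies norm V \<le> A / 2 + norm V / 2; this is the origin of
    the constant A in \<open>is_kernel\<close>.\<close>
  have nV: "norm V \<le> A"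
  proof -
    have "norm V \<le> A / 2 + norm V / 2"
      using opb[of V] V_eq by (intro norm_bound) auto
    then show ?thesis by simp
  qed
  define G where "G \<xi> y = exp (\<mu> * max 0 \<xi>) * apply_bcontfun V (max 0 \<xi>, y)" for \<xi> y
  have "is_kernel G"
    unfolding is_kernel_def
  proof (intro conjI allI impI)
    show "cont2 G"
      unfolding G_def by (intro continuous_intros cont2_compose[OF V2])
    show "\<bar>G \<xi> y\<bar> \<le> A * exp (\<mu> * max 0 \<xi>)" for \<xi> y
      using order_trans[OF Vb nV, of "(max 0 \<xi>, y)"] by (simp add: G_def abs_mult)
    fix \<xi> y :: real assume \<xi>: "0 \<le> \<xi>"
    have "G \<xi> y = exp (\<mu> * \<xi>) * op V (\<xi>, y)"
      using \<xi> V_eq[of "(\<xi>, y)"] by (simp add: G_def)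
    also have "\<dots> = - a (y + \<xi> / 2) / 2 + prim (\<lambda>\<sigma>. exp (\<mu> * \<xi>) * (exp (- \<mu> * \<sigma>) * a (y + \<sigma> / 2) *
         B (\<lambda>r. apply_bcontfun V (\<xi> - \<sigma>, r)) (y + \<sigma> / 2))) \<xi> / 4"
      unfolding prim_cmult using \<xi> by (simp add: op_def algebra_simps exp_minus_inverse flip: exp_add)
    also have "prim (\<lambda>\<sigma>. exp (\<mu> * \<xi>) * (exp (- \<mu> * \<sigma>) * a (y + \<sigma> / 2) *
         B (\<lambda>r. apply_bcontfun V (\<xi> - \<sigma>, r)) (y + \<sigma> / 2))) \<xi>
       = prim (\<lambda>\<sigma>. a (y + \<sigma> / 2) * B (G (\<xi> - \<sigma>)) (y + \<sigma> / 2)) \<xi>"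
    proof (rule prim_cong)
      fix \<sigma> assume "\<sigma> \<in> closed_segment 0 \<xi>"
      then have \<sigma>: "\<sigma> \<le> \<xi>" using \<xi> by (auto simp: closed_segment_eq_real_ivl)
      then have "B (G (\<xi> - \<sigma>)) (y + \<sigma> / 2)
          = exp (\<mu> * (\<xi> - \<sigma>)) * B (\<lambda>r. apply_bcontfun V (\<xi> - \<sigma>, r)) (y + \<sigma> / 2)"
        unfolding B_cmult[symmetric] by (simp add: G_def[abs_def])
      moreover have "exp (\<mu> * (\<xi> - \<sigma>)) = exp (\<mu> * \<xi>) * exp (- \<mu> * \<sigma>)"
        by (simp add: algebra_simps flip: exp_add)
      ultimately show "exp (\<mu> * \<xi>) * (exp (- \<mu> * \<sigma>) * a (y + \<sigma> / 2) *
         B (\<lambda>r. apply_bcontfun V (\<xi> - \<sigma>, r)) (y + \<sigma> / 2)) = a (y + \<sigma> / 2) * B (G (\<xi> - \<sigma>)) (y + \<sigma> / 2)"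
        by simp
    qed
    finally show "G \<xi> y = - a (y + \<xi> / 2) / 2
        + prim (\<lambda>\<sigma>. a (y + \<sigma> / 2) * B (G (\<xi> - \<sigma>)) (y + \<sigma> / 2)) \<xi> / 4" .
  qed
  then show ?thesis by blast
qed

definition G :: "real \<Rightarrow> real \<Rightarrow> real" where "G = (SOME G. is_kernel G)"

definition H :: "real \<Rightarrow> real \<Rightarrow> real" where "H \<xi> = B (G \<xi>)"

lemma is_kernel_G: "is_kernel G"
  unfolding G_def using kernel_exists by (rule someI_ex)

section \<open>Equations and bounds for the kernels G and H\<close>

lemma G_cont: "cont2 G"
  and G_bound: "\<bar>G \<xi> y\<bar> \<le> A * exp (\<mu> * max 0 \<xi>)"
  and G_eq: "0 \<le> \<xi> \<Longrightarrow> G \<xi> y = - a (y + \<xi> / 2) / 2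
        + prim (\<lambda>\<sigma>. a (y + \<sigma> / 2) * H (\<xi> - \<sigma>) (y + \<sigma> / 2)) \<xi> / 4"
  using is_kernel_G unfolding is_kernel_def H_def by blast+

lemma G_cont_on: "continuous_on S f \<Longrightarrow> continuous_on S g \<Longrightarrow> continuous_on S (\<lambda>x. G (f x) (g x))"
  by (rule cont2_compose[OF G_cont])

lemma H_cont: "cont2 H"
  unfolding H_def by (intro B_continuous_on[OF G_cont] continuous_intros)

lemma H_cont_on: "continuous_on S f \<Longrightarrow> continuous_on S g \<Longrightarrow> continuous_on S (\<lambda>x. H (f x) (g x))"
  by (rule cont2_compose[OF H_cont])

lemma H_bound: "\<bar>H \<xi> y\<bar> \<le> \<beta> * (A * exp (\<mu> * max 0 \<xi>))"
  unfolding H_def by (intro B_bound G_bound cont2_section[OF G_cont])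

lemma H_0: "H \<xi> 0 = G \<xi> 0"
  by (simp add: H_def B_def)

lemma H_eq: "H \<xi> y = G \<xi> 0 - prim (\<lambda>r. a r * G \<xi> r) y / 2"
  by (simp add: H_def B_def)

lemma G_diagonal: "G 0 y = - a y / 2"
  using G_eq[of 0 y] by simp

text \<open>\<open>G \<xi> y\<close> and \<open>G (\<xi> + 2 * y) 0\<close> integrate the same
  function along the same characteristic and have the same leading term in \<open>a\<close>; they
  differ by the stretch between depths 0 and y. Read inwards from the boundary, this determines the
  kernel at depth y from boundary values and from the coefficient above y.\<close>

lemma G_sideways:
  assumes "0 \<le> \<xi>" "0 \<le> y"
  shows "G \<xi> y = G (\<xi> + 2 * y) 0 - prim (\<lambda>r. a r * H (\<xi> + 2 * (y - r)) r) y / 2"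
proof -
  define h where "h \<sigma> = a (\<sigma> / 2) * H (\<xi> + 2 * y - \<sigma>) (\<sigma> / 2)" for \<sigma>
  have h: "continuous_on UNIV h"
    unfolding h_def by (intro continuous_intros a_cont_on H_cont_on) auto
  have "1 * prim (\<lambda>\<sigma>. h (1 * \<sigma> + 2 * y)) \<xi> = prim h (1 * \<xi> + 2 * y) - prim h (2 * y)"
    by (rule prim_affine[OF h])
  moreover have "2 * prim (\<lambda>r. h (2 * r + 0)) y = prim h (2 * y + 0) - prim h 0"
    by (rule prim_affine[OF h])
  moreover have "G (\<xi> + 2 * y) 0 = - a (y + \<xi> / 2) / 2 + prim h (\<xi> + 2 * y) / 4"
  proof -
    have "(\<lambda>\<sigma>. a (0 + \<sigma> / 2) * H (\<xi> + 2 * y - \<sigma>) (0 + \<sigma> / 2)) = h"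
      by (simp add: h_def fun_eq_iff)
    then show ?thesis
      using G_eq[of "\<xi> + 2 * y" 0] assms by (simp add: add_divide_distrib add.commute)
  qed
  moreover have "G \<xi> y = - a (y + \<xi> / 2) / 2 + prim (\<lambda>\<sigma>. h (\<sigma> + 2 * y)) \<xi> / 4"
  proof -
    have "(\<lambda>\<sigma>. a (y + \<sigma> / 2) * H (\<xi> - \<sigma>) (y + \<sigma> / 2)) = (\<lambda>\<sigma>. h (\<sigma> + 2 * y))"
      by (simp add: h_def fun_eq_iff add_divide_distrib add.commute)
    then show ?thesis
      using G_eq[of \<xi> y] assms by simp
  qed
  ultimately show ?thesis
    by (simp add: h_def algebra_simps)
qed

text \<open>The constant involves \<open>a\<close> only through its bound, its support and its
  Lipschitz constant, hence is common to all wave speeds. The increment solves the kernel equation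
  up to terms of order h, so \<open>halving_bound\<close> applies in the weight exp (\<mu>
  \<xi>).\<close>

lemma G_Lipschitz:
  assumes K: "\<And>y z. \<bar>a y - a z\<bar> \<le> K * \<bar>y - z\<bar>" and "0 \<le> \<xi>" "0 \<le> h" "\<xi> + h \<le> X"
  shows "\<bar>G (\<xi> + h) y - G \<xi> y\<bar> \<le> (K / 2 + A * (\<beta> * (A * exp (\<mu> * X))) / 2) * exp (\<mu> * X) * h"
proof -
  define e where "e = (K / 4 + A * (\<beta> * (A * exp (\<mu> * X))) / 4) * h"
  define P where "P N \<longleftrightarrow> (\<forall>\<xi> y. 0 \<le> \<xi> \<longrightarrow> \<xi> + h \<le> X \<longrightarrow> \<bar>G (\<xi> + h) y - G \<xi> y\<bar> \<le> N * exp (\<mu> * \<xi>))" for N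
  have K0: "0 \<le> K" using K[of 0 1] by simp
  have e0: "0 \<le> e" unfolding e_def using K0 A_pos \<beta>_ge assms by (intro mult_nonneg_nonneg add_nonneg_nonneg) auto
  have "P (2 * e)"
  proof (rule halving_bound[where P = P])
    show "P (2 * (A * exp (\<mu> * X)))"
      unfolding P_def
    proof (intro allI impI)
      fix \<xi> y assume \<xi>: "0 \<le> \<xi>" "\<xi> + h \<le> X"
      have "A * exp (\<mu> * \<eta>) \<le> A * exp (\<mu> * X)" if "\<eta> \<le> X" for \<eta>
        using A_pos \<mu>_pos that by simp
      then have "\<bar>G (\<xi> + h) y\<bar> \<le> A * exp (\<mu> * X)" "\<bar>G \<xi> y\<bar> \<le> A * exp (\<mu> * X)"
        using \<xi> \<open>0 \<le> h\<close> by (auto intro!: order_trans[OF G_bound])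
      then have "\<bar>G (\<xi> + h) y - G \<xi> y\<bar> \<le> 2 * (A * exp (\<mu> * X)) * 1"
        by linarith
      also have "\<dots> \<le> 2 * (A * exp (\<mu> * X)) * exp (\<mu> * \<xi>)"
        using \<xi> \<mu>_pos A_pos by (intro mult_left_mono) auto
      finally show "\<bar>G (\<xi> + h) y - G \<xi> y\<bar> \<le> 2 * (A * exp (\<mu> * X)) * exp (\<mu> * \<xi>)" .
    qed
    show "P N" if "\<And>k. P (Z k)" "Z \<longlonglongrightarrow> N" for Z :: "nat \<Rightarrow> real" and N
      unfolding P_def
    proof (intro allI impI)
      fix \<xi> y assume "0 \<le> \<xi>" "\<xi> + h \<le> X"
      then have "\<bar>G (\<xi> + h) y - G \<xi> y\<bar> \<le> Z k * exp (\<mu> * \<xi>)" for k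
        using that(1) P_def by auto
      then show "\<bar>G (\<xi> + h) y - G \<xi> y\<bar> \<le> N * exp (\<mu> * \<xi>)"
        by (intro LIMSEQ_le_const[OF tendsto_mult_right[OF that(2)]]) auto
    qed
    fix N :: real assume N: "0 \<le> N" "P N"
    show "P (e + N / 2)"
      unfolding P_def
    proof (intro allI impI)
      fix \<xi> y assume \<xi>: "0 \<le> \<xi>" "\<xi> + h \<le> X"
      define k where "k \<sigma> = a (y + \<sigma> / 2) * H (\<xi> + h - \<sigma>) (y + \<sigma> / 2)" for \<sigma>
      define l where "l \<sigma> = a (y + \<sigma> / 2) * H (\<xi> - \<sigma>) (y + \<sigma> / 2)" for \<sigma>
      have kc: "continuous_on UNIV k" and lc: "continuous_on UNIV l"
        unfolding k_def l_def by (intro continuous_intros a_cont_on H_cont_on; simp)+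
      \<comment> \<open>The two integrals have lengths \<xi> + h and \<xi>. The surplus piece of
        length h is bounded by the size of its integrand, the common piece by
        \<open>P N\<close>.\<close>
      have "1 * prim (\<lambda>\<sigma>. k (1 * \<sigma> + \<xi>)) h = prim k (1 * h + \<xi>) - prim k \<xi>"
        by (rule prim_affine[OF kc])
      then have split: "prim k (\<xi> + h) = prim k \<xi> + prim (\<lambda>\<sigma>. k (\<sigma> + \<xi>)) h"
        by (simp add: add.commute)
      have "\<bar>prim (\<lambda>\<sigma>. k (\<sigma> + \<xi>)) h\<bar> \<le> A * (\<beta> * (A * exp (\<mu> * X))) * \<bar>h\<bar>"
      proof (rule prim_abs_le_const)
        show "continuous_on UNIV (\<lambda>\<sigma>. k (\<sigma> + \<xi>))"
          by (intro cont2_compose1[OF kc] continuous_intros)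
        fix \<sigma> assume "\<sigma> \<in> closed_segment 0 h"
        then have s: "0 \<le> \<sigma>" "\<sigma> \<le> h" using \<open>0 \<le> h\<close> by (auto simp: closed_segment_eq_real_ivl)
        have "\<bar>H (\<xi> + h - (\<sigma> + \<xi>)) z\<bar> \<le> \<beta> * (A * exp (\<mu> * X))" for z
          using s \<xi> \<beta>_ge A_pos \<mu>_pos by (intro order_trans[OF H_bound] mult_left_mono) auto
        then show "\<bar>k (\<sigma> + \<xi>)\<bar> \<le> A * (\<beta> * (A * exp (\<mu> * X)))"
          unfolding k_def abs_mult using a_bound A_pos by (intro mult_mono) auto
      qed
      then have t1: "\<bar>prim (\<lambda>\<sigma>. k (\<sigma> + \<xi>)) h / 4\<bar> \<le> A * (\<beta> * (A * exp (\<mu> * X))) / 4 * h"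
        using \<open>0 \<le> h\<close> by simp
      have "\<bar>prim (\<lambda>\<sigma>. k \<sigma> - l \<sigma>) \<xi>\<bar> \<le> prim (\<lambda>\<sigma>. A * \<beta> * N * exp (\<mu> * \<xi>) * exp (- \<mu> * \<sigma>)) \<xi>"
      proof (rule prim_abs_le)
        fix \<sigma> assume s: "0 \<le> \<sigma>" "\<sigma> \<le> \<xi>"
        have "\<bar>G (\<xi> + h - \<sigma>) r - G (\<xi> - \<sigma>) r\<bar> \<le> N * exp (\<mu> * (\<xi> - \<sigma>))" for r
          using N(2)[unfolded P_def, rule_format, of "\<xi> - \<sigma>" r] s \<xi> by (simp add: algebra_simps)
        then have "\<bar>B (\<lambda>r. G (\<xi> + h - \<sigma>) r - G (\<xi> - \<sigma>) r) (y + \<sigma> / 2)\<bar> \<le> \<beta> * (N * exp (\<mu> * (\<xi> - \<sigma>)))"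
          by (intro B_bound continuous_intros cont2_section[OF G_cont])
        then have "\<bar>H (\<xi> + h - \<sigma>) (y + \<sigma> / 2) - H (\<xi> - \<sigma>) (y + \<sigma> / 2)\<bar> \<le> \<beta> * (N * exp (\<mu> * (\<xi> - \<sigma>)))"
          unfolding H_def using B_diff[OF cont2_section(1)[OF G_cont] cont2_section(1)[OF G_cont]] by simp
        then have "\<bar>k \<sigma> - l \<sigma>\<bar> \<le> A * (\<beta> * (N * exp (\<mu> * (\<xi> - \<sigma>))))"
          unfolding k_def l_def right_diff_distrib[symmetric] abs_mult
          using a_bound A_pos by (intro mult_mono) auto
        also have "exp (\<mu> * (\<xi> - \<sigma>)) = exp (\<mu> * \<xi>) * exp (- \<mu> * \<sigma>)"
          by (simp add: algebra_simps flip: exp_add)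
        finally show "\<bar>k \<sigma> - l \<sigma>\<bar> \<le> A * \<beta> * N * exp (\<mu> * \<xi>) * exp (- \<mu> * \<sigma>)"
          by (simp add: mult_ac)
      qed (use kc lc \<xi> in \<open>auto intro!: continuous_intros\<close>)
      also have "\<dots> = A * \<beta> * N * exp (\<mu> * \<xi>) * ((1 - exp (- \<mu> * \<xi>)) / \<mu>)"
        by (rule prim_exp_decay[OF \<mu>_pos])
      also have "\<dots> \<le> A * \<beta> * N * exp (\<mu> * \<xi>) * (1 / \<mu>)"
        using N A_pos \<beta>_ge \<mu>_pos by (intro mult_left_mono divide_right_mono) auto
      also have "\<dots> = 2 * N * exp (\<mu> * \<xi>)"
        using A_pos \<beta>_ge by (simp add: \<mu>_def)
      finally have t2: "\<bar>(prim k \<xi> - prim l \<xi>) / 4\<bar> \<le> N / 2 * exp (\<mu> * \<xi>)"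
        using prim_diff[OF kc lc, of \<xi>] by simp
      have t3: "\<bar>(a (y + (\<xi> + h) / 2) - a (y + \<xi> / 2)) / 2\<bar> \<le> K / 4 * h"
        using K[of "y + (\<xi> + h) / 2" "y + \<xi> / 2"] \<open>0 \<le> h\<close> by (simp add: add_divide_distrib)
      have "G (\<xi> + h) y - G \<xi> y = - ((a (y + (\<xi> + h) / 2) - a (y + \<xi> / 2)) / 2)
          + (prim k \<xi> - prim l \<xi>) / 4 + prim (\<lambda>\<sigma>. k (\<sigma> + \<xi>)) h / 4"
        using G_eq[of "\<xi> + h" y] G_eq[of \<xi> y] \<xi> \<open>0 \<le> h\<close> split
        unfolding k_def[symmetric] l_def[symmetric] by (simp add: field_simps)
      then have "\<bar>G (\<xi> + h) y - G \<xi> y\<bar> \<le> K / 4 * h + N / 2 * exp (\<mu> * \<xi>)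
          + A * (\<beta> * (A * exp (\<mu> * X))) / 4 * h"
        using t1 t2 t3 by linarith
      also have "\<dots> = e * 1 + N / 2 * exp (\<mu> * \<xi>)"
        by (simp add: e_def algebra_simps)
      also have "\<dots> \<le> e * exp (\<mu> * \<xi>) + N / 2 * exp (\<mu> * \<xi>)"
        using e0 \<xi> \<mu>_pos by (intro add_right_mono mult_left_mono) auto
      finally show "\<bar>G (\<xi> + h) y - G \<xi> y\<bar> \<le> (e + N / 2) * exp (\<mu> * \<xi>)"
        by (simp add: algebra_simps)
    qed
  qed (use A_pos e0 in auto)
  then have "\<bar>G (\<xi> + h) y - G \<xi> y\<bar> \<le> 2 * e * exp (\<mu> * \<xi>)"
    using assms by (auto simp: P_def)
  also have "\<dots> \<le> 2 * e * exp (\<mu> * X)"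
    using e0 \<mu>_pos assms by (intro mult_left_mono) auto
  finally show ?thesis by (simp add: e_def algebra_simps)
qed

end

section \<open>Regular solutions in travel time coordinates\<close>

definition causal :: "(real \<Rightarrow> real) \<Rightarrow> bool" where
  "causal f \<longleftrightarrow> continuous_on UNIV f \<and> (\<forall>t\<le>0. f t = 0)"

definition conv :: "(real \<Rightarrow> real) \<Rightarrow> (real \<Rightarrow> real) \<Rightarrow> real \<Rightarrow> real" where
  "conv k f \<xi> = prim (\<lambda>\<sigma>. k \<sigma> * f (\<xi> - \<sigma>)) \<xi>"

lemma causal_cont_on: "causal f \<Longrightarrow> continuous_on S g \<Longrightarrow> continuous_on S (\<lambda>x. f (g x))"
  unfolding causal_def by (blast intro: cont2_compose1)

text \<open>Causality makes the integrand vanish beyond \<xi>, so one fixed upper limit serves all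
  \<xi> \<le> M. Without a moving endpoint, a derivative in \<xi> falls on \<open>f\<close>
  alone.\<close>

lemma conv_upper:
  assumes f: "causal f" and k: "continuous_on UNIV k" and M: "0 \<le> M" "\<xi> \<le> M"
  shows "conv k f \<xi> = prim (\<lambda>\<sigma>. k \<sigma> * f (\<xi> - \<sigma>)) M"
proof (cases "0 \<le> \<xi>")
  case True
  have "prim (\<lambda>\<sigma>. k \<sigma> * f (\<xi> - \<sigma>)) M = prim (\<lambda>\<sigma>. k \<sigma> * f (\<xi> - \<sigma>)) \<xi>"
    using f M by (intro prim_cutoff) (auto simp: causal_def intro!: continuous_intros k causal_cont_on[OF f])
  then show ?thesis by (simp add: conv_def)
next
  case False
  have "prim (\<lambda>\<sigma>. k \<sigma> * f (\<xi> - \<sigma>)) M = 0" "prim (\<lambda>\<sigma>. k \<sigma> * f (\<xi> - \<sigma>)) \<xi> = 0"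
    using f M False by (auto intro!: prim_vanish simp: causal_def closed_segment_eq_real_ivl)
  then show ?thesis by (simp add: conv_def)
qed

lemma conv_causal:
  assumes f: "causal f" and k: "continuous_on UNIV k" and "\<And>t. t \<le> \<delta> \<Longrightarrow> f t = 0" "\<xi> \<le> \<delta>"
  shows "conv k f \<xi> = 0"
proof (cases "0 \<le> \<xi>")
  case True
  then show ?thesis
    unfolding conv_def using assms by (intro prim_vanish) (auto simp: closed_segment_eq_real_ivl)
next
  case False
  then show ?thesis using conv_upper[OF f k, of 0 \<xi>] by simp
qed

lemma conv_has_derivative:
  assumes f: "causal f" and f': "causal f'" and d: "\<And>t. (f has_real_derivative f' t) (at t)"
    and k: "continuous_on UNIV k"
  shows "(conv k f has_real_derivative conv k f' \<xi>) (at \<xi>)"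
proof -
  define M where "M = \<bar>\<xi>\<bar> + 1"
  have "((\<lambda>\<xi>. prim (\<lambda>\<sigma>. k \<sigma> * f (\<xi> - \<sigma>)) M) has_real_derivative prim (\<lambda>\<sigma>. k \<sigma> * f' (\<xi> - \<sigma>)) M) (at \<xi>)"
  proof (rule has_derivative_prim_param)
    show "continuous_on UNIV (\<lambda>\<sigma>. k \<sigma> * f (s - \<sigma>))" for s
      by (intro continuous_intros k causal_cont_on[OF f])
    show "((\<lambda>p. k s * f (p - s)) has_real_derivative k s * f' (p - s)) (at p)" for p s
    proof (rule DERIV_cmult)
      have "((\<lambda>p. p - s) has_real_derivative 1) (at p)"
        by (auto intro!: derivative_eq_intros)
      from DERIV_chain2[OF d this] show "((\<lambda>p. f (p - s)) has_real_derivative f' (p - s)) (at p)"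
        by simp
    qed
    show "cont2 (\<lambda>\<xi> \<sigma>. k \<sigma> * f' (\<xi> - \<sigma>))"
      by (intro continuous_intros cont2_compose1[OF k] causal_cont_on[OF f'])
  qed
  then have D: "((\<lambda>\<xi>. prim (\<lambda>\<sigma>. k \<sigma> * f (\<xi> - \<sigma>)) M) has_real_derivative conv k f' \<xi>) (at \<xi>)"
    using conv_upper[OF f' k, of M \<xi>] by (simp add: M_def)
  have "prim (\<lambda>\<sigma>. k \<sigma> * f (\<eta> - \<sigma>)) M = conv k f \<eta>" if "\<eta> \<in> {..<M}" for \<eta>
    using conv_upper[OF f k, of M \<eta>] that by (auto simp: M_def)
  moreover have "\<xi> \<in> {..<M}" by (simp add: M_def)
  ultimately show ?thesis
    using has_field_derivative_transform_within_open[OF D open_lessThan, of M "conv k f"] by blast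
qed

section \<open>Riemann invariants and their transport equations\<close>

context profile
begin

text \<open>The Riemann invariants \<open>W\<^sub>+\<close> (here \<open>Z\<close>) and \<open>W\<^sub>-\<close> for the boundary data \<open>f\<close>.\<close>

definition Z :: "(real \<Rightarrow> real) \<Rightarrow> real \<Rightarrow> real \<Rightarrow> real" where
  "Z f \<xi> y = conv (\<lambda>\<sigma>. G \<sigma> y) f \<xi>"

definition Wm :: "(real \<Rightarrow> real) \<Rightarrow> real \<Rightarrow> real \<Rightarrow> real" where
  "Wm f \<xi> y = - 2 * f \<xi> + B (Z f \<xi>) y"

lemma Z_cont: assumes f: "causal f" shows "cont2 (Z f)"
  unfolding Z_def conv_def
  by (intro continuous_intros prim_continuous_on G_cont_on causal_cont_on[OF f])

lemma Z_cont_on: "causal f \<Longrightarrow> continuous_on S p \<Longrightarrow> continuous_on S q \<Longrightarrow> continuous_on S (\<lambda>x. Z f (p x) (q x))"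
  by (rule cont2_compose[OF Z_cont])

lemma Wm_cont: assumes f: "causal f" shows "cont2 (Wm f)"
  unfolding Wm_def
  by (intro continuous_intros B_continuous_on[OF Z_cont[OF f]] causal_cont_on[OF f])

lemma Wm_cont_on: "causal f \<Longrightarrow> continuous_on S p \<Longrightarrow> continuous_on S q \<Longrightarrow> continuous_on S (\<lambda>x. Wm f (p x) (q x))"
  by (rule cont2_compose[OF Wm_cont])

lemma Z_causal:
  assumes "causal f" "\<And>t. t \<le> \<delta> \<Longrightarrow> f t = 0" "\<xi> \<le> \<delta>"
  shows "Z f \<xi> y = 0"
  unfolding Z_def by (rule conv_causal[OF assms(1) _ assms(2,3)]) (rule cont2_section[OF G_cont])

text \<open>Integration over depth commutes with convolution in time. The definition of
  \<open>Wm\<close> displays its derivative in y, this form its derivative in \<xi>.\<close>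

lemma Wm_conv:
  assumes f: "causal f"
  shows "Wm f \<xi> y = - 2 * f \<xi> + conv (\<lambda>\<sigma>. H \<sigma> y) f \<xi>"
proof -
  have "prim (\<lambda>r. a r * Z f \<xi> r) y = prim (\<lambda>r. prim (\<lambda>\<sigma>. a r * (G \<sigma> r * f (\<xi> - \<sigma>))) \<xi>) y"
    by (simp add: Z_def conv_def prim_cmult)
  also have "\<dots> = prim (\<lambda>\<sigma>. prim (\<lambda>r. a r * (G \<sigma> r * f (\<xi> - \<sigma>))) y) \<xi>"
    by (rule prim_swap) (intro continuous_intros a_cont_on G_cont_on causal_cont_on[OF f])
  also have "\<dots> = prim (\<lambda>\<sigma>. f (\<xi> - \<sigma>) * prim (\<lambda>r. a r * G \<sigma> r) y) \<xi>"
    by (simp add: prim_cmult[symmetric] mult_ac)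
  finally have e: "prim (\<lambda>r. a r * Z f \<xi> r) y = prim (\<lambda>\<sigma>. f (\<xi> - \<sigma>) * prim (\<lambda>r. a r * G \<sigma> r) y) \<xi>" .
  have "conv (\<lambda>\<sigma>. H \<sigma> y) f \<xi> = prim (\<lambda>\<sigma>. G \<sigma> 0 * f (\<xi> - \<sigma>) - 1 / 2 * (f (\<xi> - \<sigma>) * prim (\<lambda>r. a r * G \<sigma> r) y)) \<xi>"
    by (simp add: conv_def H_eq algebra_simps)
  also have "\<dots> = Z f \<xi> 0 - 1 / 2 * prim (\<lambda>\<sigma>. f (\<xi> - \<sigma>) * prim (\<lambda>r. a r * G \<sigma> r) y) \<xi>"
    unfolding Z_def conv_def prim_cmult[symmetric]
    by (intro prim_diff continuous_intros G_cont_on causal_cont_on[OF f] prim_continuous_on a_cont_on)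
  finally show ?thesis
    by (simp add: Wm_def B_def e)
qed

lemma Wm_causal:
  assumes "causal f" "\<And>t. t \<le> \<delta> \<Longrightarrow> f t = 0" "\<xi> \<le> \<delta>"
  shows "Wm f \<xi> y = 0"
  using conv_causal[OF assms(1) cont2_section(2)[OF H_cont] assms(2,3)] assms(2,3)
  by (simp add: Wm_conv[OF assms(1)])

text \<open>The kernel equation convolved with \<open>f\<close>. Once the order of integration on
  the triangle is exchanged, the inner integral is a convolution with \<open>H\<close>, and the
  leading term of the kernel supplies the - 2 f in \<open>Wm\<close>.\<close>

lemma Z_integral_equation:
  assumes f: "causal f" and M: "0 \<le> M" "\<xi> \<le> M"
  shows "Z f \<xi> y = prim (\<lambda>\<rho>. a (y + \<rho> / 2) * Wm f (\<xi> - \<rho>) (y + \<rho> / 2)) M / 4"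
proof -
  define g where "g \<rho> \<sigma> = a (y + \<rho> / 2) * (H (\<sigma> - \<rho>) (y + \<rho> / 2) * f (\<xi> - \<sigma>))" for \<rho> \<sigma>
  define h where "h \<rho> = a (y + \<rho> / 2) * f (\<xi> - \<rho>)" for \<rho>
  have gc: "cont2 g" unfolding g_def
    by (intro continuous_intros a_cont_on H_cont_on causal_cont_on[OF f]) auto
  have hc: "continuous_on UNIV h" unfolding h_def
    by (intro continuous_intros a_cont_on causal_cont_on[OF f]) auto
  have tc: "continuous_on UNIV (\<lambda>\<rho>. prim (\<lambda>\<sigma>. g \<sigma> \<rho>) \<rho>)" "continuous_on UNIV (\<lambda>\<rho>. prim (g \<rho>) M - prim (g \<rho>) \<rho>)"
    by (intro continuous_intros prim_continuous_on cont2_compose[OF gc])+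
  have c1: "continuous_on UNIV (\<lambda>\<rho>. - 1 / 2 * h \<rho>)"
    and c2: "continuous_on UNIV (\<lambda>\<sigma>. 1 / 4 * prim (\<lambda>\<rho>. g \<rho> \<sigma>) \<sigma>)"
    and c3: "continuous_on UNIV (\<lambda>\<rho>. 1 / 4 * (prim (g \<rho>) M - prim (g \<rho>) \<rho>))"
    by (intro continuous_on_mult_left hc tc)+
  have "Z f \<xi> y = prim (\<lambda>\<sigma>. G \<sigma> y * f (\<xi> - \<sigma>)) M"
    unfolding Z_def by (rule conv_upper[OF f _ M]) (rule cont2_section[OF G_cont])
  also have "\<dots> = prim (\<lambda>\<sigma>. - 1 / 2 * h \<sigma> + 1 / 4 * prim (\<lambda>\<rho>. g \<rho> \<sigma>) \<sigma>) M"
  proof (rule prim_cong)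
    fix \<sigma> assume "\<sigma> \<in> closed_segment 0 M"
    then have "0 \<le> \<sigma>" using M by (auto simp: closed_segment_eq_real_ivl)
    moreover have "prim (\<lambda>\<rho>. g \<rho> \<sigma>) \<sigma> = f (\<xi> - \<sigma>) * prim (\<lambda>\<rho>. a (y + \<rho> / 2) * H (\<sigma> - \<rho>) (y + \<rho> / 2)) \<sigma>"
      unfolding prim_cmult[symmetric] by (simp add: g_def mult_ac)
    ultimately show "G \<sigma> y * f (\<xi> - \<sigma>) = - 1 / 2 * h \<sigma> + 1 / 4 * prim (\<lambda>\<rho>. g \<rho> \<sigma>) \<sigma>"
      by (simp only: G_eq[of \<sigma> y]) (simp add: h_def algebra_simps)
  qed
  also have "\<dots> = - 1 / 2 * prim h M + 1 / 4 * prim (\<lambda>\<sigma>. prim (\<lambda>\<rho>. g \<rho> \<sigma>) \<sigma>) M"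
    using prim_add[OF c1 c2, of M] unfolding prim_cmult .
  also have "prim (\<lambda>\<sigma>. prim (\<lambda>\<rho>. g \<rho> \<sigma>) \<sigma>) M = prim (\<lambda>\<rho>. prim (g \<rho>) M - prim (g \<rho>) \<rho>) M"
    by (rule prim_triangle[OF gc])
  also have "- 1 / 2 * prim h M + 1 / 4 * prim (\<lambda>\<rho>. prim (g \<rho>) M - prim (g \<rho>) \<rho>) M
      = prim (\<lambda>\<rho>. - 1 / 2 * h \<rho> + 1 / 4 * (prim (g \<rho>) M - prim (g \<rho>) \<rho>)) M"
    using prim_add[OF c1 c3, of M] unfolding prim_cmult by (rule sym)
  also have "\<dots> = prim (\<lambda>\<rho>. 1 / 4 * (a (y + \<rho> / 2) * Wm f (\<xi> - \<rho>) (y + \<rho> / 2))) M"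
  proof (rule prim_cong)
    fix \<rho> assume "\<rho> \<in> closed_segment 0 M"
    then have \<rho>: "0 \<le> \<rho>" "\<rho> \<le> M" using M by (auto simp: closed_segment_eq_real_ivl)
    have "1 * prim (\<lambda>\<tau>. g \<rho> (1 * \<tau> + \<rho>)) (M - \<rho>) = prim (g \<rho>) (1 * (M - \<rho>) + \<rho>) - prim (g \<rho>) \<rho>"
      by (rule prim_affine) (rule cont2_section[OF gc])
    then have "prim (g \<rho>) M - prim (g \<rho>) \<rho> = prim (\<lambda>\<tau>. g \<rho> (\<tau> + \<rho>)) (M - \<rho>)"
      by simp
    also have "\<dots> = a (y + \<rho> / 2) * prim (\<lambda>\<tau>. H \<tau> (y + \<rho> / 2) * f ((\<xi> - \<rho>) - \<tau>)) (M - \<rho>)"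
      unfolding prim_cmult[symmetric] by (simp add: g_def algebra_simps)
    also have "prim (\<lambda>\<tau>. H \<tau> (y + \<rho> / 2) * f ((\<xi> - \<rho>) - \<tau>)) (M - \<rho>) = conv (\<lambda>\<tau>. H \<tau> (y + \<rho> / 2)) f (\<xi> - \<rho>)"
      using \<rho> M by (intro conv_upper[symmetric] f cont2_section[OF H_cont]) auto
    finally show "- 1 / 2 * h \<rho> + 1 / 4 * (prim (g \<rho>) M - prim (g \<rho>) \<rho>)
        = 1 / 4 * (a (y + \<rho> / 2) * Wm f (\<xi> - \<rho>) (y + \<rho> / 2))"
      by (simp add: Wm_conv[OF f] h_def algebra_simps)
  qed
  finally show ?thesis unfolding prim_cmult by simp
qed

text \<open>With the depth s = y + \<rho> / 2 as variable of integration, y disappears from the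
  argument of \<open>a\<close>. For fixed \<xi> + 2 y it then occurs only as an endpoint.\<close>

lemma Z_characteristic:
  assumes f: "causal f"
  shows "Z f \<xi> y = (prim (\<lambda>s. a s * Wm f (\<xi> + 2 * y - 2 * s) s) Y - prim (\<lambda>s. a s * Wm f (\<xi> + 2 * y - 2 * s) s) y) / 2"
proof -
  define h where "h s = a s * Wm f (\<xi> + 2 * y - 2 * s) s" for s
  define M where "M = 2 * (\<bar>\<xi>\<bar> + \<bar>y\<bar> + Y)"
  have hc: "continuous_on UNIV h"
    unfolding h_def by (intro continuous_intros a_cont_on Wm_cont_on f)
  have "1 / 2 * prim (\<lambda>\<rho>. h (1 / 2 * \<rho> + y)) M = prim h (1 / 2 * M + y) - prim h y"
    by (rule prim_affine[OF hc])
  moreover have "Y \<le> 1 / 2 * M + y"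
    unfolding M_def using abs_ge_minus_self[of y] abs_ge_zero[of \<xi>] by (simp add: field_simps)
  then have "prim h (1 / 2 * M + y) = prim h Y"
    by (intro prim_cutoff[OF hc]) (auto simp: h_def a_zero)
  moreover have "Z f \<xi> y = prim (\<lambda>\<rho>. h (1 / 2 * \<rho> + y)) M / 4"
    using Y_pos Z_integral_equation[OF f, of M \<xi> y] by (simp add: M_def h_def algebra_simps)
  ultimately show ?thesis by (simp add: h_def[abs_def])
qed

text \<open>Neither the kernels nor \<open>a\<close> are differentiated: a derivative in \<xi> turns
  \<open>f\<close> into \<open>f'\<close>, and a derivative at a fixed characteristic comes from the
  endpoint of an integral. The last two claims are the transport equations of the Riemann
  invariants.\<close>

lemma
  assumes f: "causal f" and f': "causal f'" and d: "\<And>t. (f has_real_derivative f' t) (at t)"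
  shows Z_deriv_\<xi>: "((\<lambda>\<xi>. Z f \<xi> y) has_real_derivative Z f' \<xi> y) (at \<xi>)"
    and Wm_deriv_\<xi>: "((\<lambda>\<xi>. Wm f \<xi> y) has_real_derivative Wm f' \<xi> y) (at \<xi>)"
    and Wm_deriv_y: "(Wm f \<xi> has_real_derivative - a y * Z f \<xi> y / 2) (at y)"
    and Z_deriv_y: "(Z f \<xi> has_real_derivative 2 * Z f' \<xi> y - a y * Wm f \<xi> y / 2) (at y)"
proof -
  show Z: "((\<lambda>\<xi>. Z f \<xi> y) has_real_derivative Z f' \<xi> y) (at \<xi>)" for \<xi> y
    unfolding Z_def by (rule conv_has_derivative[OF f f' d]) (rule cont2_section[OF G_cont])
  have "((\<lambda>\<xi>. conv (\<lambda>\<sigma>. H \<sigma> y) f \<xi>) has_real_derivative conv (\<lambda>\<sigma>. H \<sigma> y) f' \<xi>) (at \<xi>)" for \<xi> y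
    by (rule conv_has_derivative[OF f f' d]) (rule cont2_section[OF H_cont])
  then show W: "((\<lambda>\<xi>. Wm f \<xi> y) has_real_derivative Wm f' \<xi> y) (at \<xi>)" for \<xi> y
    unfolding Wm_conv[OF f] Wm_conv[OF f'] by (intro DERIV_add DERIV_cmult d)
  show "(Wm f \<xi> has_real_derivative - a y * Z f \<xi> y / 2) (at y)"
  proof -
    have "(prim (\<lambda>r. a r * Z f \<xi> r) has_real_derivative a y * Z f \<xi> y) (at y)"
      by (intro has_derivative_prim continuous_intros a_cont cont2_section[OF Z_cont[OF f]])
    then show ?thesis
      unfolding Wm_def[abs_def] B_def by (auto intro!: derivative_eq_intros)
  qed
  \<comment> \<open>\<open>Z\<close> in the coordinates (\<eta>, y), where \<eta> = \<xi> + 2 y is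
    constant along the characteristics of \<open>W\<^sub>+\<close>. The chain rule in \<eta>
    produces the term 2 Z f'.\<close>
  define \<Gamma> where "\<Gamma> \<eta> y = (prim (\<lambda>s. a s * Wm f (\<eta> - 2 * s) s) Y - prim (\<lambda>s. a s * Wm f (\<eta> - 2 * s) s) y) / 2" for \<eta> y
  have \<Gamma>\<eta>: "((\<lambda>\<eta>. \<Gamma> \<eta> y) has_real_derivative Z f' (\<eta> - 2 * y) y) (at \<eta>)" for \<eta> y
  proof -
    have P: "((\<lambda>\<eta>. prim (\<lambda>s. a s * Wm f (\<eta> - 2 * s) s) z) has_real_derivative
       prim (\<lambda>s. a s * Wm f' (\<eta> - 2 * s) s) z) (at \<eta>)" for z
    proof (rule has_derivative_prim_param)
      show "continuous_on UNIV (\<lambda>s. a s * Wm f (\<eta> - 2 * s) s)" for \<eta>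
        by (intro continuous_intros a_cont Wm_cont_on f)
      show "cont2 (\<lambda>\<eta> s. a s * Wm f' (\<eta> - 2 * s) s)"
        by (intro continuous_intros a_cont_on Wm_cont_on f')
      show "((\<lambda>p. a s * Wm f (p - 2 * s) s) has_real_derivative a s * Wm f' (p - 2 * s) s) (at p)" for p s
      proof (rule DERIV_cmult)
        have "((\<lambda>p. p - 2 * s) has_real_derivative 1) (at p)"
          by (auto intro!: derivative_eq_intros)
        from DERIV_chain2[OF W this] show "((\<lambda>p. Wm f (p - 2 * s) s) has_real_derivative Wm f' (p - 2 * s) s) (at p)"
          by simp
      qed
    qed
    show ?thesis
      unfolding \<Gamma>_def Z_characteristic[OF f'] by (auto intro!: derivative_eq_intros P)
  qed
  have hc: "cont2 (\<lambda>\<eta> s. a s * Wm f (\<eta> - 2 * s) s)"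
    by (intro continuous_intros a_cont_on Wm_cont_on f)
  have \<Gamma>y: "(\<Gamma> \<eta> has_real_derivative - (a y * Wm f (\<eta> - 2 * y) y) / 2) (at y)" for \<eta> y
    unfolding \<Gamma>_def[abs_def]
    by (auto intro!: derivative_eq_intros has_derivative_prim cont2_section(1)[OF hc])
  have "((\<lambda>y. \<Gamma> (\<xi> + 2 * y) y) has_real_derivative
      Z f' (\<xi> + 2 * y - 2 * y) y * 2 + - (a y * Wm f (\<xi> + 2 * y - 2 * y) y) / 2 * 1) (at y)"
    by (rule chain2[OF \<Gamma>\<eta> \<Gamma>y]) (auto intro!: derivative_eq_intros continuous_intros cont2_compose[OF hc])
  moreover have "Z f \<xi> = (\<lambda>y. \<Gamma> (\<xi> + 2 * y) y)"
    by (rule ext) (simp add: \<Gamma>_def Z_characteristic[OF f, of \<xi>])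
  ultimately show "(Z f \<xi> has_real_derivative 2 * Z f' \<xi> y - a y * Wm f \<xi> y / 2) (at y)"
    by (simp add: mult.commute)
qed

section \<open>The displacement in travel time coordinates\<close>

definition \<kappa> :: "real \<Rightarrow> real" where "\<kappa> y = exp (prim a y / 2)"

lemma \<kappa>_pos [simp]: "0 < \<kappa> y" by (simp add: \<kappa>_def)

lemma \<kappa>_0 [simp]: "\<kappa> 0 = 1" by (simp add: \<kappa>_def)

lemma \<kappa>_deriv: "(\<kappa> has_real_derivative a y / 2 * \<kappa> y) (at y)"
  unfolding \<kappa>_def by (auto intro!: derivative_eq_intros has_derivative_prim a_cont)

lemma \<kappa>_cont_on:
  assumes "continuous_on S f"
  shows "continuous_on S (\<lambda>x. \<kappa> (f x))"
proof -
  have "continuous_on UNIV \<kappa>"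
    using \<kappa>_deriv by (meson DERIV_isCont continuous_at_imp_continuous_on)
  from cont2_compose1[OF this assms] show ?thesis .
qed

text \<open>\<open>u\<^sub>t = \<kappa> (W\<^sub>+ + W\<^sub>-) / 2\<close> integrated in time at
  fixed depth, starting from rest at the arrival time \<xi> = 0.\<close>

definition U :: "(real \<Rightarrow> real) \<Rightarrow> real \<Rightarrow> real \<Rightarrow> real" where
  "U f \<xi> y = \<kappa> y / 2 * prim (\<lambda>\<xi>. Z f \<xi> y + Wm f \<xi> y) \<xi>"

lemma U_causal:
  assumes "causal f" "\<And>t. t \<le> \<delta> \<Longrightarrow> f t = 0" "\<xi> \<le> \<delta>" "0 \<le> \<delta>"
  shows "U f \<xi> y = 0"
proof -
  have "prim (\<lambda>\<xi>. Z f \<xi> y + Wm f \<xi> y) \<xi> = 0"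
  proof (rule prim_vanish)
    fix s assume "s \<in> closed_segment 0 \<xi>"
    then have "s \<le> \<delta>" using assms by (auto simp: closed_segment_eq_real_ivl split: if_splits)
    then show "Z f s y + Wm f s y = 0"
      using Z_causal[OF assms(1,2), of s] Wm_causal[OF assms(1,2), of s] by simp
  qed
  then show ?thesis by (simp add: U_def)
qed

lemma U_deriv_\<xi>:
  assumes f: "causal f"
  shows "((\<lambda>\<xi>. U f \<xi> y) has_real_derivative \<kappa> y / 2 * (Z f \<xi> y + Wm f \<xi> y)) (at \<xi>)"
  unfolding U_def
  by (intro DERIV_cmult has_derivative_prim continuous_intros cont2_section(2)[OF Z_cont[OF f]]
    cont2_section(2)[OF Wm_cont[OF f]])

text \<open>At fixed \<xi> the derivative in y is \<open>u\<^sub>t + u\<^sub>y\<close>, which is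
  \<kappa> times \<open>W\<^sub>+\<close>. The derivative of \<kappa> cancels the coefficient terms
  of the two transport equations.\<close>

lemma U_deriv_y:
  assumes f: "causal f" and f': "causal f'" and d: "\<And>t. (f has_real_derivative f' t) (at t)"
  shows "(U f \<xi> has_real_derivative \<kappa> y * Z f \<xi> y) (at y)"
proof -
  have cZ: "continuous_on UNIV (\<lambda>\<xi>. Z g \<xi> y)" "continuous_on UNIV (\<lambda>\<xi>. Wm g \<xi> y)" if "causal g" for g y
    using cont2_section(2)[OF Z_cont[OF that]] cont2_section(2)[OF Wm_cont[OF that]] .
  have "((\<lambda>y. prim (\<lambda>\<xi>. Z f \<xi> y + Wm f \<xi> y) \<xi>) has_real_derivative
     prim (\<lambda>\<xi>. 2 * Z f' \<xi> y - a y / 2 * (Z f \<xi> y + Wm f \<xi> y)) \<xi>) (at y)"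
  proof (rule has_derivative_prim_param)
    show "continuous_on UNIV (\<lambda>\<xi>. Z f \<xi> y + Wm f \<xi> y)" for y
      by (intro continuous_intros cZ f)
    show "cont2 (\<lambda>y \<xi>. 2 * Z f' \<xi> y - a y / 2 * (Z f \<xi> y + Wm f \<xi> y))"
      by (intro continuous_intros a_cont_on Z_cont_on Wm_cont_on f f') auto
    show "((\<lambda>p. Z f s p + Wm f s p) has_real_derivative 2 * Z f' s p - a p / 2 * (Z f s p + Wm f s p)) (at p)" for s p
      by (rule DERIV_cong[OF DERIV_add[OF Z_deriv_y[OF assms] Wm_deriv_y[OF assms]]]) (simp add: field_simps)
  qed
  note D = DERIV_mult[OF DERIV_cdivide[OF \<kappa>_deriv[of y], of 2] this]
  have p: "prim (\<lambda>\<xi>. 2 * Z f' \<xi> y - a y / 2 * (Z f \<xi> y + Wm f \<xi> y)) \<xi>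
      = 2 * Z f \<xi> y - a y / 2 * prim (\<lambda>\<xi>. Z f \<xi> y + Wm f \<xi> y) \<xi>"
  proof -
    have "prim (\<lambda>\<xi>. Z f' \<xi> y) \<xi> = Z f \<xi> y - Z f 0 y"
      by (rule prim_FTC[OF Z_deriv_\<xi>[OF assms]])
    then have z: "prim (\<lambda>\<xi>. Z f' \<xi> y) \<xi> = Z f \<xi> y" by (simp add: Z_causal[OF f, of 0] f[unfolded causal_def])
    show ?thesis
      unfolding z[symmetric] prim_cmult[symmetric] by (intro prim_diff continuous_intros cZ f f')
  qed
  show ?thesis
    unfolding U_def[abs_def] by (rule DERIV_cong[OF D]) (simp only: p, simp add: field_simps)
qed

end

section \<open>Travel time and regular solutions of the wave equation\<close>

text \<open>The speed is continued by 1 to the negative axis, so that regular solutions extend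
  differentiably across x = 0 and can be cut off to test functions on the plane. Of the second
  derivative only the Lipschitz bound on \<open>c'\<close> is kept.\<close>

locale speed =
  fixes c c' :: "real \<Rightarrow> real" and C0 C1 L m :: real
  assumes c_deriv: "(c has_real_derivative c' x) (at x)"
    and c_lower: "C0 \<le> c x" and c_upper: "c x \<le> C1"
    and c'_bound: "\<bar>c' x\<bar> \<le> m" and c'_Lipschitz: "\<bar>c' x - c' z\<bar> \<le> m * \<bar>x - z\<bar>"
    and c_one: "x \<le> 0 \<or> L \<le> x \<Longrightarrow> c x = 1" and c'_zero: "x \<le> 0 \<or> L \<le> x \<Longrightarrow> c' x = 0"
    and C0_pos: "0 < C0" and L_pos: "0 < L" and m_pos: "0 < m"
begin

lemma c_pos [simp]: "0 < c x" and c_nz [simp]: "c x \<noteq> 0"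
  using c_lower[of x] C0_pos by auto

lemma C1_pos: "0 < C1"
  using c_pos[of 0] c_upper[of 0] by linarith

lemma c_cont: "continuous_on UNIV c"
  using c_deriv by (meson DERIV_isCont continuous_at_imp_continuous_on)

lemma c_cont_on: "continuous_on S f \<Longrightarrow> continuous_on S (\<lambda>x. c (f x))"
  by (rule cont2_compose1[OF c_cont])

lemma c'_cont: "continuous_on UNIV c'"
proof -
  have "m-lipschitz_on UNIV c'"
    using c'_Lipschitz m_pos by (intro lipschitz_onI) (auto simp: dist_real_def)
  then show ?thesis by (rule lipschitz_on_continuous_on)
qed

definition \<theta> :: "real \<Rightarrow> real" where "\<theta> = prim (\<lambda>x. 1 / c x)"

lemma \<theta>_deriv: "(\<theta> has_real_derivative 1 / c x) (at x)"
  unfolding \<theta>_def by (intro has_derivative_prim continuous_intros c_cont) auto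

lemma \<theta>_0 [simp]: "\<theta> 0 = 0"
  by (simp add: \<theta>_def)

lemma \<theta>_cont_on: "continuous_on S f \<Longrightarrow> continuous_on S (\<lambda>x. \<theta> (f x))"
  by (rule cont2_compose1) (use \<theta>_deriv in \<open>meson DERIV_isCont continuous_at_imp_continuous_on\<close>)

lemma \<theta>_diff_lower: "x \<le> z \<Longrightarrow> (z - x) / C1 \<le> \<theta> z - \<theta> x"
proof -
  assume "x \<le> z"
  have "\<theta> x - x / C1 \<le> \<theta> z - z / C1"
  proof (rule DERIV_nonneg_imp_nondecreasing[OF \<open>x \<le> z\<close>])
    fix w
    have "((\<lambda>x. \<theta> x - x / C1) has_real_derivative 1 / c w - 1 / C1) (at w)"
      using C1_pos by (auto intro!: derivative_eq_intros \<theta>_deriv)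
    moreover have "1 / C1 \<le> 1 / c w"
      using c_upper by (intro divide_left_mono mult_pos_pos C1_pos) auto
    ultimately show "\<exists>y. ((\<lambda>x. \<theta> x - x / C1) has_real_derivative y) (at w) \<and> 0 \<le> y"
      by (intro exI conjI) auto
  qed
  then show ?thesis by (simp add: diff_divide_distrib)
qed

lemma \<theta>_diff_upper: "x \<le> z \<Longrightarrow> \<theta> z - \<theta> x \<le> (z - x) / C0"
proof -
  assume "x \<le> z"
  have "x / C0 - \<theta> x \<le> z / C0 - \<theta> z"
  proof (rule DERIV_nonneg_imp_nondecreasing[OF \<open>x \<le> z\<close>])
    fix w
    have "((\<lambda>x. x / C0 - \<theta> x) has_real_derivative 1 / C0 - 1 / c w) (at w)"
      using C0_pos by (auto intro!: derivative_eq_intros \<theta>_deriv)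
    moreover have "1 / c w \<le> 1 / C0"
      using c_lower by (intro divide_left_mono mult_pos_pos C0_pos) auto
    ultimately show "\<exists>y. ((\<lambda>x. x / C0 - \<theta> x) has_real_derivative y) (at w) \<and> 0 \<le> y"
      by (intro exI conjI) auto
  qed
  then show ?thesis by (simp add: diff_divide_distrib)
qed

lemma \<theta>_less: "x < z \<Longrightarrow> \<theta> x < \<theta> z"
  using \<theta>_diff_lower[of x z] C1_pos divide_pos_pos[of "z - x" C1] by linarith

lemma \<theta>_bij: "bij \<theta>"
proof (rule bijI)
  show "inj \<theta>"
    using \<theta>_less by (intro injI) (metis less_irrefl linorder_less_linear)
  show "surj \<theta>"
    unfolding surj_def
  proof
    fix y
    have R: "\<bar>y\<bar> \<le> \<theta> (C1 * \<bar>y\<bar>)" "\<theta> (- (C1 * \<bar>y\<bar>)) \<le> - \<bar>y\<bar>"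
      using \<theta>_diff_lower[of 0 "C1 * \<bar>y\<bar>"] \<theta>_diff_lower[of "- (C1 * \<bar>y\<bar>)" 0] C1_pos by auto
    have "\<exists>x\<ge>- (C1 * \<bar>y\<bar>). x \<le> C1 * \<bar>y\<bar> \<and> \<theta> x = y"
      using R C1_pos by (intro IVT' \<theta>_cont_on continuous_intros) (auto simp: abs_le_iff)
    then show "\<exists>x. y = \<theta> x" by blast
  qed
qed

definition X :: "real \<Rightarrow> real" where "X = inv \<theta>"

lemma X_\<theta> [simp]: "X (\<theta> x) = x" and \<theta>_X [simp]: "\<theta> (X y) = y"
  unfolding X_def using \<theta>_bij by (auto simp: bij_is_inj bij_is_surj surj_f_inv_f)

lemma X_Lipschitz: "\<bar>X y - X z\<bar> \<le> C1 * \<bar>y - z\<bar>"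
proof -
  have *: "x - w \<le> C1 * \<bar>\<theta> x - \<theta> w\<bar>" if "w \<le> x" for x w
    using \<theta>_diff_lower[OF that] C1_pos by (simp add: pos_divide_le_eq mult.commute) (smt (verit) mult_left_mono)
  show ?thesis
    using *[of "X z" "X y"] *[of "X y" "X z"] by (cases "X z \<le> X y") (auto simp: abs_minus_commute)
qed

lemma X_cont: "continuous_on UNIV X"
proof -
  have "C1-lipschitz_on UNIV X"
    using X_Lipschitz C1_pos by (intro lipschitz_onI) (auto simp: dist_real_def)
  then show ?thesis by (rule lipschitz_on_continuous_on)
qed

lemma X_deriv: "(X has_real_derivative c (X y)) (at y)"
proof -
  have "(X has_real_derivative inverse (1 / c (X y))) (at y)"
  proof (rule DERIV_inverse_function[where a = "y - 1" and b = "y + 1"])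
    show "(\<theta> has_real_derivative 1 / c (X y)) (at (X y))" by (rule \<theta>_deriv)
    show "isCont X y" using X_cont by (simp add: continuous_on_eq_continuous_at)
  qed auto
  then show ?thesis by simp
qed

lemma X_0 [simp]: "X 0 = 0"
  using X_\<theta>[of 0] by simp

lemma X_mono: "y \<le> z \<Longrightarrow> X y \<le> X z"
  using \<theta>_less[of "X z" "X y"] by (simp add: not_less[symmetric]) (metis not_less)

text \<open>The factor c in the derivative of \<open>X\<close> cancels the 1 / c of the logarithmic
  derivative.\<close>

definition a :: "real \<Rightarrow> real" where "a y = c' (X y)"

lemma a_profile: "profile a m (L / C0)"
proof
  show "continuous_on UNIV a"
    unfolding a_def by (intro cont2_compose1[OF c'_cont] X_cont)
  show "\<bar>a y\<bar> \<le> m" for y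
    by (simp add: a_def c'_bound)
  show "a y = 0" if "y \<le> 0 \<or> L / C0 \<le> y" for y
  proof -
    have "L \<le> X y" if "L / C0 \<le> y"
    proof -
      have "\<theta> L \<le> y" using \<theta>_diff_upper[of 0 L] L_pos that by simp
      from X_mono[OF this] show ?thesis by simp
    qed
    moreover have "X y \<le> 0" if "y \<le> 0"
      using X_mono[OF that] by simp
    ultimately show ?thesis
      using that c'_zero by (auto simp: a_def)
  qed
qed (use m_pos L_pos C0_pos in auto)

sublocale profile a m "L / C0"
  by (rule a_profile)

lemma a_Lipschitz: "\<bar>a y - a z\<bar> \<le> m * C1 * \<bar>y - z\<bar>"
proof -
  have "\<bar>a y - a z\<bar> \<le> m * \<bar>X y - X z\<bar>"
    unfolding a_def by (rule c'_Lipschitz)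
  also have "\<dots> \<le> m * (C1 * \<bar>y - z\<bar>)"
    using m_pos X_Lipschitz by (intro mult_left_mono) auto
  finally show ?thesis by (simp add: mult.assoc)
qed

lemma c_X: "c (X y) = exp (prim a y)"
proof -
  have d: "((\<lambda>y. ln (c (X y))) has_real_derivative a y) (at y)" for y
    using DERIV_chain2[OF c_deriv X_deriv, of y]
    by (auto intro!: derivative_eq_intros simp: a_def)
  have "prim a y = ln (c (X y))"
    using prim_FTC[OF d, of y] by (simp add: c_one)
  then show ?thesis by simp
qed

lemma \<kappa>_squared: "\<kappa> (\<theta> x) * \<kappa> (\<theta> x) = c x"
  using c_X[of "\<theta> x"] by (simp add: \<kappa>_def flip: exp_add)

definition u :: "(real \<Rightarrow> real) \<Rightarrow> real \<Rightarrow> real \<Rightarrow> real" where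
  "u f t x = U f (t - \<theta> x) (\<theta> x)"

definition ut :: "(real \<Rightarrow> real) \<Rightarrow> real \<Rightarrow> real \<Rightarrow> real" where
  "ut f t x = \<kappa> (\<theta> x) / 2 * (Z f (t - \<theta> x) (\<theta> x) + Wm f (t - \<theta> x) (\<theta> x))"

definition ux :: "(real \<Rightarrow> real) \<Rightarrow> real \<Rightarrow> real \<Rightarrow> real" where
  "ux f t x = (Z f (t - \<theta> x) (\<theta> x) - Wm f (t - \<theta> x) (\<theta> x)) / (2 * \<kappa> (\<theta> x))"

lemma ut_cont: "causal f \<Longrightarrow> cont2 (ut f)"
  unfolding ut_def by (intro continuous_intros \<kappa>_cont_on \<theta>_cont_on Z_cont_on Wm_cont_on) auto

lemma ux_cont: "causal f \<Longrightarrow> cont2 (ux f)"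
  unfolding ux_def by (intro continuous_intros \<kappa>_cont_on \<theta>_cont_on Z_cont_on Wm_cont_on)
    (auto simp: less_imp_neq[OF \<kappa>_pos, symmetric])

lemma u_cont: "causal f \<Longrightarrow> cont2 (u f)"
  unfolding u_def U_def
  by (intro continuous_intros \<kappa>_cont_on \<theta>_cont_on prim_continuous_on Z_cont_on Wm_cont_on) auto

lemma
  assumes "causal f" "\<And>t. t \<le> \<delta> \<Longrightarrow> f t = 0" "t \<le> \<theta> x + \<delta>" "0 \<le> \<delta>"
  shows u_zero: "u f t x = 0" and ut_zero: "ut f t x = 0" and ux_zero: "ux f t x = 0"
  using Z_causal[OF assms(1,2)] Wm_causal[OF assms(1,2)] U_causal[OF assms(1,2) _ assms(4)] assms(3)
  by (simp_all add: u_def ut_def ux_def)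

text \<open>At depth 0 the operator \<open>B\<close> is evaluation and \<kappa> is 1, so the
  boundary condition holds by construction.\<close>

lemma ux_0: "ux f t 0 = f t"
  by (simp add: ux_def Wm_def B_def)

lemma u_deriv_t:
  assumes "causal f"
  shows "((\<lambda>t. u f t x) has_real_derivative ut f t x) (at t)"
proof -
  have "((\<lambda>t. t - \<theta> x) has_real_derivative 1) (at t)"
    by (auto intro!: derivative_eq_intros)
  from DERIV_chain2[OF U_deriv_\<xi>[OF assms] this] show ?thesis
    by (simp add: u_def ut_def)
qed

context
  fixes f f' :: "real \<Rightarrow> real"
  assumes f: "causal f" and f': "causal f'" and d: "\<And>t. (f has_real_derivative f' t) (at t)"
begin

lemma ut_deriv_t: "((\<lambda>t. ut f t x) has_real_derivative ut f' t x) (at t)"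
proof -
  have s: "((\<lambda>t. t - \<theta> x) has_real_derivative 1) (at t)"
    by (auto intro!: derivative_eq_intros)
  show ?thesis
    unfolding ut_def
    using DERIV_chain2[OF Z_deriv_\<xi>[OF f f' d] s] DERIV_chain2[OF Wm_deriv_\<xi>[OF f f' d] s]
    by (intro DERIV_cmult DERIV_add) auto
qed

lemma chain_\<theta>:
  assumes F\<xi>: "\<And>\<xi> y. ((\<lambda>\<xi>. F \<xi> y) has_real_derivative F\<xi> \<xi> y) (at \<xi>)"
    and Fy: "\<And>\<xi> y. (F \<xi> has_real_derivative Fy \<xi> y) (at y)" and c: "cont2 Fy"
  shows "((\<lambda>x. F (t - \<theta> x) (\<theta> x)) has_real_derivative
     (Fy (t - \<theta> x) (\<theta> x) - F\<xi> (t - \<theta> x) (\<theta> x)) / c x) (at x)"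
proof -
  have s: "((\<lambda>x. t - \<theta> x) has_real_derivative - (1 / c x)) (at x)"
    using \<theta>_deriv by (auto intro!: derivative_eq_intros)
  show ?thesis
    by (rule DERIV_cong[OF chain2[OF F\<xi> Fy c s \<theta>_deriv]]) (simp add: field_simps)
qed

lemma u_deriv_x: "(u f t has_real_derivative ux f t x) (at x)"
proof -
  have k: "\<kappa> (\<theta> x) * \<kappa> (\<theta> x) = c x" by (rule \<kappa>_squared)
  have "(u f t has_real_derivative (\<kappa> (\<theta> x) * Z f (t - \<theta> x) (\<theta> x)
      - \<kappa> (\<theta> x) / 2 * (Z f (t - \<theta> x) (\<theta> x) + Wm f (t - \<theta> x) (\<theta> x))) / c x) (at x)"
    unfolding u_def[abs_def]
    by (rule chain_\<theta>[OF U_deriv_\<xi>[OF f] U_deriv_y[OF f f' d]])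
       (intro continuous_intros \<kappa>_cont_on Z_cont_on f)
  then show ?thesis
    by (rule DERIV_cong) (simp add: ux_def k[symmetric] field_simps less_imp_neq[OF \<kappa>_pos, symmetric])
qed

text \<open>This is the wave equation, because \<open>ut f'\<close> is the second time derivative by
  \<open>ut_deriv_t\<close>. Division by \<kappa> removes the coefficient terms and leaves Z f' /
  \<kappa> as the derivative at fixed \<xi>.\<close>

lemma ux_deriv_x: "(ux f t has_real_derivative ut f' t x / (c x)\<^sup>2) (at x)"
proof -
  have k: "\<kappa> (\<theta> x) * \<kappa> (\<theta> x) = c x" by (rule \<kappa>_squared)
  have nz: "\<kappa> y \<noteq> 0" for y by (simp add: less_imp_neq[OF \<kappa>_pos, symmetric])
  define F where "F \<xi> y = (Z f \<xi> y - Wm f \<xi> y) / (2 * \<kappa> y)" for \<xi> y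
  have 1: "((\<lambda>\<xi>. F \<xi> y) has_real_derivative (Z f' \<xi> y - Wm f' \<xi> y) / (2 * \<kappa> y)) (at \<xi>)" for \<xi> y
    unfolding F_def using Z_deriv_\<xi>[OF f f' d] Wm_deriv_\<xi>[OF f f' d] by (intro DERIV_cdivide DERIV_diff)
  have 2: "(F \<xi> has_real_derivative Z f' \<xi> y / \<kappa> y) (at y)" for \<xi> y
  proof -
    have "((\<lambda>y. Z f \<xi> y - Wm f \<xi> y) has_real_derivative
       (2 * Z f' \<xi> y - a y * Wm f \<xi> y / 2) - (- a y * Z f \<xi> y / 2)) (at y)"
      by (intro DERIV_diff Z_deriv_y[OF f f' d] Wm_deriv_y[OF f f' d])
    from DERIV_divide[OF this DERIV_cmult[OF \<kappa>_deriv], of 2] nz[of y]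
    have "(F \<xi> has_real_derivative ((2 * Z f' \<xi> y - a y * Wm f \<xi> y / 2 - - a y * Z f \<xi> y / 2) * (2 * \<kappa> y)
        - (Z f \<xi> y - Wm f \<xi> y) * (2 * (a y / 2 * \<kappa> y))) / (2 * \<kappa> y * (2 * \<kappa> y))) (at y)"
      unfolding F_def[abs_def] by simp
    then show ?thesis
      by (rule DERIV_cong) (use nz[of y] in \<open>simp add: field_simps\<close>)
  qed
  have "(ux f t has_real_derivative (Z f' (t - \<theta> x) (\<theta> x) / \<kappa> (\<theta> x)
      - (Z f' (t - \<theta> x) (\<theta> x) - Wm f' (t - \<theta> x) (\<theta> x)) / (2 * \<kappa> (\<theta> x))) / c x) (at x)"
  proof -
    have "cont2 (\<lambda>\<xi> y. Z f' \<xi> y / \<kappa> y)"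
      by (intro continuous_intros \<kappa>_cont_on Z_cont_on f') (simp add: nz)
    from chain_\<theta>[OF 1 2 this, of t x] show ?thesis
      unfolding F_def ux_def[abs_def] .
  qed
  then show ?thesis
    by (rule DERIV_cong) (use nz[of "\<theta> x"] in \<open>simp add: ut_def k[symmetric] power2_eq_square field_simps\<close>)
qed

end

end

section \<open>Square integrable functions and integrals over the strip\<close>

lemma square_integrable_cmult: "square_integrable M f \<Longrightarrow> square_integrable M (\<lambda>x. c * f x)"
  by (auto simp: square_integrable_def power_mult_distrib)

text \<open>The squared triangle inequality, applied to f and to - f.\<close>

lemma Cauchy_Schwarz_integral:
  assumes f: "square_integrable M f" and g: "square_integrable M g"
  shows "\<bar>LINT x|M. f x * g x\<bar> \<le> sqrt (LINT x|M. (f x)\<^sup>2) * sqrt (LINT x|M. (g x)\<^sup>2)"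
proof -
  have le: "(LINT x|M. f x * g x) \<le> sqrt (LINT x|M. (f x)\<^sup>2) * sqrt (LINT x|M. (g x)\<^sup>2)"
    if f: "square_integrable M f" for f
  proof -
    have i: "integrable M (\<lambda>x. (f x)\<^sup>2)" "integrable M (\<lambda>x. (g x)\<^sup>2)" "integrable M (\<lambda>x. f x * g x)"
      using f g square_integrable_mult[OF f g] by (auto simp: square_integrable_def)
    define a b where "a = (LINT x|M. (f x)\<^sup>2)" and "b = (LINT x|M. (g x)\<^sup>2)"
    have ab: "0 \<le> a" "0 \<le> b" by (simp_all add: a_def b_def)
    have "(LINT x|M. (f x + g x)\<^sup>2) = a + b + 2 * (LINT x|M. f x * g x)"
      using i by (simp add: power2_sum a_def b_def mult.assoc)
    moreover have "(LINT x|M. (f x + g x)\<^sup>2) \<le> (sqrt a + sqrt b)\<^sup>2"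
      using L2_triangle[OF f g] ab by (intro sqrt_le_D) (simp add: a_def b_def)
    ultimately have "a + b + 2 * (LINT x|M. f x * g x) \<le> a + b + 2 * (sqrt a * sqrt b)"
      using ab by (simp add: power2_sum algebra_simps)
    then show ?thesis by (simp add: a_def b_def)
  qed
  have "square_integrable M (\<lambda>x. - f x)"
    using square_integrable_cmult[OF f, of "-1"] by simp
  from le[OF f] le[OF this] show ?thesis by (simp add: abs_le_iff)
qed

definition L2_tendsto :: "'a measure \<Rightarrow> (nat \<Rightarrow> 'a \<Rightarrow> real) \<Rightarrow> ('a \<Rightarrow> real) \<Rightarrow> bool" where
  "L2_tendsto M f g \<longleftrightarrow> square_integrable M g \<and> (\<forall>n. square_integrable M (f n)) \<and>
     (\<lambda>n. LINT x|M. (f n x - g x)\<^sup>2) \<longlonglongrightarrow> 0"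

lemma L2_tendsto_integral:
  assumes f: "L2_tendsto M f g" and h: "square_integrable M h"
  shows "(\<lambda>n. LINT x|M. f n x * h x) \<longlonglongrightarrow> (LINT x|M. g x * h x)"
proof -
  have si: "square_integrable M (f n)" "square_integrable M g"
    and lim: "(\<lambda>n. LINT x|M. (f n x - g x)\<^sup>2) \<longlonglongrightarrow> 0" for n
    using f by (auto simp: L2_tendsto_def)
  have eq: "(LINT x|M. (f n x - g x) * h x) = (LINT x|M. f n x * h x) - (LINT x|M. g x * h x)" for n
    using square_integrable_mult[OF si(1) h] square_integrable_mult[OF si(2) h]
    by (simp add: left_diff_distrib)
  have "(\<lambda>n. sqrt (LINT x|M. (f n x - g x)\<^sup>2) * sqrt (LINT x|M. (h x)\<^sup>2)) \<longlonglongrightarrow> sqrt 0 * sqrt (LINT x|M. (h x)\<^sup>2)"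
    by (intro tendsto_intros lim)
  then have lim0: "(\<lambda>n. sqrt (LINT x|M. (f n x - g x)\<^sup>2) * sqrt (LINT x|M. (h x)\<^sup>2)) \<longlonglongrightarrow> 0"
    by simp
  have "norm ((LINT x|M. f n x * h x) - (LINT x|M. g x * h x))
      \<le> sqrt (LINT x|M. (f n x - g x)\<^sup>2) * sqrt (LINT x|M. (h x)\<^sup>2)" for n
    unfolding eq[symmetric] real_norm_def by (rule Cauchy_Schwarz_integral[OF square_integrable_diff[OF si] h])
  then have "(\<lambda>n. (LINT x|M. f n x * h x) - (LINT x|M. g x * h x)) \<longlonglongrightarrow> 0"
    by (intro Lim_null_comparison[OF always_eventually lim0] allI)
  then show ?thesis by (rule LIM_zero_cancel)
qed

text \<open>Bridge from Lebesgue to Henstock-Kurzweil integrals, on which the calculus of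
  \<open>prim\<close> rests: a continuous integrand that lives on a bounded Borel set.\<close>

lemma restrict_integral_bounded:
  fixes k :: "'a::euclidean_space \<Rightarrow> real"
  assumes S: "S \<in> sets borel" and D: "D \<in> sets borel" "D \<subseteq> S" "D \<subseteq> cbox a b"
    and k: "continuous_on UNIV k" and z: "\<And>x. x \<in> S \<Longrightarrow> x \<notin> D \<Longrightarrow> k x = 0"
  shows "integrable (restrict_space lborel S) k"
    and "(LINT x|restrict_space lborel S. k x) = integral D k"
proof -
  have "continuous_on (cbox a b) k" using k continuous_on_subset by blast
  then have "set_integrable lborel (cbox a b) k"
    unfolding set_integrable_def by (intro borel_integrable_compact) auto
  then have D': "set_integrable lborel D k"
    by (rule set_integrable_subset) (use D in auto)
  have eq: "(\<lambda>x. indicator S x *\<^sub>R k x) = (\<lambda>x. indicator D x *\<^sub>R k x)"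
    using z D(2) by (auto simp: fun_eq_iff indicator_def)
  have m: "S \<inter> space lborel \<in> sets lborel" using S by simp
  show "integrable (restrict_space lborel S) k"
    unfolding integrable_restrict_space[OF m] eq using D' unfolding set_integrable_def .
  show "(LINT x|restrict_space lborel S. k x) = integral D k"
    unfolding integral_restrict_space[OF m] eq
    using set_borel_integral_eq_integral(2)[OF D'] unfolding set_lebesgue_integral_def .
qed

lemma strip_borel: "{0<..<2 * T} \<times> {0<..} \<in> sets (borel :: (real \<times> real) measure)"
  by (auto intro!: borel_open open_Times)

lemma continuous_measurable_restrict:
  "continuous_on UNIV k \<Longrightarrow> k \<in> borel_measurable (restrict_space lborel S)"
  by (rule measurable_restrict_space1) (simp add: borel_measurable_continuous_onI)

lemma strip_measurable: "continuous_on UNIV k \<Longrightarrow> k \<in> borel_measurable (strip T)"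
  unfolding strip_def by (rule continuous_measurable_restrict)

lemma box_Pair_real: "box (a, c) (b, d) = {a<..<b} \<times> {c<..<(d::real)}" for a b :: real
  by (force simp: box_def Basis_prod_def)

text \<open>Vanishing beyond R reduces the strip to a box, where the integral of a continuous
  function is an iterated one.\<close>

lemma
  assumes k: "cont2 k" and z: "\<And>t x. 0 \<le> t \<Longrightarrow> t \<le> 2 * T \<Longrightarrow> R \<le> x \<Longrightarrow> k t x = 0"
  shows strip_integrable: "integrable (strip T) (\<lambda>z. k (fst z) (snd z))"
    and strip_integral: "(LINT z|strip T. k (fst z) (snd z)) = integral {0..2 * T} (\<lambda>t. integral {0..R} (k t))"
    and strip_square_integrable: "square_integrable (strip T) (\<lambda>z. k (fst z) (snd z))"
proof -
  have D: "box (0, 0) (2 * T, R) \<subseteq> {0<..<2 * T} \<times> {0<..}"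
    by (auto simp: box_Pair_real)
  have z': "k (fst x) (snd x) = 0" if "x \<in> {0<..<2 * T} \<times> {0<..}" "x \<notin> box (0, 0) (2 * T, R)" for x
    using that z[of "fst x" "snd x"] by (cases x) (auto simp: box_Pair_real not_less)
  note ri = restrict_integral_bounded[OF strip_borel[of T] borel_open[OF open_box] D box_subset_cbox]
  show "integrable (strip T) (\<lambda>z. k (fst z) (snd z))"
    unfolding strip_def using ri(1)[OF k z'] .
  have "(LINT z|strip T. k (fst z) (snd z)) = integral (box (0, 0) (2 * T, R)) (\<lambda>z. k (fst z) (snd z))"
    unfolding strip_def using ri(2)[OF k z'] .
  also have "\<dots> = integral (cbox (0, 0) (2 * T, R)) (\<lambda>z. k (fst z) (snd z))"
    by (rule integral_open_interval)
  also have "\<dots> = integral (cbox 0 (2 * T)) (\<lambda>t. integral (cbox 0 R) (\<lambda>x. k (fst (t, x)) (snd (t, x))))"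
    by (rule integral_prod_continuous) (use k continuous_on_subset in blast)
  finally show "(LINT z|strip T. k (fst z) (snd z)) = integral {0..2 * T} (\<lambda>t. integral {0..R} (k t))"
    by simp
  have k2: "continuous_on UNIV (\<lambda>z. (k (fst z) (snd z))\<^sup>2)"
    by (intro continuous_intros k)
  have "integrable (strip T) (\<lambda>z. (k (fst z) (snd z))\<^sup>2)"
    unfolding strip_def using ri(1)[OF k2] z' by auto
  then show "square_integrable (strip T) (\<lambda>z. k (fst z) (snd z))"
    using strip_measurable[OF k] by (simp add: square_integrable_def)
qed

lemma strip_integral_deriv_x:
  assumes \<Psi>: "cont2 \<Psi>" and d: "\<And>t x. (\<Phi> t has_real_derivative \<Psi> t x) (at x)" and "0 \<le> R"
    and z: "\<And>t x. 0 \<le> t \<Longrightarrow> t \<le> 2 * T \<Longrightarrow> R \<le> x \<Longrightarrow> \<Psi> t x = 0" "\<And>t. 0 \<le> t \<Longrightarrow> t \<le> 2 * T \<Longrightarrow> \<Phi> t R = 0"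
  shows "(LINT z|strip T. \<Psi> (fst z) (snd z)) = - integral {0..2 * T} (\<lambda>t. \<Phi> t 0)"
proof -
  have "integral {0..R} (\<Psi> t) = \<Phi> t R - \<Phi> t 0" for t
    using \<open>0 \<le> R\<close> d
    by (intro integral_unique fundamental_theorem_of_calculus)
      (auto simp flip: has_real_derivative_iff_has_vector_derivative intro: has_field_derivative_at_within)
  then have "(LINT z|strip T. \<Psi> (fst z) (snd z)) = integral {0..2 * T} (\<lambda>t. \<Phi> t R - \<Phi> t 0)"
    using strip_integral[OF \<Psi> z(1)] by simp
  also have "\<dots> = integral {0..2 * T} (\<lambda>t. - \<Phi> t 0)"
    using z(2) by (intro Henstock_Kurzweil_Integration.integral_cong) auto
  finally show ?thesis by simp
qed

lemma strip_integral_deriv_t: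
  assumes \<Psi>: "cont2 \<Psi>" and d: "\<And>t x. ((\<lambda>t. \<Phi> t x) has_real_derivative \<Psi> t x) (at t)" and "0 \<le> T"
    and z: "\<And>t x. 0 \<le> t \<Longrightarrow> t \<le> 2 * T \<Longrightarrow> R \<le> x \<Longrightarrow> \<Psi> t x = 0"
  shows "(LINT z|strip T. \<Psi> (fst z) (snd z)) = integral {0..R} (\<lambda>x. \<Phi> (2 * T) x - \<Phi> 0 x)"
proof -
  have "integral {0..2 * T} (\<lambda>t. \<Psi> t x) = \<Phi> (2 * T) x - \<Phi> 0 x" for x
    using \<open>0 \<le> T\<close> d
    by (intro integral_unique fundamental_theorem_of_calculus)
      (auto simp flip: has_real_derivative_iff_has_vector_derivative intro: has_field_derivative_at_within)
  moreover have "integral (cbox 0 (2 * T)) (\<lambda>t. integral (cbox 0 R) (\<Psi> t))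
      = integral (cbox 0 R) (\<lambda>x. integral (cbox 0 (2 * T)) (\<lambda>t. \<Psi> t x))"
    by (rule integral_swap_continuous) (use \<Psi> continuous_on_subset in \<open>auto simp: case_prod_unfold\<close>)
  ultimately show ?thesis
    using strip_integral[OF \<Psi> z] by simp
qed

lemma
  fixes k :: "real \<Rightarrow> real"
  assumes k: "continuous_on UNIV k"
  shows time_interval_integrable: "integrable (time_interval T) k"
    and time_interval_integral: "(LINT t|time_interval T. k t) = integral {0..2 * T} k"
    and time_interval_square_integrable: "square_integrable (time_interval T) k"
proof -
  have i: "integrable (time_interval T) k" "(LINT t|time_interval T. k t) = integral {0<..<2 * T} k"
    if k: "continuous_on UNIV k" for k :: "real \<Rightarrow> real"
    unfolding time_interval_def
    using restrict_integral_bounded[of "{0<..<2 * T}" "{0<..<2 * T}" 0 "2 * T" k] k by force+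
  show "integrable (time_interval T) k" using i[OF k] by simp
  show "(LINT t|time_interval T. k t) = integral {0..2 * T} k"
    using i[OF k] by (simp add: integral_open_interval_real)
  have "continuous_on UNIV (\<lambda>x. (k x)\<^sup>2)" by (intro continuous_intros k)
  from i(1)[OF this] show "square_integrable (time_interval T) k"
    using continuous_measurable_restrict[OF k]
    by (simp add: square_integrable_def time_interval_def)
qed

lemma
  fixes k :: "real \<Rightarrow> real"
  assumes k: "continuous_on UNIV k" and z: "\<And>x. R \<le> x \<Longrightarrow> k x = 0" and R: "0 \<le> R"
  shows halfline_integral: "(LINT x|halfline. k x) = integral {0..R} k"
    and halfline_square_integrable: "square_integrable halfline k"
proof -
  have i: "integrable halfline k" "(LINT x|halfline. k x) = integral {0..R} k"
    if k: "continuous_on UNIV k" and z: "\<And>x. R \<le> x \<Longrightarrow> k x = 0" for k :: "real \<Rightarrow> real"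
    unfolding halfline_def
    using restrict_integral_bounded[of "{0..}" "{0..R}" 0 R k] k z by force+
  show "(LINT x|halfline. k x) = integral {0..R} k" using i[OF k z] by simp
  have "continuous_on UNIV (\<lambda>x. (k x)\<^sup>2)" by (intro continuous_intros k)
  from i(1)[OF this] z show "square_integrable halfline k"
    using continuous_measurable_restrict[OF k]
    by (simp add: square_integrable_def halfline_def)
qed

lemma C1_testI:
  assumes dt: "\<And>t x. ((\<lambda>t. w t x) has_real_derivative wt t x) (at t)"
    and dx: "\<And>t x. (w t has_real_derivative wx t x) (at x)"
    and c: "cont2 wt" "cont2 wx"
    and K: "compact K" "K \<subseteq> V" "\<And>t x. (t, x) \<notin> K \<Longrightarrow> w t x = 0"
  shows "(\<lambda>(t, x). w t x) \<in> C1_test V"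
    and "part_t (\<lambda>(t, x). w t x) = (\<lambda>(t, x). wt t x)"
    and "part_x (\<lambda>(t, x). w t x) = (\<lambda>(t, x). wx t x)"
proof -
  show t: "part_t (\<lambda>(t, x). w t x) = (\<lambda>(t, x). wt t x)"
    using dt by (auto simp: part_t_def fun_eq_iff intro: DERIV_imp_deriv)
  show x: "part_x (\<lambda>(t, x). w t x) = (\<lambda>(t, x). wx t x)"
    using dx by (auto simp: part_x_def fun_eq_iff intro: DERIV_imp_deriv)
  have "(\<lambda>(t, x). w t x) differentiable_on UNIV"
    using has_derivative_pair[OF dt dx c(2)]
    by (auto simp: differentiable_on_def differentiable_def case_prod_unfold)
  then show "(\<lambda>(t, x). w t x) \<in> C1_test V"
    unfolding C1_test_def t x mem_Collect_eq case_prod_unfold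
    using c K(1,2) t[unfolded case_prod_unfold] x[unfolded case_prod_unfold]
    by (intro conjI exI[of _ K] allI impI K(3)) auto
qed

lemma C1_testD:
  assumes "\<phi> \<in> C1_test V"
  obtains R where "0 < R" "\<And>t x. ((\<lambda>s. \<phi> (s, x)) has_real_derivative part_t \<phi> (t, x)) (at t)"
      "\<And>t x. ((\<lambda>y. \<phi> (t, y)) has_real_derivative part_x \<phi> (t, x)) (at x)"
      "continuous_on UNIV \<phi>" "continuous_on UNIV (part_t \<phi>)" "continuous_on UNIV (part_x \<phi>)"
      "\<And>z. z \<notin> V \<Longrightarrow> \<phi> z = 0"
      "\<And>t x. R \<le> x \<Longrightarrow> \<phi> (t, x) = 0" "\<And>t x. R \<le> x \<Longrightarrow> part_t \<phi> (t, x) = 0"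
      "\<And>t x. R \<le> x \<Longrightarrow> part_x \<phi> (t, x) = 0"
proof -
  have diff: "\<phi> differentiable (at z)" for z
    using assms unfolding C1_test_def differentiable_on_def by blast
  have s: "(\<lambda>s. \<phi> (s, x)) differentiable (at t)" and y: "(\<lambda>y. \<phi> (t, y)) differentiable (at x)" for t x
    by (rule differentiable_compose[of \<phi>, OF diff], simp)+
  have dt: "((\<lambda>s. \<phi> (s, x)) has_real_derivative part_t \<phi> (t, x)) (at t)" for t x
    using s[of x t] by (simp add: part_t_def DERIV_deriv_iff_real_differentiable)
  have dx: "((\<lambda>y. \<phi> (t, y)) has_real_derivative part_x \<phi> (t, x)) (at x)" for t x
    using y[of t x] by (simp add: part_x_def DERIV_deriv_iff_real_differentiable)
  obtain K where K: "compact K" "K \<subseteq> V" "\<And>z. z \<notin> K \<Longrightarrow> \<phi> z = 0"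
    using assms by (auto simp: C1_test_def)
  obtain N where N: "0 < N" "\<And>z. z \<in> K \<Longrightarrow> norm z \<le> N"
    using compact_imp_bounded[OF K(1)] unfolding bounded_pos by blast
  have \<phi>0: "\<phi> (t, x) = 0" if "N < x" for t x
  proof (rule K(3))
    have "\<bar>x\<bar> \<le> norm (t, x)" by (metis real_norm_def norm_snd_le)
    then show "(t, x) \<notin> K" using N(2)[of "(t, x)"] that by auto
  qed
  have t0: "part_t \<phi> (t, x) = 0" if "N < x" for t x
    using \<phi>0[OF that] by (simp add: part_t_def)
  have x0: "part_x \<phi> (t, x) = 0" if "N < x" for t x
  proof -
    have "((\<lambda>y. \<phi> (t, y)) has_real_derivative 0) (at x)"
      by (rule has_field_derivative_transform_within_open[of "\<lambda>_. 0" _ _ "{N<..}"])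
         (use that \<phi>0 in auto)
    then show ?thesis by (simp add: part_x_def DERIV_imp_deriv)
  qed
  \<comment> \<open>On the open set x > N the function vanishes together with its derivatives; N + 1
    turns this into a condition on closed half-planes.\<close>
  show ?thesis
  proof (rule that[of "N + 1", OF _ dt dx])
    show "0 < N + 1" using N by simp
    show "continuous_on UNIV \<phi>"
      using diff differentiable_imp_continuous_on differentiable_on_def by blast
    show "continuous_on UNIV (part_t \<phi>)" "continuous_on UNIV (part_x \<phi>)"
      using assms unfolding C1_test_def by blast+
    show "\<phi> z = 0" if "z \<notin> V" for z using K(2,3) that by blast
    fix t x assume "N + 1 \<le> x"
    then have "N < x" by simp
    then show "\<phi> (t, x) = 0" "part_t \<phi> (t, x) = 0" "part_x \<phi> (t, x) = 0"
      by (rule \<phi>0 t0 x0)+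
  qed
qed

section \<open>Density of regular functions\<close>

lemma tendsto_zero_bound:
  fixes f g :: "nat \<Rightarrow> real"
  assumes "\<And>n. \<bar>f n\<bar> \<le> g n" "g \<longlonglongrightarrow> 0"
  shows "f \<longlonglongrightarrow> 0"
  by (rule Lim_null_comparison[OF always_eventually assms(2)]) (use assms(1) in simp)

lemma tendsto_inverse_Suc: "(\<lambda>n. 1 / (real n + 1)) \<longlonglongrightarrow> 0"
  using LIMSEQ_inverse_real_of_nat by (simp add: inverse_eq_divide add.commute)

text \<open>A C^1 transition from 0 to 1 across [0, 1], the normalised primitive of the positive
  part of x (1 - x).\<close>

definition step :: "real \<Rightarrow> real" where
  "step x = prim (\<lambda>x. max 0 (x * (1 - x))) x / prim (\<lambda>x. max 0 (x * (1 - x))) 1"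

definition step' :: "real \<Rightarrow> real" where
  "step' x = max 0 (x * (1 - x)) / prim (\<lambda>x. max 0 (x * (1 - x))) 1"

lemma bump_cont: "continuous_on UNIV (\<lambda>x::real. max 0 (x * (1 - x)))"
  by (intro continuous_intros)

lemma step_deriv: "(step has_real_derivative step' x) (at x)"
  unfolding step_def[abs_def] step'_def
  by (intro DERIV_cdivide has_derivative_prim bump_cont)

lemma step_integral_pos: "0 < prim (\<lambda>x. max 0 (x * (1 - x))) 1"
proof -
  have "prim (\<lambda>x. max 0 (x * (1 - x))) 1 = prim (\<lambda>x. x * (1 - x)) 1"
    by (rule prim_cong) (auto simp: closed_segment_eq_real_ivl max_def mult_le_0_iff)
  also have "\<dots> = (1 / 2 * 1\<^sup>2 - 1 / 3 * 1 ^ 3) - (1 / 2 * 0\<^sup>2 - 1 / 3 * 0 ^ 3)"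
    by (rule prim_FTC) (auto intro!: derivative_eq_intros simp: power2_eq_square algebra_simps)
  finally show ?thesis by simp
qed

lemma step'_cont: "continuous_on UNIV step'"
  using step_integral_pos unfolding step'_def[abs_def] by (intro continuous_intros) auto

lemma step'_nonneg: "0 \<le> step' x"
  unfolding step'_def using step_integral_pos by (intro divide_nonneg_pos) auto

lemma step'_0: "x \<le> 0 \<Longrightarrow> step' x = 0"
  using mult_nonpos_nonneg[of x "1 - x"] by (simp add: step'_def)

lemma step'_1: "1 \<le> x \<Longrightarrow> step' x = 0"
  using mult_nonneg_nonpos[of x "1 - x"] by (simp add: step'_def)

lemma step_0: "x \<le> 0 \<Longrightarrow> step x = 0"
proof -
  assume x: "x \<le> 0"
  have "max 0 (s * (1 - s)) = 0" if "s \<in> closed_segment 0 x" for s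
    using x that mult_nonpos_nonneg[of s "1 - s"] by (auto simp: closed_segment_eq_real_ivl split: if_splits)
  from prim_vanish[OF this] show ?thesis by (simp add: step_def)
qed

lemma step_1:
  assumes "1 \<le> x"
  shows "step x = 1"
proof -
  have "max 0 (s * (1 - s)) = 0" if "1 \<le> s" for s :: real
    using that mult_nonneg_nonpos[of s "1 - s"] by simp
  from prim_cutoff[OF bump_cont this assms] show ?thesis
    using step_integral_pos by (simp add: step_def)
qed

lemma step_cont: "continuous_on UNIV step"
  using step_deriv by (meson DERIV_isCont continuous_at_imp_continuous_on)

lemma step_cont_on: "continuous_on S f \<Longrightarrow> continuous_on S (\<lambda>x. step (f x))"
  by (rule cont2_compose1[OF step_cont])

lemma step'_cont_on: "continuous_on S f \<Longrightarrow> continuous_on S (\<lambda>x. step' (f x))"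
  by (rule cont2_compose1[OF step'_cont])

lemma step_mono: "x \<le> z \<Longrightarrow> step x \<le> step z"
  by (rule DERIV_nonneg_imp_nondecreasing, assumption, intro exI conjI, rule step_deriv, rule step'_nonneg)

lemma step_range: "0 \<le> step x" "step x \<le> 1"
proof -
  show "0 \<le> step x" using step_mono[of 0 x] step_0[of 0] step_0[of x] by linarith
  show "step x \<le> 1" using step_mono[of x 1] step_1[of 1] step_1[of x] by linarith
qed

text \<open>The margin \<open>2 \<delta>\<close> makes the solution vanish near the initial time also for slightly negative \<open>x\<close>,
  where it is cut off.\<close>

definition regular_input :: "real \<Rightarrow> real \<Rightarrow> (real \<Rightarrow> real) \<Rightarrow> (real \<Rightarrow> real) \<Rightarrow> bool" where
  "regular_input T \<delta> f f' \<longleftrightarrow> 0 < \<delta> \<and> (\<forall>t. (f has_real_derivative f' t) (at t)) \<and>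
     continuous_on UNIV f' \<and> (\<forall>t. t \<le> 2 * \<delta> \<or> 2 * T - 2 * \<delta> \<le> t \<longrightarrow> f t = 0 \<and> f' t = 0)"

lemma regular_input_cont: "regular_input T \<delta> f f' \<Longrightarrow> continuous_on UNIV f"
  unfolding regular_input_def by (meson DERIV_isCont continuous_at_imp_continuous_on)

lemma space_time_interval [simp]: "space (time_interval T) = {0<..<2 * T}"
  by (simp add: time_interval_def space_restrict_space)

lemma finite_measure_time_interval: "finite_measure (time_interval T)"
  by (rule finite_measureI, cases "0 \<le> T")
    (simp_all add: time_interval_def emeasure_restrict_space space_restrict_space)

lemma L2_dominated_convergence:
  assumes f: "\<And>n. square_integrable M (f n)" and g: "square_integrable M g"
    and lim: "AE x in M. (\<lambda>n. f n x) \<longlonglongrightarrow> g x"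
    and w: "integrable M w" "\<And>n. AE x in M. (f n x - g x)\<^sup>2 \<le> w x"
  shows "L2_tendsto M f g"
proof -
  have m: "f n \<in> borel_measurable M" "g \<in> borel_measurable M" for n
    using f g by (auto simp: square_integrable_def)
  have "(\<lambda>n. LINT x|M. (f n x - g x)\<^sup>2) \<longlonglongrightarrow> (LINT x|M. 0)"
  proof (rule integral_dominated_convergence[where w = w])
    show "AE x in M. (\<lambda>n. (f n x - g x)\<^sup>2) \<longlonglongrightarrow> 0"
      using lim
    proof eventually_elim
      case (elim x)
      then have "(\<lambda>n. (f n x - g x)\<^sup>2) \<longlonglongrightarrow> (g x - g x)\<^sup>2" by (intro tendsto_intros)
      then show ?case by simp
    qed
  qed (use w m in \<open>auto\<close>)
  then show ?thesis using f g by (simp add: L2_tendsto_def)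
qed

text \<open>Density in \<epsilon>-form, so that closure under L2 limits
  (\<open>approximable_limit\<close>) needs no diagonal sequence. The class of approximable
  functions then grows from C^1 to continuous, bounded and square integrable ones.\<close>

definition approximable :: "real \<Rightarrow> (real \<Rightarrow> real) \<Rightarrow> bool" where
  "approximable T f \<longleftrightarrow> square_integrable (time_interval T) f \<and>
     (\<forall>e>0. \<exists>\<delta> g g'. regular_input T \<delta> g g' \<and> (LINT t|time_interval T. (g t - f t)\<^sup>2) < e)"

lemma integral_square_triangle:
  assumes "square_integrable M f" "square_integrable M g" "square_integrable M h"
  shows "(LINT x|M. (f x - h x)\<^sup>2) \<le> 2 * (LINT x|M. (f x - g x)\<^sup>2) + 2 * (LINT x|M. (g x - h x)\<^sup>2)"
proof -
  have i: "integrable M (\<lambda>x. (k x - l x)\<^sup>2)" if "square_integrable M k" "square_integrable M l" for k l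
    using square_integrable_diff[OF that] by (simp add: square_integrable_def)
  have "(LINT x|M. (f x - h x)\<^sup>2) \<le> (LINT x|M. 2 * (f x - g x)\<^sup>2 + 2 * (g x - h x)\<^sup>2)"
  proof (rule integral_mono)
    fix x
    have "0 \<le> ((f x - g x) - (g x - h x))\<^sup>2" by simp
    then show "(f x - h x)\<^sup>2 \<le> 2 * (f x - g x)\<^sup>2 + 2 * (g x - h x)\<^sup>2"
      by (simp add: power2_eq_square algebra_simps)
  qed (use i assms in auto)
  also have "\<dots> = 2 * (LINT x|M. (f x - g x)\<^sup>2) + 2 * (LINT x|M. (g x - h x)\<^sup>2)"
    using i assms by simp
  finally show ?thesis .
qed

lemma approximable_limit:
  assumes f: "L2_tendsto (time_interval T) f g" and a: "\<And>n. approximable T (f n)"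
  shows "approximable T g"
  unfolding approximable_def
proof (intro conjI allI impI)
  show g: "square_integrable (time_interval T) g" using f by (simp add: L2_tendsto_def)
  fix e :: real assume "0 < e"
  then have "\<forall>\<^sub>F n in sequentially. (LINT x|time_interval T. (f n x - g x)\<^sup>2) < e / 4"
    using f by (intro order_tendstoD(2)[where y = 0]) (auto simp: L2_tendsto_def)
  then obtain n where n: "(LINT x|time_interval T. (f n x - g x)\<^sup>2) < e / 4"
    by (auto simp: eventually_sequentially)
  obtain \<delta> k k' where k: "regular_input T \<delta> k k'" "(LINT t|time_interval T. (k t - f n t)\<^sup>2) < e / 4"
    using a[of n] \<open>0 < e\<close> unfolding approximable_def by (meson divide_pos_pos zero_less_numeral)
  have "(LINT t|time_interval T. (k t - g t)\<^sup>2) < e"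
    using integral_square_triangle[of "time_interval T" k "f n" g] n k
      time_interval_square_integrable[OF regular_input_cont[OF k(1)]] f g
    by (auto simp: L2_tendsto_def)
  with k(1) show "\<exists>\<delta> g' g''. regular_input T \<delta> g' g'' \<and> (LINT t|time_interval T. (g' t - g t)\<^sup>2) < e"
    by blast
qed

lemma approximable_C1:
  assumes d: "\<And>t. (p has_real_derivative p' t) (at t)" and c: "continuous_on UNIV p'" and T: "0 < T"
  shows "approximable T p"
proof -
  define \<delta> :: "nat \<Rightarrow> real" where "\<delta> n = 1 / (n + 1)" for n
  have \<delta>: "0 < \<delta> n" for n by (simp add: \<delta>_def)
  have \<delta>0: "\<delta> \<longlonglongrightarrow> 0"
    unfolding \<delta>_def by (rule tendsto_inverse_Suc)
  \<comment> \<open>Vanishes up to distance 2 \<delta> from the ends of (0, 2T), as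
    \<open>regular_input\<close> demands, and equals 1 from distance 3 \<delta> on.\<close>
  define \<zeta> where "\<zeta> n t = step ((t - 2 * \<delta> n) / \<delta> n) * step ((2 * T - 2 * \<delta> n - t) / \<delta> n)" for n t
  define \<zeta>' where "\<zeta>' n t = step' ((t - 2 * \<delta> n) / \<delta> n) / \<delta> n * step ((2 * T - 2 * \<delta> n - t) / \<delta> n)
      - step ((t - 2 * \<delta> n) / \<delta> n) * step' ((2 * T - 2 * \<delta> n - t) / \<delta> n) / \<delta> n" for n t
  have pc: "continuous_on UNIV p"
    using d by (meson DERIV_isCont continuous_at_imp_continuous_on)
  have \<zeta>d: "(\<zeta> n has_real_derivative \<zeta>' n t) (at t)" for n t
  proof -
    have 1: "((\<lambda>t. (t - 2 * \<delta> n) / \<delta> n) has_real_derivative 1 / \<delta> n) (at t)"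
      using \<delta>[of n] by (auto intro!: derivative_eq_intros)
    have 2: "((\<lambda>t. (2 * T - 2 * \<delta> n - t) / \<delta> n) has_real_derivative - 1 / \<delta> n) (at t)"
      using \<delta>[of n] by (auto intro!: derivative_eq_intros)
    show ?thesis
      unfolding \<zeta>_def[abs_def]
      by (rule DERIV_cong[OF DERIV_mult[OF DERIV_chain2[OF step_deriv 1] DERIV_chain2[OF step_deriv 2]]])
        (simp add: \<zeta>'_def algebra_simps)
  qed
  have out: "\<zeta> n t = 0 \<and> \<zeta>' n t = 0" if "t \<le> 2 * \<delta> n \<or> 2 * T - 2 * \<delta> n \<le> t" for n t
  proof -
    have "(t - 2 * \<delta> n) / \<delta> n \<le> 0 \<or> (2 * T - 2 * \<delta> n - t) / \<delta> n \<le> 0"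
      using that
    proof
      assume "t \<le> 2 * \<delta> n"
      then show ?thesis using \<delta>[of n] by (intro disjI1 divide_nonpos_pos) simp_all
    next
      assume "2 * T - 2 * \<delta> n \<le> t"
      then show ?thesis using \<delta>[of n] by (intro disjI2 divide_nonpos_pos) simp_all
    qed
    then show ?thesis by (auto simp: \<zeta>_def \<zeta>'_def step_0 step'_0)
  qed
  have reg: "regular_input T (\<delta> n) (\<lambda>t. \<zeta> n t * p t) (\<lambda>t. \<zeta>' n t * p t + p' t * \<zeta> n t)" for n
    unfolding regular_input_def
  proof (intro conjI allI impI)
    show "((\<lambda>t. \<zeta> n t * p t) has_real_derivative \<zeta>' n t * p t + p' t * \<zeta> n t) (at t)" for t
      by (rule DERIV_mult[OF \<zeta>d d])
    show "continuous_on UNIV (\<lambda>t. \<zeta>' n t * p t + p' t * \<zeta> n t)"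
      using less_imp_neq[OF \<delta>[of n]] unfolding \<zeta>'_def \<zeta>_def
      by (intro continuous_intros step_cont_on step'_cont_on pc c) auto
  qed (use out \<delta> in auto)
  have \<zeta>r: "0 \<le> \<zeta> n t" "\<zeta> n t \<le> 1" for n t
    using step_range by (auto simp: \<zeta>_def intro!: mult_le_one)
  have si: "square_integrable (time_interval T) (\<lambda>t. \<zeta> n t * p t)" for n
    using time_interval_square_integrable[OF regular_input_cont[OF reg]] .
  have "L2_tendsto (time_interval T) (\<lambda>n t. \<zeta> n t * p t) p"
  proof (rule L2_dominated_convergence[OF si time_interval_square_integrable[OF pc]])
    show "AE t in time_interval T. (\<lambda>n. \<zeta> n t * p t) \<longlonglongrightarrow> p t"
    proof (rule AE_I2)
      fix t assume "t \<in> space (time_interval T)"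
      then have t: "0 < t" "t < 2 * T" by auto
      have "\<forall>\<^sub>F n in sequentially. \<delta> n < min (t / 3) ((2 * T - t) / 3)"
        using t \<delta>0 by (intro order_tendstoD(2)[where y = 0]) auto
      then have "\<forall>\<^sub>F n in sequentially. \<zeta> n t * p t = p t"
      proof eventually_elim
        case (elim n)
        then have "step ((t - 2 * \<delta> n) / \<delta> n) = 1" "step ((2 * T - 2 * \<delta> n - t) / \<delta> n) = 1"
          using \<delta>[of n] by (auto intro!: step_1 simp: pos_le_divide_eq)
        then show ?case by (simp add: \<zeta>_def)
      qed
      then show "(\<lambda>n. \<zeta> n t * p t) \<longlonglongrightarrow> p t" by (rule tendsto_eventually)
    qed
    show "integrable (time_interval T) (\<lambda>t. (p t)\<^sup>2)"
      by (intro time_interval_integrable continuous_intros pc)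
    have "(\<zeta> n t * p t - p t)\<^sup>2 \<le> (p t)\<^sup>2" for n t
    proof -
      have "(\<zeta> n t * p t - p t)\<^sup>2 = (1 - \<zeta> n t)\<^sup>2 * (p t)\<^sup>2"
        by (simp add: power2_eq_square algebra_simps)
      also have "\<dots> \<le> 1 * (p t)\<^sup>2"
        using \<zeta>r[of n t] by (intro mult_right_mono power_le_one) auto
      finally show ?thesis by simp
    qed
    then show "AE t in time_interval T. (\<zeta> n t * p t - p t)\<^sup>2 \<le> (p t)\<^sup>2" for n by simp
  qed
  moreover have "approximable T (\<lambda>t. \<zeta> n t * p t)" for n
    unfolding approximable_def using si reg by (intro conjI allI impI exI[of _ "\<delta> n"] exI) auto
  ultimately show ?thesis by (rule approximable_limit)
qed

lemma approximable_continuous: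
  assumes g: "continuous_on UNIV g" and T: "0 < T"
  shows "approximable T g"
proof -
  have "\<exists>p. polynomial_function p \<and> (\<forall>t\<in>{0..2 * T}. \<bar>g t - p t\<bar> < 1 / (real n + 1))" for n
  proof -
    have "continuous_on {0..2 * T} g" using continuous_on_subset[OF g] by blast
    from Stone_Weierstrass_polynomial_function[OF compact_Icc this, of "1 / (real n + 1)"]
    show ?thesis by simp
  qed
  then obtain p where p: "\<And>n. polynomial_function (p n :: real \<Rightarrow> real)"
    "\<And>n t. t \<in> {0..2 * T} \<Longrightarrow> \<bar>g t - p n t\<bar> < 1 / (real n + 1)" by metis
  have pc: "continuous_on UNIV (p n)" for n
    by (rule continuous_on_polymonial_function[OF p(1)])
  have le: "\<bar>g t - p n t\<bar> \<le> 1 / (real n + 1)" if "0 < t" "t < 2 * T" for n t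
    using p(2)[of t n] that by auto
  have "approximable T (p n)" for n
  proof -
    obtain p' where "polynomial_function p'" "\<And>t. (p n has_vector_derivative p' t) (at t)"
      using has_vector_derivative_polynomial_function[OF p(1)[of n]] by blast
    then show ?thesis
      using T by (intro approximable_C1[where p' = p'])
        (auto simp: has_real_derivative_iff_has_vector_derivative continuous_on_polymonial_function)
  qed
  moreover have "L2_tendsto (time_interval T) p g"
  proof (rule L2_dominated_convergence[OF time_interval_square_integrable[OF pc] time_interval_square_integrable[OF g],
        where w = "\<lambda>t. 1"])
    show "AE t in time_interval T. (\<lambda>n. p n t) \<longlonglongrightarrow> g t"
    proof (rule AE_I2)
      fix t assume "t \<in> space (time_interval T)"
      then have "norm (p n t - g t) \<le> 1 / (real n + 1)" for n
        using le[of t n] by (simp add: abs_minus_commute)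
      then have "(\<lambda>n. p n t - g t) \<longlonglongrightarrow> 0"
        by (intro tendsto_zero_bound[OF _ tendsto_inverse_Suc]) simp
      then show "(\<lambda>n. p n t) \<longlonglongrightarrow> g t" by (rule LIM_zero_cancel)
    qed
    show "integrable (time_interval T) (\<lambda>t. 1::real)"
      by (intro time_interval_integrable continuous_intros)
    show "AE t in time_interval T. (p n t - g t)\<^sup>2 \<le> 1" for n
    proof (rule AE_I2)
      fix t assume "t \<in> space (time_interval T)"
      then have "\<bar>p n t - g t\<bar> \<le> 1 / (real n + 1)"
        using le[of t n] by (simp add: abs_minus_commute)
      also have "\<dots> \<le> 1" by simp
      finally show "(p n t - g t)\<^sup>2 \<le> 1" by (simp add: abs_square_le_1)
    qed
  qed
  ultimately show ?thesis by (rule approximable_limit[rotated])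
qed

text \<open>A measurable function is an almost everywhere limit of continuous functions, but these
  need not be dominated; clamping both sides to [-K, K] gives a constant bound. The level K is
  released afterwards, with the square of \<open>f\<close> as dominating function.\<close>

lemma approximable_square_integrable:
  assumes f: "square_integrable (time_interval T) f" and T: "0 < T"
  shows "approximable T f"
proof -
  interpret finite_measure "time_interval T" by (rule finite_measure_time_interval)
  have fm [measurable]: "f \<in> borel_measurable (time_interval T)"
    using f by (simp add: square_integrable_def)
  define S where "S = {0<..<2 * T}"
  define h where "h t = indicator S t *\<^sub>R f t" for t
  have h: "h \<in> borel_measurable lborel"
    using fm unfolding h_def time_interval_def S_def
    by (subst (asm) borel_measurable_restrict_space_iff) auto
  then have "h \<in> borel_measurable lebesgue" by (rule measurable_completion)
  then have "h measurable_on UNIV"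
    by (simp add: measurable_on_iff_borel_measurable lebesgue_on_UNIV_eq)
  then obtain N g where N: "negligible N" and g: "\<And>n. continuous_on UNIV (g n)"
    and lim: "\<And>x. x \<notin> N \<Longrightarrow> (\<lambda>n. g n x) \<longlonglongrightarrow> h x"
    by (auto simp: measurable_on_def)
  have "AE x in lebesgue. x \<notin> N"
    using N by (intro AE_not_in) (simp add: negligible_iff_null_sets)
  then have "AE x in lborel. x \<notin> N" by (simp add: AE_completion_iff)
  then have "AE x in lborel. x \<in> S \<longrightarrow> (\<lambda>n. g n x) \<longlonglongrightarrow> f x"
    by eventually_elim (use lim in \<open>force simp: h_def\<close>)
  then have ae: "AE x in time_interval T. (\<lambda>n. g n x) \<longlonglongrightarrow> f x"
    unfolding time_interval_def S_def by (subst AE_restrict_space_iff) auto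
  define cl where "cl K v = max (- K) (min K v)" for K v :: real
  have cl: "\<bar>cl K v\<bar> \<le> K" if "0 \<le> K" for K v
    using that by (auto simp: cl_def)
  have clm [measurable]: "(\<lambda>t. cl K (f t)) \<in> borel_measurable (time_interval T)" for K
    unfolding cl_def by measurable
  have si: "square_integrable (time_interval T) (\<lambda>t. cl K (f t))" if "0 \<le> K" for K
    unfolding square_integrable_def
  proof (intro conjI clm)
    have "(cl K (f t))\<^sup>2 \<le> K\<^sup>2" for t
      using cl[OF that, of "f t"] by (metis abs_ge_zero power2_abs power_mono)
    then show "integrable (time_interval T) (\<lambda>t. (cl K (f t))\<^sup>2)"
      by (intro integrable_const_bound[where B = "K\<^sup>2"]) (auto simp del: power_mono_iff)
  qed
  have b: "approximable T (\<lambda>t. cl K (f t))" if K: "0 \<le> K" for K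
  proof (rule approximable_limit[where f = "\<lambda>n t. cl K (g n t)"])
    have c: "continuous_on UNIV (\<lambda>t. cl K (g n t))" for n
      unfolding cl_def by (intro continuous_intros g)
    show "approximable T (\<lambda>t. cl K (g n t))" for n
      by (rule approximable_continuous[OF c T])
    show "L2_tendsto (time_interval T) (\<lambda>n t. cl K (g n t)) (\<lambda>t. cl K (f t))"
    proof (rule L2_dominated_convergence[OF time_interval_square_integrable[OF c] si[OF K]])
      show "AE t in time_interval T. (\<lambda>n. cl K (g n t)) \<longlonglongrightarrow> cl K (f t)"
        using ae by eventually_elim (auto simp: cl_def intro!: tendsto_intros)
      show "integrable (time_interval T) (\<lambda>t. (2 * K)\<^sup>2)" by simp
      have "(cl K v - cl K w)\<^sup>2 \<le> (2 * K)\<^sup>2" for v w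
        using cl[OF K, of v] cl[OF K, of w] by (intro power2_le_iff_abs_le[THEN iffD2]) (auto simp: K)
      then show "AE t in time_interval T. (cl K (g n t) - cl K (f t))\<^sup>2 \<le> (2 * K)\<^sup>2" for n
        by simp
    qed
  qed
  show ?thesis
  proof (rule approximable_limit[where f = "\<lambda>n t. cl (real n) (f t)"])
    show "approximable T (\<lambda>t. cl (real n) (f t))" for n by (rule b) simp
    show "L2_tendsto (time_interval T) (\<lambda>n t. cl (real n) (f t)) f"
    proof (rule L2_dominated_convergence[OF si f])
      show "AE t in time_interval T. (\<lambda>n. cl (real n) (f t)) \<longlonglongrightarrow> f t"
      proof (rule AE_I2)
        fix t
        have "\<forall>\<^sub>F n in sequentially. \<bar>f t\<bar> \<le> real n"
          by (rule eventually_sequentiallyI[of "nat \<lceil>\<bar>f t\<bar>\<rceil>"]) linarith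
        then have "\<forall>\<^sub>F n in sequentially. cl (real n) (f t) = f t"
          by eventually_elim (auto simp: cl_def)
        then show "(\<lambda>n. cl (real n) (f t)) \<longlonglongrightarrow> f t" by (rule tendsto_eventually)
      qed
      show "integrable (time_interval T) (\<lambda>t. (f t)\<^sup>2)" using f by (simp add: square_integrable_def)
      have "(cl (real n) v - v)\<^sup>2 \<le> v\<^sup>2" for n v
        by (intro power2_le_iff_abs_le[THEN iffD2, of "\<bar>v\<bar>", simplified]) (auto simp: cl_def)
      then show "AE t in time_interval T. (cl (real n) (f t) - f t)\<^sup>2 \<le> (f t)\<^sup>2" for n by simp
    qed simp
  qed
qed

lemma regular_inputs_dense:
  assumes f: "square_integrable (time_interval T) f" and T: "0 < T"
  obtains \<delta> g g' where "\<And>n. regular_input T (\<delta> n) (g n) (g' n)" "L2_tendsto (time_interval T) g f"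
proof -
  have "\<exists>\<delta> g g'. regular_input T \<delta> g g' \<and> (LINT t|time_interval T. (g t - f t)\<^sup>2) < 1 / (real n + 1)" for n
    using approximable_square_integrable[OF f T] unfolding approximable_def by simp
  then obtain \<delta> g g' where g: "\<And>n. regular_input T (\<delta> n) (g n) (g' n)"
    "\<And>n. (LINT t|time_interval T. (g n t - f t)\<^sup>2) < 1 / (real n + 1)" by metis
  have "(\<lambda>n. LINT t|time_interval T. (g n t - f t)\<^sup>2) \<longlonglongrightarrow> 0"
    by (rule tendsto_zero_bound[OF _ tendsto_inverse_Suc]) (use g(2) in \<open>simp add: less_imp_le\<close>)
  then show ?thesis
    using f time_interval_square_integrable[OF regular_input_cont[OF g(1)]]
    by (intro that[OF g(1)]) (auto simp: L2_tendsto_def)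
qed

section \<open>Sobolev functions on the strip as limits of test functions\<close>

lemma
  assumes "\<phi> \<in> C1_test V"
  shows C1_test_strip: "square_integrable (strip T) \<phi>" "square_integrable (strip T) (part_t \<phi>)"
      "square_integrable (strip T) (part_x \<phi>)"
    and C1_test_time: "square_integrable (time_interval T) (\<lambda>t. \<phi> (t, 0))"
    and C1_test_halfline: "square_integrable halfline (\<lambda>x. \<phi> (0, x))"
proof -
  obtain R where R: "0 < R" "continuous_on UNIV \<phi>" "continuous_on UNIV (part_t \<phi>)" "continuous_on UNIV (part_x \<phi>)"
    "\<And>t x. R \<le> x \<Longrightarrow> \<phi> (t, x) = 0" "\<And>t x. R \<le> x \<Longrightarrow> part_t \<phi> (t, x) = 0"
    "\<And>t x. R \<le> x \<Longrightarrow> part_x \<phi> (t, x) = 0"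
    using C1_testD[OF assms] by metis
  show "square_integrable (strip T) \<phi>" "square_integrable (strip T) (part_t \<phi>)"
    "square_integrable (strip T) (part_x \<phi>)"
    using strip_square_integrable[of "\<lambda>t x. \<phi> (t, x)" T R] strip_square_integrable[of "\<lambda>t x. part_t \<phi> (t, x)" T R]
      strip_square_integrable[of "\<lambda>t x. part_x \<phi> (t, x)" T R] R by simp_all
  have c: "continuous_on UNIV (\<lambda>t. \<phi> (t, 0))" "continuous_on UNIV (\<lambda>x. \<phi> (0, x))"
    by (rule continuous_on_compose2[OF R(2)], auto intro!: continuous_intros)+
  show "square_integrable (time_interval T) (\<lambda>t. \<phi> (t, 0))"
    by (rule time_interval_square_integrable[OF c(1)])
  show "square_integrable halfline (\<lambda>x. \<phi> (0, x))"
    using R by (intro halfline_square_integrable[OF c(2), of R]) auto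
qed

text \<open>Classical integration by parts for the approximants passes to the limit, since both
  sides are L2 pairings with a fixed test function.\<close>

lemma H1_stripI:
  assumes v: "\<And>n. v n \<in> C1_test UNIV" and T: "0 \<le> T"
    and u: "L2_tendsto (strip T) v u" and ut: "L2_tendsto (strip T) (\<lambda>n. part_t (v n)) ut"
    and ux: "L2_tendsto (strip T) (\<lambda>n. part_x (v n)) ux"
  shows "H1_strip T u ut ux"
  unfolding H1_strip_def
proof (intro conjI ballI)
  fix \<phi> assume \<phi>: "\<phi> \<in> C1_test ({0<..<2 * T} \<times> {0<..})"
  obtain R where R: "0 < R" "\<And>t x. ((\<lambda>s. \<phi> (s, x)) has_real_derivative part_t \<phi> (t, x)) (at t)"
    "\<And>t x. ((\<lambda>y. \<phi> (t, y)) has_real_derivative part_x \<phi> (t, x)) (at x)"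
    "continuous_on UNIV \<phi>" "continuous_on UNIV (part_t \<phi>)" "continuous_on UNIV (part_x \<phi>)"
    "\<And>z. z \<notin> {0<..<2 * T} \<times> {0<..} \<Longrightarrow> \<phi> z = 0"
    "\<And>t x. R \<le> x \<Longrightarrow> \<phi> (t, x) = 0" "\<And>t x. R \<le> x \<Longrightarrow> part_t \<phi> (t, x) = 0"
    "\<And>t x. R \<le> x \<Longrightarrow> part_x \<phi> (t, x) = 0"
    using C1_testD[OF \<phi>] by metis
  have parts: "(LINT z|strip T. v n z * part_t \<phi> z) = - (LINT z|strip T. part_t (v n) z * \<phi> z)"
    "(LINT z|strip T. v n z * part_x \<phi> z) = - (LINT z|strip T. part_x (v n) z * \<phi> z)" for n
  proof -
    obtain Q where Q: "\<And>t x. ((\<lambda>s. v n (s, x)) has_real_derivative part_t (v n) (t, x)) (at t)"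
      "\<And>t x. ((\<lambda>y. v n (t, y)) has_real_derivative part_x (v n) (t, x)) (at x)"
      "continuous_on UNIV (v n)" "continuous_on UNIV (part_t (v n))" "continuous_on UNIV (part_x (v n))"
      using C1_testD[OF v] by metis
    have i: "integrable (strip T) (\<lambda>z. part_t (v n) z * \<phi> z)" "integrable (strip T) (\<lambda>z. v n z * part_t \<phi> z)"
      "integrable (strip T) (\<lambda>z. part_x (v n) z * \<phi> z)" "integrable (strip T) (\<lambda>z. v n z * part_x \<phi> z)"
      by (intro square_integrable_mult C1_test_strip[OF \<phi>] C1_test_strip[OF v])+
    have "(LINT z|strip T. part_t (v n) (fst z, snd z) * \<phi> (fst z, snd z) + part_t \<phi> (fst z, snd z) * v n (fst z, snd z))
        = integral {0..R} (\<lambda>x. v n (2 * T, x) * \<phi> (2 * T, x) - v n (0, x) * \<phi> (0, x))"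
      by (rule strip_integral_deriv_t[OF _ DERIV_mult[OF Q(1) R(2)] T])
         (use Q R in \<open>auto intro!: continuous_intros\<close>)
    also have "\<dots> = 0" using R(7) by simp
    finally have "(LINT z|strip T. part_t (v n) z * \<phi> z + part_t \<phi> z * v n z) = 0" by simp
    then show "(LINT z|strip T. v n z * part_t \<phi> z) = - (LINT z|strip T. part_t (v n) z * \<phi> z)"
      using i by (simp add: mult.commute)
    have "(LINT z|strip T. part_x (v n) (fst z, snd z) * \<phi> (fst z, snd z) + part_x \<phi> (fst z, snd z) * v n (fst z, snd z))
        = - integral {0..2 * T} (\<lambda>t. v n (t, 0) * \<phi> (t, 0))"
      by (rule strip_integral_deriv_x[OF _ DERIV_mult[OF Q(2) R(3)] less_imp_le[OF R(1)]])
         (use Q R in \<open>auto intro!: continuous_intros\<close>)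
    also have "\<dots> = 0" using R(7) by simp
    finally have "(LINT z|strip T. part_x (v n) z * \<phi> z + part_x \<phi> z * v n z) = 0" by simp
    then show "(LINT z|strip T. v n z * part_x \<phi> z) = - (LINT z|strip T. part_x (v n) z * \<phi> z)"
      using i by (simp add: mult.commute)
  qed
  note s = C1_test_strip[OF \<phi>, of T]
  show "(LINT z|strip T. u z * part_t \<phi> z) = - (LINT z|strip T. ut z * \<phi> z)"
    using LIMSEQ_unique[OF L2_tendsto_integral[OF u s(2)]
      tendsto_minus[OF L2_tendsto_integral[OF ut s(1)], folded parts(1)]] .
  show "(LINT z|strip T. u z * part_x \<phi> z) = - (LINT z|strip T. ux z * \<phi> z)"
    using LIMSEQ_unique[OF L2_tendsto_integral[OF u s(3)]
      tendsto_minus[OF L2_tendsto_integral[OF ux s(1)], folded parts(2)]] .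
qed (use assms in \<open>auto simp: L2_tendsto_def\<close>)

lemma has_traceI:
  assumes v: "\<And>n. v n \<in> C1_test UNIV" and T: "0 \<le> T"
    and u: "L2_tendsto (strip T) v u" and ut: "L2_tendsto (strip T) (\<lambda>n. part_t (v n)) ut"
    and ux: "L2_tendsto (strip T) (\<lambda>n. part_x (v n)) ux"
    and g: "L2_tendsto E (\<lambda>n s. v n (e s)) g"
  shows "has_trace T u ut ux E e g"
  unfolding has_trace_def
proof (intro conjI exI[of _ v] allI v H1_stripI[OF v T u ut ux])
  have i: "integrable (strip T) (\<lambda>z. (w n z - k z)\<^sup>2)" if "L2_tendsto (strip T) w k" for w k n
    using that square_integrable_diff[of "strip T" "w n" k] by (simp add: L2_tendsto_def square_integrable_def)
  have "(\<lambda>n. (LINT z|strip T. (v n z - u z)\<^sup>2) + (LINT z|strip T. (part_t (v n) z - ut z)\<^sup>2)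
      + (LINT z|strip T. (part_x (v n) z - ux z)\<^sup>2)) \<longlonglongrightarrow> 0 + 0 + 0"
    using u ut ux by (intro tendsto_add) (auto simp: L2_tendsto_def)
  then show "(\<lambda>n. LINT z|strip T. (v n z - u z)\<^sup>2 + (part_t (v n) z - ut z)\<^sup>2 + (part_x (v n) z - ux z)\<^sup>2) \<longlonglongrightarrow> 0"
    using i[OF u] i[OF ut] i[OF ux] by simp
qed (use g in \<open>auto simp: L2_tendsto_def\<close>)

lemma has_traceE:
  assumes "has_trace T u ut ux E e g" and E: "\<And>\<phi>. \<phi> \<in> C1_test UNIV \<Longrightarrow> square_integrable E (\<lambda>s. \<phi> (e s))"
  obtains v where "\<And>n. v n \<in> C1_test UNIV" "L2_tendsto (strip T) v u" "L2_tendsto (strip T) (\<lambda>n. part_t (v n)) ut"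
    "L2_tendsto (strip T) (\<lambda>n. part_x (v n)) ux" "L2_tendsto E (\<lambda>n s. v n (e s)) g"
proof -
  obtain v where v: "\<And>n. v n \<in> C1_test UNIV"
    and lim: "(\<lambda>n. LINT z|strip T. (v n z - u z)\<^sup>2 + (part_t (v n) z - ut z)\<^sup>2 + (part_x (v n) z - ux z)\<^sup>2) \<longlonglongrightarrow> 0"
    and g: "(\<lambda>n. LINT s|E. (v n (e s) - g s)\<^sup>2) \<longlonglongrightarrow> 0"
    and sg: "square_integrable E g"
    and si: "square_integrable (strip T) u" "square_integrable (strip T) ut" "square_integrable (strip T) ux"
    using assms(1) unfolding has_trace_def H1_strip_def by blast
  note sv = C1_test_strip[OF v, of T]
  have i: "integrable (strip T) (\<lambda>z. (v n z - u z)\<^sup>2)" "integrable (strip T) (\<lambda>z. (part_t (v n) z - ut z)\<^sup>2)"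
    "integrable (strip T) (\<lambda>z. (part_x (v n) z - ux z)\<^sup>2)" for n
    using square_integrable_diff[OF sv(1) si(1)] square_integrable_diff[OF sv(2) si(2)]
      square_integrable_diff[OF sv(3) si(3)] by (simp_all add: square_integrable_def)
  let ?s = "\<lambda>n. LINT z|strip T. (v n z - u z)\<^sup>2 + (part_t (v n) z - ut z)\<^sup>2 + (part_x (v n) z - ux z)\<^sup>2"
  have "\<bar>LINT z|strip T. (v n z - u z)\<^sup>2\<bar> \<le> ?s n" "\<bar>LINT z|strip T. (part_t (v n) z - ut z)\<^sup>2\<bar> \<le> ?s n"
    "\<bar>LINT z|strip T. (part_x (v n) z - ux z)\<^sup>2\<bar> \<le> ?s n" for n
    using i[of n] by simp_all
  from this[THEN tendsto_zero_bound[OF _ lim]] show ?thesis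
    using v sv si sg g E by (intro that[of v]) (auto simp: L2_tendsto_def)
qed

lemma C1_test_time_reflect:
  fixes S :: real
  assumes "w \<in> C1_test ({0<..} \<times> UNIV)"
  defines "\<phi> \<equiv> (\<lambda>(t, x). w (S - t, x))"
  shows "\<phi> \<in> C1_test ({..<S} \<times> UNIV)"
    and "part_t \<phi> = (\<lambda>(t, x). - part_t w (S - t, x))" and "part_x \<phi> = (\<lambda>(t, x). part_x w (S - t, x))"
proof -
  obtain K where K: "compact K" "K \<subseteq> {0<..} \<times> UNIV" "\<And>z. z \<notin> K \<Longrightarrow> w z = 0"
    using assms(1) unfolding C1_test_def by blast
  have wd: "\<And>t x. ((\<lambda>s. w (s, x)) has_real_derivative part_t w (t, x)) (at t)"
    "\<And>t x. ((\<lambda>y. w (t, y)) has_real_derivative part_x w (t, x)) (at x)"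
    and wc: "continuous_on UNIV (part_t w)" "continuous_on UNIV (part_x w)"
    using C1_testD[OF assms(1)] by metis+
  have "((\<lambda>t. S - t) has_real_derivative - 1) (at t)" for t
    by (auto intro!: derivative_eq_intros)
  from DERIV_chain2[OF wd(1) this]
  have d: "((\<lambda>t. w (S - t, x)) has_real_derivative - part_t w (S - t, x)) (at t)" for t x
    by simp
  have c: "cont2 (\<lambda>t x. - part_t w (S - t, x))" "cont2 (\<lambda>t x. part_x w (S - t, x))"
    by (intro continuous_intros continuous_on_compose2[OF wc(1)] continuous_on_compose2[OF wc(2)]; simp)+
  define J where "J = (\<lambda>z. (S - fst z, snd z)) ` K"
  have J: "compact J" "J \<subseteq> {..<S} \<times> UNIV"
    unfolding J_def using K by (auto intro!: compact_continuous_image continuous_intros)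
  have "w (S - t, x) = 0" if "(t, x) \<notin> J" for t x
  proof (rule K(3), rule notI)
    assume "(S - t, x) \<in> K"
    then have "(t, x) \<in> J" unfolding J_def by (rule rev_image_eqI) simp
    with that show False by simp
  qed
  note C = C1_testI[of "\<lambda>t x. w (S - t, x)", OF d wd(2) c J this]
  show "\<phi> \<in> C1_test ({..<S} \<times> UNIV)" "part_t \<phi> = (\<lambda>(t, x). - part_t w (S - t, x))"
    "part_x \<phi> = (\<lambda>(t, x). part_x w (S - t, x))"
    unfolding \<phi>_def using C by auto
qed

section \<open>Regular solutions are weak solutions\<close>

context speed
begin

lemma \<theta>_nonpos: "x \<le> 0 \<Longrightarrow> \<theta> x = x"
proof -
  assume "x \<le> 0"
  then have "\<theta> x = prim (\<lambda>x. 1) x"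
    unfolding \<theta>_def by (intro prim_cong) (auto simp: c_one closed_segment_eq_real_ivl split: if_splits)
  then show ?thesis by simp
qed

lemma \<theta>_nonneg: "0 \<le> x \<Longrightarrow> 0 \<le> \<theta> x"
  using \<theta>_less[of 0 x] by (cases "x = 0") auto

lemma \<theta>_le: "x \<le> z \<Longrightarrow> \<theta> x \<le> \<theta> z"
  using \<theta>_less[of x z] by (cases "x = z") auto

lemma regular_inputD:
  assumes "regular_input T \<delta> f f'"
  shows "causal f" "causal f'" "\<And>t. (f has_real_derivative f' t) (at t)" "0 < \<delta>"
    "\<And>t. t \<le> 2 * \<delta> \<Longrightarrow> f t = 0" "\<And>t. t \<le> 2 * \<delta> \<Longrightarrow> f' t = 0"
  using assms regular_input_cont[OF assms] unfolding causal_def regular_input_def by auto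

text \<open>Test functions live on the whole plane, whereas \<open>u f\<close> matters only for x
  \<ge> 0 and t \<le> 2T. Ahead of its front the solution vanishes by itself, so one cutoff on the
  negative x axis and one above t = 2T give compact support and leave the closed strip
  untouched.\<close>

lemma approximant:
  assumes f: "regular_input T \<delta> f f'"
  obtains w where "w \<in> C1_test ({0<..} \<times> UNIV)"
    "\<And>t x. 0 \<le> x \<Longrightarrow> t \<le> 2 * T \<Longrightarrow> w (t, x) = u f t x"
    "\<And>t x. 0 \<le> x \<Longrightarrow> t \<le> 2 * T \<Longrightarrow> part_t w (t, x) = ut f t x"
    "\<And>t x. 0 \<le> x \<Longrightarrow> t \<le> 2 * T \<Longrightarrow> part_x w (t, x) = ux f t x"
proof -
  note F = regular_inputD[OF f]
  define p where "p x = step ((x + \<delta>) / \<delta>)" for x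
  define p' where "p' x = step' ((x + \<delta>) / \<delta>) / \<delta>" for x
  define q where "q t = step (2 * T + 1 - t)" for t
  define q' where "q' t = - step' (2 * T + 1 - t)" for t
  have pd: "(p has_real_derivative p' x) (at x)" for x
  proof -
    have "((\<lambda>x. (x + \<delta>) / \<delta>) has_real_derivative 1 / \<delta>) (at x)"
      using F(4) by (auto intro!: derivative_eq_intros)
    from DERIV_chain2[OF step_deriv this] show ?thesis
      unfolding p_def[abs_def] p'_def by simp
  qed
  have qd: "(q has_real_derivative q' t) (at t)" for t
  proof -
    have "((\<lambda>t. 2 * T + 1 - t) has_real_derivative - 1) (at t)"
      by (auto intro!: derivative_eq_intros)
    from DERIV_chain2[OF step_deriv this] show ?thesis
      unfolding q_def[abs_def] q'_def by simp
  qed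
  define w where "w t x = p x * q t * u f t x" for t x
  define wt where "wt t x = p x * (q' t * u f t x + ut f t x * q t)" for t x
  define wx where "wx t x = q t * (p' x * u f t x + ux f t x * p x)" for t x
  \<comment> \<open>\<open>X (2 * T + 1)\<close> is the depth of the front when the time cutoff
    ends. The lower corner stays clear of t = 0 because \<theta> x \<ge> - \<delta> and the data
    vanish up to 2 \<delta>.\<close>
  define K where "K = {\<delta>..2 * T + 1} \<times> {-\<delta>..X (2 * T + 1)}"
  have wd: "((\<lambda>t. w t x) has_real_derivative wt t x) (at t)" "(w t has_real_derivative wx t x) (at x)" for t x
  proof -
    show "((\<lambda>t. w t x) has_real_derivative wt t x) (at t)"
      using DERIV_cmult[OF DERIV_mult[OF qd u_deriv_t[OF F(1)]], of "p x"]
      by (simp add: w_def wt_def mult_ac)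
    show "(w t has_real_derivative wx t x) (at x)"
      using DERIV_cmult[OF DERIV_mult[OF pd u_deriv_x[OF F(1-3)]], of "q t"]
      by (simp add: w_def[abs_def] wx_def mult_ac)
  qed
  have c: "cont2 wt" "cont2 wx"
    unfolding wt_def wx_def p_def p'_def q_def q'_def using F(4)
    by (intro continuous_intros step_cont_on step'_cont_on cont2_compose[OF u_cont[OF F(1)]]
      cont2_compose[OF ut_cont[OF F(1)]] cont2_compose[OF ux_cont[OF F(1)]]; simp)+
  have K: "compact K" "K \<subseteq> {0<..} \<times> UNIV"
    using F(4) by (auto simp: K_def intro!: compact_Times)
  have z: "w t x = 0" if "(t, x) \<notin> K" for t x
  proof -
    consider "2 * T + 1 < t" | "x < - \<delta>" | "t < \<delta>" "- \<delta> \<le> x" | "X (2 * T + 1) < x" "t \<le> 2 * T + 1"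
      using \<open>(t, x) \<notin> K\<close> by (force simp: K_def)
    then show ?thesis
    proof cases
      case 1 then show ?thesis by (simp add: w_def q_def step_0)
    next
      case 2
      then have "(x + \<delta>) / \<delta> \<le> 0" using F(4) by (intro divide_nonpos_pos) auto
      then show ?thesis by (simp add: w_def p_def step_0)
    next
      case 3
      have "- \<delta> \<le> \<theta> x" using \<theta>_le[OF 3(2)] \<theta>_nonpos[of "- \<delta>"] F(4) by simp
      then have "u f t x = 0" using 3 F(4) by (intro u_zero[OF F(1), of "2 * \<delta>"] F(5)) auto
      then show ?thesis by (simp add: w_def)
    next
      case 4
      have "2 * T + 1 \<le> \<theta> x" using \<theta>_le[of "X (2 * T + 1)" x] 4 by simp
      then have "u f t x = 0" using 4 F(4) by (intro u_zero[OF F(1), of "2 * \<delta>"] F(5)) auto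
      then show ?thesis by (simp add: w_def)
    qed
  qed
  note t = C1_testI[OF wd c K z]
  have v: "p x = 1" "p' x = 0" if "0 \<le> x" for x
  proof -
    have "1 \<le> (x + \<delta>) / \<delta>" using that F(4) by simp
    then show "p x = 1" "p' x = 0" by (simp_all add: p_def p'_def step_1 step'_1)
  qed
  have v': "q t = 1" "q' t = 0" if "t \<le> 2 * T" for t
    using that by (simp_all add: q_def q'_def step_1 step'_1)
  show ?thesis
  proof (rule that[OF t(1)])
    fix t x :: real assume a: "0 \<le> x" "t \<le> 2 * T"
    show "(\<lambda>(t, x). w t x) (t, x) = u f t x" "part_t (\<lambda>(t, x). w t x) (t, x) = ut f t x"
      "part_x (\<lambda>(t, x). w t x) (t, x) = ux f t x"
      using v[OF a(1)] v'[OF a(2)] fun_cong[OF t(2), of "(t, x)"] fun_cong[OF t(3), of "(t, x)"]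
      by (simp_all add: wt_def wx_def) (simp add: w_def)
  qed
qed

lemma regular_weak:
  assumes f: "regular_input T \<delta> f f'" and T: "0 \<le> T" and \<phi>: "\<phi> \<in> C1_test ({..<2 * T} \<times> UNIV)"
  shows "(LINT z|strip T. ux f (fst z) (snd z) * part_x \<phi> z - ut f (fst z) (snd z) * part_t \<phi> z / (c (snd z))\<^sup>2)
        + (LINT t|time_interval T. f t * \<phi> (t, 0)) = 0"
proof -
  note F = regular_inputD[OF f]
  obtain R where R: "0 < R" "\<And>t x. ((\<lambda>s. \<phi> (s, x)) has_real_derivative part_t \<phi> (t, x)) (at t)"
    "\<And>t x. ((\<lambda>y. \<phi> (t, y)) has_real_derivative part_x \<phi> (t, x)) (at x)"
    "continuous_on UNIV \<phi>" "continuous_on UNIV (part_t \<phi>)" "continuous_on UNIV (part_x \<phi>)"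
    "\<And>z. z \<notin> {..<2 * T} \<times> UNIV \<Longrightarrow> \<phi> z = 0"
    "\<And>t x. R \<le> x \<Longrightarrow> \<phi> (t, x) = 0" "\<And>t x. R \<le> x \<Longrightarrow> part_t \<phi> (t, x) = 0"
    "\<And>t x. R \<le> x \<Longrightarrow> part_x \<phi> (t, x) = 0"
    using C1_testD[OF \<phi>] by metis
  have pc: "continuous_on S (\<lambda>x. \<phi> (k x, l x))" "continuous_on S (\<lambda>x. part_t \<phi> (k x, l x))"
    "continuous_on S (\<lambda>x. part_x \<phi> (k x, l x))" if "continuous_on S k" "continuous_on S l"
    for k l and S :: "'z::topological_space set"
    by (rule continuous_on_compose2[OF R(4)] continuous_on_compose2[OF R(5)] continuous_on_compose2[OF R(6)],
      auto intro!: continuous_intros that)+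
  define \<Psi>x where "\<Psi>x t x = ut f' t x / (c x)\<^sup>2 * \<phi> (t, x) + part_x \<phi> (t, x) * ux f t x" for t x
  define \<Psi>t where "\<Psi>t t x = (ut f' t x * \<phi> (t, x) + part_t \<phi> (t, x) * ut f t x) / (c x)\<^sup>2" for t x
  have cx: "cont2 \<Psi>x" and ct: "cont2 \<Psi>t"
    unfolding \<Psi>x_def \<Psi>t_def
    by (intro continuous_intros pc c_cont_on cont2_compose[OF ut_cont[OF F(1)]] cont2_compose[OF ut_cont[OF F(2)]]
      cont2_compose[OF ux_cont[OF F(1)]]; simp)+
  have zx: "\<Psi>x t x = 0" and zt: "\<Psi>t t x = 0" if "R \<le> x" for t x
    using that R(8-10) by (simp_all add: \<Psi>x_def \<Psi>t_def)
  have dx: "((\<lambda>x. ux f t x * \<phi> (t, x)) has_real_derivative \<Psi>x t x) (at x)" for t x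
    unfolding \<Psi>x_def by (rule DERIV_mult[OF ux_deriv_x[OF F(1-3)] R(3)])
  have dt: "((\<lambda>t. ut f t x * \<phi> (t, x) / (c x)\<^sup>2) has_real_derivative \<Psi>t t x) (at t)" for t x
    unfolding \<Psi>t_def by (rule DERIV_cdivide[OF DERIV_mult[OF ut_deriv_t[OF F(1-3)] R(2)]])
  have "(LINT z|strip T. \<Psi>x (fst z) (snd z)) = - integral {0..2 * T} (\<lambda>t. ux f t 0 * \<phi> (t, 0))"
    by (rule strip_integral_deriv_x[OF cx dx less_imp_le[OF R(1)] zx]) (simp_all add: R(8))
  then have Ix: "(LINT z|strip T. \<Psi>x (fst z) (snd z)) = - (LINT t|time_interval T. f t * \<phi> (t, 0))"
    by (subst time_interval_integral) (auto simp: ux_0 intro!: continuous_intros pc causal_cont_on[OF F(1)])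
  have "(LINT z|strip T. \<Psi>t (fst z) (snd z)) = integral {0..R} (\<lambda>x. ut f (2 * T) x * \<phi> (2 * T, x) / (c x)\<^sup>2
      - ut f 0 x * \<phi> (0, x) / (c x)\<^sup>2)"
    by (rule strip_integral_deriv_t[OF ct dt T zt])
  \<comment> \<open>The test function vanishes at t = 2T, the velocity \<open>ut f\<close> at t =
    0.\<close>
  also have "\<dots> = integral {0..R} (\<lambda>x. 0)"
  proof (rule Henstock_Kurzweil_Integration.integral_cong)
    fix x assume "x \<in> {0..R}"
    then have "ut f 0 x = 0"
      using \<theta>_nonneg[of x] F(4) by (intro ut_zero[OF F(1), of "2 * \<delta>"] F(5)) auto
    moreover have "\<phi> (2 * T, x) = 0" by (rule R(7)) simp
    ultimately show "ut f (2 * T) x * \<phi> (2 * T, x) / (c x)\<^sup>2 - ut f 0 x * \<phi> (0, x) / (c x)\<^sup>2 = 0" by simp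
  qed
  finally have It: "(LINT z|strip T. \<Psi>t (fst z) (snd z)) = 0" by simp
  have "(LINT z|strip T. ux f (fst z) (snd z) * part_x \<phi> z - ut f (fst z) (snd z) * part_t \<phi> z / (c (snd z))\<^sup>2)
      = (LINT z|strip T. \<Psi>x (fst z) (snd z) - \<Psi>t (fst z) (snd z))"
    by (rule Bochner_Integration.integral_cong) (auto simp: \<Psi>x_def \<Psi>t_def field_simps)
  also have "\<dots> = (LINT z|strip T. \<Psi>x (fst z) (snd z)) - (LINT z|strip T. \<Psi>t (fst z) (snd z))"
    using strip_integrable[OF cx zx] strip_integrable[OF ct zt] by simp
  finally show ?thesis using Ix It by simp
qed

text \<open>The weak equation is tested with the regular solution for data \<open>h\<close>, run
  backwards in time from rest at 2T. When the derivatives are moved off \<open>v\<close>, the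
  interior terms cancel because the reversed solution solves the same equation, and the boundary
  pairings remain. The right side does not contain \<open>v\<close>, so \<open>f\<close> determines
  all pairings of the trace \<open>g\<close>.\<close>

lemma duality:
  assumes h: "regular_input T \<delta> h h'" and T: "0 < T"
    and tr0: "has_trace T v vt vx halfline (\<lambda>x. (0, x)) (\<lambda>x. 0)"
    and trx: "has_trace T v vt vx (time_interval T) (\<lambda>t. (t, 0)) g"
    and weak: "\<And>\<phi>. \<phi> \<in> C1_test ({..<2 * T} \<times> UNIV) \<Longrightarrow>
        (LINT z|strip T. vx z * part_x \<phi> z - vt z * part_t \<phi> z / (c (snd z))\<^sup>2)
        + (LINT t|time_interval T. f t * \<phi> (t, 0)) = 0"
  shows "(LINT t|time_interval T. g t * h t) =
      (LINT t|time_interval T. f t * u (\<lambda>t. h (2 * T - t)) (2 * T - t) 0)"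
proof -
  define k where "k t = h (2 * T - t)" for t
  define k' where "k' t = - h' (2 * T - t)" for t
  have hc: "continuous_on UNIV h" "continuous_on UNIV h'"
    using regular_input_cont[OF h] h by (auto simp: regular_input_def)
  have k: "regular_input T \<delta> k k'"
  proof -
    have "((\<lambda>t. 2 * T - t) has_real_derivative - 1) (at t)" for t
      by (auto intro!: derivative_eq_intros)
    then have "(k has_real_derivative k' t) (at t)" for t
      unfolding k_def[abs_def] k'_def using h DERIV_chain2[of h "h' (2 * T - t)" "\<lambda>t. 2 * T - t" t "- 1" UNIV]
      by (simp add: regular_input_def)
    moreover have "continuous_on UNIV k'"
      unfolding k'_def by (intro continuous_intros cont2_compose1[OF hc(2)])
    moreover have "k t = 0 \<and> k' t = 0" if "t \<le> 2 * \<delta> \<or> 2 * T - 2 * \<delta> \<le> t" for t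
      using h that by (auto simp: k_def k'_def regular_input_def)
    ultimately show ?thesis using h by (simp add: regular_input_def)
  qed
  note K = regular_inputD[OF k]
  define R where "R = X (2 * T)"
  have R: "0 \<le> R" "\<theta> R = 2 * T" using X_mono[of 0 "2 * T"] T by (auto simp: R_def)
  \<comment> \<open>The first alternative lies ahead of the front of the reversed solution, the
    second is its state of rest at t = 2T.\<close>
  have zero: "ut k (2 * T - t) x = 0" "ux k (2 * T - t) x = 0" "ut k' (2 * T - t) x = 0"
    if "R \<le> x \<and> 0 \<le> t \<or> t = 2 * T \<and> 0 \<le> x" for t x
  proof -
    have "2 * T - t \<le> \<theta> x + 2 * \<delta>"
      using that \<theta>_le[of R x] \<theta>_nonneg[of x] R K(4) by auto
    then show "ut k (2 * T - t) x = 0" "ux k (2 * T - t) x = 0" "ut k' (2 * T - t) x = 0"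
      using K(4) by (auto intro!: ut_zero[OF K(1), of "2 * \<delta>"] ux_zero[OF K(1), of "2 * \<delta>"]
        ut_zero[OF K(2), of "2 * \<delta>"] K(5,6))
  qed
  obtain w where w: "w \<in> C1_test ({0<..} \<times> UNIV)"
    "\<And>t x. 0 \<le> x \<Longrightarrow> t \<le> 2 * T \<Longrightarrow> w (t, x) = u k t x"
    "\<And>t x. 0 \<le> x \<Longrightarrow> t \<le> 2 * T \<Longrightarrow> part_t w (t, x) = ut k t x"
    "\<And>t x. 0 \<le> x \<Longrightarrow> t \<le> 2 * T \<Longrightarrow> part_x w (t, x) = ux k t x"
    using approximant[OF k] by blast
  define \<phi> where "\<phi> = (\<lambda>(t, x). w (2 * T - t, x))"
  note \<phi> = C1_test_time_reflect[OF w(1), of "2 * T", folded \<phi>_def]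
  \<comment> \<open>On the strip \<open>p\<close> is minus the time derivative of \<phi> divided by
    c squared, and \<open>q\<close> is its space derivative. The wave equation for \<phi> says that
    the x derivative of \<open>q\<close> is \<open>- pt\<close>.\<close>
  define p where "p t x = ut k (2 * T - t) x / (c x)\<^sup>2" for t x
  define pt where "pt t x = - ut k' (2 * T - t) x / (c x)\<^sup>2" for t x
  define q where "q t x = ux k (2 * T - t) x" for t x
  have cont: "cont2 p" "cont2 pt" "cont2 q"
    unfolding p_def pt_def q_def
    by (intro continuous_intros c_cont_on cont2_compose[OF ut_cont[OF K(1)]] cont2_compose[OF ut_cont[OF K(2)]]
      cont2_compose[OF ux_cont[OF K(1)]]; simp)+
  have z: "p t x = 0" "pt t x = 0" "q t x = 0" if "0 \<le> t" "R \<le> x" for t x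
    using zero[of x t] that by (simp_all add: p_def pt_def q_def)
  have r: "((\<lambda>t. 2 * T - t) has_real_derivative - 1) (at t)" for t
    by (auto intro!: derivative_eq_intros)
  have dp: "((\<lambda>t. p t x) has_real_derivative pt t x) (at t)" for t x
    unfolding p_def pt_def using DERIV_cdivide[OF DERIV_chain2[OF ut_deriv_t[OF K(1-3)] r]] by simp
  have dq: "(q t has_real_derivative - pt t x) (at x)" for t x
    unfolding q_def[abs_def] pt_def using ux_deriv_x[OF K(1-3)] by simp
  have sq: "square_integrable (strip T) (\<lambda>z. l (fst z) (snd z))" if "cont2 l" "\<And>t x. 0 \<le> t \<Longrightarrow> R \<le> x \<Longrightarrow> l t x = 0" for l
    by (rule strip_square_integrable[OF that(1), of T R]) (use that(2) in auto)
  note sp = sq[OF cont(1) z(1)] and spt = sq[OF cont(2) z(2)] and sqq = sq[OF cont(3) z(3)]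
  have p0: "continuous_on UNIV (p 0)" "\<And>x. R \<le> x \<Longrightarrow> p 0 x = 0"
    using cont2_section(1)[OF cont(1)] z(1)[of 0] by auto
  have kc: "continuous_on UNIV h" by (rule hc)
  \<comment> \<open>The edge t = 0 contributes nothing in the limit because \<open>v\<close> has
    trace 0 there, the edge t = 2T because \<open>p\<close> vanishes on it.\<close>
  have t_parts: "(LINT z|strip T. vt z * p (fst z) (snd z)) + (LINT z|strip T. v z * pt (fst z) (snd z)) = 0"
  proof -
    obtain a where a: "\<And>n. a n \<in> C1_test UNIV" "L2_tendsto (strip T) a v" "L2_tendsto (strip T) (\<lambda>n. part_t (a n)) vt"
      "L2_tendsto (strip T) (\<lambda>n. part_x (a n)) vx" "L2_tendsto halfline (\<lambda>n x. a n (0, x)) (\<lambda>x. 0)"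
      using has_traceE[OF tr0 C1_test_halfline[where V = UNIV]] by blast
    have eq: "(LINT z|strip T. part_t (a n) z * p (fst z) (snd z)) + (LINT z|strip T. a n z * pt (fst z) (snd z))
       = - (LINT x|halfline. a n (0, x) * p 0 x)" for n
    proof -
      have ad: "\<And>t x. ((\<lambda>s. a n (s, x)) has_real_derivative part_t (a n) (t, x)) (at t)"
        and ac: "continuous_on UNIV (a n)" "continuous_on UNIV (part_t (a n))"
        using C1_testD[OF a(1)] by metis+
      have cc: "cont2 (\<lambda>t x. part_t (a n) (t, x) * p t x + pt t x * a n (t, x))"
        using ac by (intro continuous_intros cont) simp_all
      have "(LINT z|strip T. part_t (a n) (fst z, snd z) * p (fst z) (snd z) + pt (fst z) (snd z) * a n (fst z, snd z))
        = integral {0..R} (\<lambda>x. a n (2 * T, x) * p (2 * T) x - a n (0, x) * p 0 x)"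
        by (rule strip_integral_deriv_t[OF cc DERIV_mult[OF ad dp]]) (use T z in auto)
      also have "\<dots> = integral {0..R} (\<lambda>x. - (a n (0, x) * p 0 x))"
        using zero(1)[of _ "2 * T"] by (intro Henstock_Kurzweil_Integration.integral_cong) (simp add: p_def)
      also have "\<dots> = - (LINT x|halfline. a n (0, x) * p 0 x)"
        using p0 R by (subst halfline_integral[of _ R])
          (auto intro!: continuous_intros continuous_on_compose2[OF ac(1)])
      finally have "(LINT z|strip T. part_t (a n) z * p (fst z) (snd z) + a n z * pt (fst z) (snd z))
        = - (LINT x|halfline. a n (0, x) * p 0 x)" by (simp add: mult.commute)
      then show ?thesis
        using square_integrable_mult[OF C1_test_strip(2)[OF a(1)] sp] square_integrable_mult[OF C1_test_strip(1)[OF a(1)] spt]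
        by simp
    qed
    have "(\<lambda>n. - (LINT x|halfline. a n (0, x) * p 0 x)) \<longlonglongrightarrow>
        (LINT z|strip T. vt z * p (fst z) (snd z)) + (LINT z|strip T. v z * pt (fst z) (snd z))"
      unfolding eq[symmetric] by (intro tendsto_add L2_tendsto_integral a sp spt)
    moreover have "(\<lambda>n. - (LINT x|halfline. a n (0, x) * p 0 x)) \<longlonglongrightarrow> - (LINT x|halfline. 0 * p 0 x)"
      using p0 R by (intro tendsto_minus L2_tendsto_integral a halfline_square_integrable) auto
    ultimately show ?thesis using LIMSEQ_unique by fastforce
  qed
  have x_parts: "(LINT z|strip T. vx z * q (fst z) (snd z)) - (LINT z|strip T. v z * pt (fst z) (snd z))
      = - (LINT t|time_interval T. g t * h t)"
  proof -
    obtain a where a: "\<And>n. a n \<in> C1_test UNIV" "L2_tendsto (strip T) a v" "L2_tendsto (strip T) (\<lambda>n. part_t (a n)) vt"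
      "L2_tendsto (strip T) (\<lambda>n. part_x (a n)) vx" "L2_tendsto (time_interval T) (\<lambda>n t. a n (t, 0)) g"
      using has_traceE[OF trx C1_test_time[where V = UNIV]] by blast
    have eq: "(LINT z|strip T. part_x (a n) z * q (fst z) (snd z)) - (LINT z|strip T. a n z * pt (fst z) (snd z))
       = - (LINT t|time_interval T. a n (t, 0) * h t)" for n
    proof -
      have ad: "\<And>t x. ((\<lambda>y. a n (t, y)) has_real_derivative part_x (a n) (t, x)) (at x)"
        and ac: "continuous_on UNIV (a n)" "continuous_on UNIV (part_x (a n))"
        using C1_testD[OF a(1)] by metis+
      have cc: "cont2 (\<lambda>t x. part_x (a n) (t, x) * q t x + - pt t x * a n (t, x))"
        using ac by (intro continuous_intros cont) simp_all
      have "(LINT z|strip T. part_x (a n) (fst z, snd z) * q (fst z) (snd z) + - pt (fst z) (snd z) * a n (fst z, snd z))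
        = - integral {0..2 * T} (\<lambda>t. a n (t, 0) * q t 0)"
        by (rule strip_integral_deriv_x[OF cc DERIV_mult[OF ad dq] R(1)]) (use z in auto)
      also have "\<dots> = - (LINT t|time_interval T. a n (t, 0) * h t)"
        by (subst time_interval_integral)
          (auto simp: q_def ux_0 k_def intro!: continuous_intros continuous_on_compose2[OF ac(1)] kc)
      finally have "(LINT z|strip T. part_x (a n) z * q (fst z) (snd z) - a n z * pt (fst z) (snd z))
        = - (LINT t|time_interval T. a n (t, 0) * h t)" by (simp add: mult.commute)
      then show ?thesis
        using square_integrable_mult[OF C1_test_strip(3)[OF a(1)] sqq] square_integrable_mult[OF C1_test_strip(1)[OF a(1)] spt]
        by simp
    qed
    have "(\<lambda>n. - (LINT t|time_interval T. a n (t, 0) * h t)) \<longlonglongrightarrow>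
        (LINT z|strip T. vx z * q (fst z) (snd z)) - (LINT z|strip T. v z * pt (fst z) (snd z))"
      unfolding eq[symmetric] by (intro tendsto_diff L2_tendsto_integral a sqq spt)
    moreover have "(\<lambda>n. - (LINT t|time_interval T. a n (t, 0) * h t)) \<longlonglongrightarrow> - (LINT t|time_interval T. g t * h t)"
      by (intro tendsto_minus L2_tendsto_integral a time_interval_square_integrable kc)
    ultimately show ?thesis by (rule LIMSEQ_unique)
  qed
  have sv: "square_integrable (strip T) vt" "square_integrable (strip T) vx"
    using trx by (auto simp: has_trace_def H1_strip_def)
  have "(LINT z|strip T. vx z * part_x \<phi> z - vt z * part_t \<phi> z / (c (snd z))\<^sup>2)
      = (LINT z|strip T. vx z * q (fst z) (snd z) + vt z * p (fst z) (snd z))"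
  proof (rule Bochner_Integration.integral_cong)
    fix z assume "z \<in> space (strip T)"
    then obtain t x where "z = (t, x)" "0 < t" "t < 2 * T" "0 < x"
      by (auto simp: strip_def space_restrict_space)
    then show "vx z * part_x \<phi> z - vt z * part_t \<phi> z / (c (snd z))\<^sup>2 = vx z * q (fst z) (snd z) + vt z * p (fst z) (snd z)"
      using w by (simp add: \<phi>(2,3) p_def q_def)
  qed simp
  also have "\<dots> = (LINT z|strip T. vx z * q (fst z) (snd z)) + (LINT z|strip T. vt z * p (fst z) (snd z))"
    using square_integrable_mult[OF sv(1) sp] square_integrable_mult[OF sv(2) sqq] by simp
  finally have "(LINT z|strip T. vx z * part_x \<phi> z - vt z * part_t \<phi> z / (c (snd z))\<^sup>2)
      = - (LINT t|time_interval T. g t * h t)"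
    using t_parts x_parts by simp
  moreover have "(LINT t|time_interval T. f t * \<phi> (t, 0)) = (LINT t|time_interval T. f t * u k (2 * T - t) 0)"
    using w(2) by (intro Bochner_Integration.integral_cong) (auto simp: \<phi>_def)
  ultimately show ?thesis
    using weak[OF \<phi>(1)] by (simp add: k_def[abs_def])
qed

end

section \<open>Solutions with square integrable Neumann data\<close>

text \<open>The set of integration differs from [0, \<xi>] by null points only; for negative \<xi>
  both sides are 0.\<close>

lemma time_integral_upto:
  fixes w :: "real \<Rightarrow> real"
  assumes w: "continuous_on UNIV w" and "\<xi> \<le> 2 * T"
  shows "(LINT \<sigma>|time_interval T. indicator {..\<xi>} \<sigma> * w \<sigma>) = prim w (max 0 \<xi>)"
proof -
  define D where "D = {0<..<2 * T} \<inter> {..\<xi>}"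
  have m: "{0<..<2 * T} \<inter> space lborel \<in> sets lborel" by simp
  have i: "set_integrable lborel {0..max 0 \<xi>} w"
    unfolding set_integrable_def using w continuous_on_subset by (intro borel_integrable_compact) blast+
  have D: "set_integrable lborel D w"
    by (rule set_integrable_subset[OF i]) (auto simp: D_def)
  have "(LINT \<sigma>|time_interval T. indicator {..\<xi>} \<sigma> * w \<sigma>) = (LINT \<sigma>|lborel. indicator D \<sigma> *\<^sub>R w \<sigma>)"
    unfolding time_interval_def integral_restrict_space[OF m]
    by (intro Bochner_Integration.integral_cong) (auto simp: D_def indicator_def)
  also have "\<dots> = integral D w"
    using set_borel_integral_eq_integral(2)[OF D] unfolding set_lebesgue_integral_def .
  also have "\<dots> = integral {0..max 0 \<xi>} w"
  proof (rule integral_spike_set)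
    show "negligible {x \<in> D - {0..max 0 \<xi>}. w x \<noteq> 0}"
      by (rule negligible_subset[of "{}"]) (auto simp: D_def)
    show "negligible {x \<in> {0..max 0 \<xi>} - D. w x \<noteq> 0}"
      by (rule negligible_subset[of "{0, \<xi>, 2 * T}"]) (use assms in \<open>auto simp: D_def\<close>)
  qed
  also have "\<dots> = prim w (max 0 \<xi>)"
    using w continuous_on_subset by (intro prim_eq_integral[symmetric]) auto
  finally show ?thesis .
qed

lemma L1_bound_time:
  assumes f: "square_integrable (time_interval T) f" and T: "0 < T"
  shows "integrable (time_interval T) f"
    and "(LINT t|time_interval T. \<bar>f t\<bar>) \<le> sqrt (2 * T) * sqrt (LINT t|time_interval T. (f t)\<^sup>2)"
proof -
  have 1: "square_integrable (time_interval T) (\<lambda>t. 1)"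
    by (rule time_interval_square_integrable) (intro continuous_intros)
  show "integrable (time_interval T) f"
    using square_integrable_mult[OF f 1] by simp
  have a: "square_integrable (time_interval T) (\<lambda>t. \<bar>f t\<bar>)"
    using f by (auto simp: square_integrable_def)
  have "(LINT t|time_interval T. (1::real)\<^sup>2) = 2 * T"
    using T by (subst time_interval_integral) auto
  then show "(LINT t|time_interval T. \<bar>f t\<bar>) \<le> sqrt (2 * T) * sqrt (LINT t|time_interval T. (f t)\<^sup>2)"
    using Cauchy_Schwarz_integral[OF a 1] by (simp add: mult.commute)
qed

lemma time_abs_integral_le:
  assumes f: "square_integrable (time_interval T) f" and m: "w \<in> borel_measurable (time_interval T)"
    and w: "\<And>t. 0 < t \<Longrightarrow> t < 2 * T \<Longrightarrow> \<bar>w t\<bar> \<le> M" and T: "0 < T"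
  shows "integrable (time_interval T) (\<lambda>t. w t * f t)"
    and "\<bar>LINT t|time_interval T. w t * f t\<bar> \<le> M * (sqrt (2 * T) * sqrt (LINT t|time_interval T. (f t)\<^sup>2))"
proof -
  have M: "0 \<le> M" using w[of T] T by linarith
  have ae: "\<bar>w t * f t\<bar> \<le> M * \<bar>f t\<bar>" if "t \<in> space (time_interval T)" for t
    using w[of t] that by (auto simp: abs_mult intro!: mult_right_mono)
  note i = L1_bound_time[OF f T]
  show int: "integrable (time_interval T) (\<lambda>t. w t * f t)"
    using i(1) m ae M by (intro Bochner_Integration.integrable_bound[of _ "\<lambda>t. M * \<bar>f t\<bar>" "\<lambda>t. w t * f t"])
      (auto intro!: AE_I2 borel_measurable_times simp: abs_mult square_integrable_def)
  have "\<bar>LINT t|time_interval T. w t * f t\<bar> \<le> (LINT t|time_interval T. \<bar>w t * f t\<bar>)"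
    using integral_norm_bound[of "time_interval T" "\<lambda>t. w t * f t"] by simp
  also have "\<dots> \<le> (LINT t|time_interval T. M * \<bar>f t\<bar>)"
    using int i(1) ae by (intro integral_mono) auto
  also have "\<dots> \<le> M * (sqrt (2 * T) * sqrt (LINT t|time_interval T. (f t)\<^sup>2))"
    using i(2) M by (simp add: mult_left_mono)
  finally show "\<bar>LINT t|time_interval T. w t * f t\<bar> \<le> M * (sqrt (2 * T) * sqrt (LINT t|time_interval T. (f t)\<^sup>2))" .
qed

text \<open>The shifted time t - \<theta> x leaves (0, 2T), where a representative of the data has
  arbitrary values.\<close>

definition zero_ext :: "real \<Rightarrow> (real \<Rightarrow> real) \<Rightarrow> real \<Rightarrow> real" where
  "zero_ext T f t = indicator {0<..<2 * T} t * f t"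

lemma zero_ext_measurable:
  assumes "f \<in> borel_measurable (time_interval T)"
  shows "zero_ext T f \<in> borel_measurable borel"
proof -
  have m: "{0<..<2 * T} \<inter> space lborel \<in> sets lborel" by simp
  have "(\<lambda>t. indicator {0<..<2 * T} t *\<^sub>R f t) \<in> borel_measurable lborel"
    using assms unfolding time_interval_def borel_measurable_restrict_space_iff[OF m] .
  then show ?thesis by (simp add: zero_ext_def[abs_def])
qed

lemma nn_integral_zero_ext:
  assumes f: "square_integrable (time_interval T) f"
  shows "(\<integral>\<^sup>+t. ennreal ((zero_ext T f t)\<^sup>2) \<partial>lborel) = ennreal (LINT t|time_interval T. (f t)\<^sup>2)"
proof -
  have m: "{0<..<2 * T} \<inter> space lborel \<in> sets lborel" by simp
  have "(\<integral>\<^sup>+t. ennreal ((zero_ext T f t)\<^sup>2) \<partial>lborel)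
      = (\<integral>\<^sup>+t. ennreal ((f t)\<^sup>2) * indicator {0<..<2 * T} t \<partial>lborel)"
    by (intro nn_integral_cong) (simp add: zero_ext_def indicator_def)
  also have "\<dots> = (\<integral>\<^sup>+t. ennreal ((f t)\<^sup>2) \<partial>time_interval T)"
    unfolding time_interval_def nn_integral_restrict_space[OF m] ..
  also have "\<dots> = ennreal (LINT t|time_interval T. (f t)\<^sup>2)"
    using f by (intro nn_integral_eq_integral) (auto simp: square_integrable_def)
  finally show ?thesis .
qed

text \<open>Integrating in time first, the shift by the travel time disappears by translation invariance.\<close>

lemma strip_shift_bound:
  fixes w :: "real \<times> real \<Rightarrow> real" and \<tau> :: "real \<Rightarrow> real"
  assumes f: "square_integrable (time_interval T) f" and w: "w \<in> borel_measurable borel"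
    and \<tau>: "continuous_on UNIV \<tau>" and ab: "0 \<le> a" "0 \<le> b" "0 \<le> R" "0 \<le> T"
    and le: "\<And>t x. 0 < t \<Longrightarrow> t < 2 * T \<Longrightarrow> 0 < x \<Longrightarrow> x \<le> R \<Longrightarrow> (w (t, x))\<^sup>2 \<le> a * (zero_ext T f (t - \<tau> x))\<^sup>2 + b"
    and zero: "\<And>t x. 0 < t \<Longrightarrow> t < 2 * T \<Longrightarrow> R < x \<Longrightarrow> w (t, x) = 0"
  shows "square_integrable (strip T) w"
    and "(LINT z|strip T. (w z)\<^sup>2) \<le> R * (a * (LINT t|time_interval T. (f t)\<^sup>2) + b * (2 * T))"
proof -
  define I where "I = (LINT t|time_interval T. (f t)\<^sup>2)"
  have I: "0 \<le> I" by (simp add: I_def)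
  have f0 [measurable]: "zero_ext T f \<in> borel_measurable borel"
    using f by (intro zero_ext_measurable) (simp add: square_integrable_def)
  have [measurable]: "\<tau> \<in> borel_measurable borel" by (rule borel_measurable_continuous_onI[OF \<tau>])
  have [measurable]: "w \<in> borel_measurable (borel \<Otimes>\<^sub>M borel)" using w by (simp add: borel_prod)
  have m: "({0<..<2 * T} \<times> {0<..}) \<inter> space lborel \<in> sets (lborel :: (real \<times> real) measure)"
    using strip_borel by simp
  define k where "k t x = ennreal (a * (zero_ext T f (t - \<tau> x))\<^sup>2 + b * indicator {0<..<2 * T} t) * indicator {0<..R} x" for t x
  have km [measurable]: "case_prod k \<in> borel_measurable (lborel \<Otimes>\<^sub>M lborel)"
    unfolding k_def by measurable
  have "(\<integral>\<^sup>+z. ennreal ((w z)\<^sup>2) \<partial>strip T) = (\<integral>\<^sup>+z. ennreal ((w z)\<^sup>2) * indicator ({0<..<2 * T} \<times> {0<..}) z \<partial>lborel)"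
    unfolding strip_def nn_integral_restrict_space[OF m] ..
  also have "\<dots> \<le> (\<integral>\<^sup>+z. case_prod k z \<partial>lborel)"
  proof (rule nn_integral_mono)
    fix z :: "real \<times> real"
    obtain t x where z: "z = (t, x)" by (cases z)
    show "ennreal ((w z)\<^sup>2) * indicator ({0<..<2 * T} \<times> {0<..}) z \<le> case_prod k z"
    proof (cases "0 < t \<and> t < 2 * T \<and> 0 < x \<and> x \<le> R")
      case True
      then show ?thesis using le[of t x] by (auto simp: z k_def intro!: ennreal_leI)
    next
      case False
      then have "ennreal ((w z)\<^sup>2) * indicator ({0<..<2 * T} \<times> {0<..}) z = 0"
        using zero[of t x] by (auto simp: z indicator_def)
      then show ?thesis by (rule ord_eq_le_trans) simp
    qed
  qed
  also have "\<dots> = (\<integral>\<^sup>+z. case_prod k z \<partial>(lborel \<Otimes>\<^sub>M lborel))"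
    by (simp add: lborel_prod)
  also have "\<dots> = (\<integral>\<^sup>+x. \<integral>\<^sup>+t. k t x \<partial>lborel \<partial>lborel)"
    using lborel_pair.nn_integral_snd[OF km] by simp
  also have "\<dots> = (\<integral>\<^sup>+x. ennreal (a * I + b * (2 * T)) * indicator {0<..R} x \<partial>lborel)"
  proof (rule nn_integral_cong)
    fix x
    have sh: "(\<integral>\<^sup>+t. ennreal ((zero_ext T f (t - \<tau> x))\<^sup>2) \<partial>lborel) = ennreal I"
    proof -
      have "(\<integral>\<^sup>+t. ennreal ((zero_ext T f t)\<^sup>2) \<partial>lborel)
          = ennreal \<bar>1\<bar> * (\<integral>\<^sup>+t. ennreal ((zero_ext T f (- \<tau> x + 1 * t))\<^sup>2) \<partial>lborel)"
        by (rule nn_integral_real_affine) auto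
      then show ?thesis
        using nn_integral_zero_ext[OF f] by (simp add: I_def)
    qed
    have "(\<integral>\<^sup>+t. k t x \<partial>lborel) = (\<integral>\<^sup>+t. (ennreal a * ennreal ((zero_ext T f (t - \<tau> x))\<^sup>2)
        + ennreal b * indicator {0<..<2 * T} t) * indicator {0<..R} x \<partial>lborel)"
      unfolding k_def
    proof (intro nn_integral_cong)
      fix t
      show "ennreal (a * (zero_ext T f (t - \<tau> x))\<^sup>2 + b * indicator {0<..<2 * T} t) * indicator {0<..R} x
        = (ennreal a * ennreal ((zero_ext T f (t - \<tau> x))\<^sup>2) + ennreal b * indicator {0<..<2 * T} t) * indicator {0<..R} x"
        using ab by (cases "t \<in> {0<..<2 * T}") (simp_all add: ennreal_mult)
    qed
    also have "\<dots> = (ennreal a * ennreal I + ennreal b * ennreal (2 * T)) * indicator {0<..R} x"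
      using ab by (simp add: nn_integral_multc nn_integral_add nn_integral_cmult sh nn_integral_cmult_indicator)
    also have "\<dots> = ennreal (a * I + b * (2 * T)) * indicator {0<..R} x"
      using ab I by (simp add: ennreal_plus ennreal_mult)
    finally show "(\<integral>\<^sup>+t. k t x \<partial>lborel) = ennreal (a * I + b * (2 * T)) * indicator {0<..R} x" .
  qed
  also have "\<dots> = ennreal (R * (a * I + b * (2 * T)))"
  proof -
    have "0 \<le> a * I + b * (2 * T)" using ab I by simp
    moreover have "(\<integral>\<^sup>+x. ennreal d * indicator {0<..R} x \<partial>lborel) = ennreal d * ennreal R" for d
      using ab by (subst nn_integral_cmult_indicator) auto
    ultimately show ?thesis using ab by (simp only: ennreal_mult mult.commute[of R])
  qed
  finally have bound: "(\<integral>\<^sup>+z. ennreal ((w z)\<^sup>2) \<partial>strip T) \<le> ennreal (R * (a * I + b * (2 * T)))" .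
  have ws: "w \<in> borel_measurable (strip T)"
    unfolding strip_def using w by (intro measurable_restrict_space1) simp
  then have i: "integrable (strip T) (\<lambda>z. (w z)\<^sup>2)"
    using bound by (intro integrableI_bounded) (auto simp: le_less_trans[OF _ ennreal_less_top])
  with ws show "square_integrable (strip T) w" by (simp add: square_integrable_def)
  have "ennreal (LINT z|strip T. (w z)\<^sup>2) \<le> ennreal (R * (a * I + b * (2 * T)))"
    using bound nn_integral_eq_integral[OF i] by simp
  then show "(LINT z|strip T. (w z)\<^sup>2) \<le> R * (a * I + b * (2 * T))"
    using ab I by (simp add: ennreal_le_iff)
qed

text \<open>Causal convolution with the shift on the continuous kernel instead of on the data. It is
  meaningful for square integrable \<open>f\<close>, blind to null sets, and reads \<open>f\<close>
  only on (0, 2T).\<close>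

definition cv :: "real \<Rightarrow> (real \<Rightarrow> real \<Rightarrow> real) \<Rightarrow> (real \<Rightarrow> real) \<Rightarrow> real \<Rightarrow> real \<Rightarrow> real" where
  "cv T k f \<xi> y = (LINT \<sigma>|time_interval T. indicator {..\<xi>} \<sigma> * k (\<xi> - \<sigma>) y * f \<sigma>)"

lemma sigma_finite_time_interval: "sigma_finite_measure (time_interval T)"
  using finite_measure_time_interval by (rule finite_measure.axioms(1)[unfolded sigma_finite_measure_def, THEN sigma_finite_measure.intro])

lemma param_time_integral_measurable:
  fixes w :: "real \<times> real \<Rightarrow> real \<Rightarrow> real"
  assumes w: "(\<lambda>q. w (fst q) (snd q)) \<in> borel_measurable (borel \<Otimes>\<^sub>M borel)" and f: "f \<in> borel_measurable (time_interval T)"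
  shows "(\<lambda>p. LINT \<sigma>|time_interval T. indicator {..fst p} \<sigma> * w p \<sigma> * f \<sigma>) \<in> borel_measurable borel"
proof -
  interpret sigma_finite_measure "time_interval T" by (rule sigma_finite_time_interval)
  have [measurable]: "(\<lambda>x. x) \<in> borel_measurable (time_interval T)"
    unfolding time_interval_def by (rule continuous_measurable_restrict) (rule continuous_on_id)
  have [measurable]: "fst \<in> borel_measurable (borel :: (real \<times> real) measure)"
    by (intro borel_measurable_continuous_onI continuous_intros)
  have "(\<lambda>q. (fst q, snd q)) \<in> (borel \<Otimes>\<^sub>M time_interval T) \<rightarrow>\<^sub>M ((borel :: (real \<times> real) measure) \<Otimes>\<^sub>M (borel :: real measure))"
    by measurable
  from measurable_compose[OF this w]
  have [measurable]: "(\<lambda>q. w (fst q) (snd q)) \<in> borel_measurable (borel \<Otimes>\<^sub>M time_interval T)" by simp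
  note f[measurable]
  have "case_prod (\<lambda>p \<sigma>. indicator {..fst p} \<sigma> * w p \<sigma> * f \<sigma>) \<in> borel_measurable (borel \<Otimes>\<^sub>M time_interval T)"
  proof -
    have "(\<lambda>q. (if snd q \<le> fst (fst q) then 1 else 0) * w (fst q) (snd q) * f (snd q)) \<in> borel_measurable (borel \<Otimes>\<^sub>M time_interval T)"
      by measurable
    then show ?thesis by (simp add: case_prod_unfold indicator_def of_bool_def)
  qed
  from borel_measurable_lebesgue_integral[OF this] show ?thesis .
qed

lemma cv_measurable:
  assumes k: "cont2 k" and f: "f \<in> borel_measurable (time_interval T)"
  shows "(\<lambda>p. cv T k f (fst p) (snd p)) \<in> borel_measurable borel"
  unfolding cv_def
proof (rule param_time_integral_measurable[OF _ f])
  have "continuous_on UNIV (\<lambda>q :: (real \<times> real) \<times> real. k (fst (fst q) - snd q) (snd (fst q)))"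
    by (intro cont2_compose[OF k] continuous_intros)
  then show "(\<lambda>q. k (fst (fst q) - snd q) (snd (fst q))) \<in> borel_measurable (borel \<Otimes>\<^sub>M borel)"
    by (simp add: borel_prod borel_measurable_continuous_onI)
qed

lemma cv_bound:
  assumes k: "cont2 k" and f: "square_integrable (time_interval T) f" and T: "0 < T" and "\<xi> \<le> 2 * T"
    and M: "\<And>s. 0 \<le> s \<Longrightarrow> s \<le> 2 * T \<Longrightarrow> \<bar>k s y\<bar> \<le> M"
  shows "integrable (time_interval T) (\<lambda>\<sigma>. indicator {..\<xi>} \<sigma> * k (\<xi> - \<sigma>) y * f \<sigma>)"
    and "\<bar>cv T k f \<xi> y\<bar> \<le> M * (sqrt (2 * T) * sqrt (LINT t|time_interval T. (f t)\<^sup>2))"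
proof -
  have c: "continuous_on UNIV (\<lambda>\<sigma>. k (\<xi> - \<sigma>) y)"
    by (intro cont2_compose[OF k] continuous_intros)
  have m: "(\<lambda>\<sigma>. indicator {..\<xi>} \<sigma> * k (\<xi> - \<sigma>) y) \<in> borel_measurable (time_interval T)"
  proof -
    have [measurable]: "(\<lambda>\<sigma>. k (\<xi> - \<sigma>) y) \<in> borel_measurable borel"
      by (rule borel_measurable_continuous_onI[OF c])
    have "(\<lambda>\<sigma>. indicator {..\<xi>} \<sigma> * k (\<xi> - \<sigma>) y) \<in> borel_measurable lborel"
      by measurable
    then show ?thesis
      unfolding time_interval_def by (rule measurable_restrict_space1)
  qed
  have b: "\<bar>indicator {..\<xi>} \<sigma> * k (\<xi> - \<sigma>) y\<bar> \<le> M" if "0 < \<sigma>" for \<sigma>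
    using M[of "\<xi> - \<sigma>"] M[of 0] that assms(3,4) by (auto simp: indicator_def)
  show "integrable (time_interval T) (\<lambda>\<sigma>. indicator {..\<xi>} \<sigma> * k (\<xi> - \<sigma>) y * f \<sigma>)"
    by (rule time_abs_integral_le(1)[OF f m b T])
  show "\<bar>cv T k f \<xi> y\<bar> \<le> M * (sqrt (2 * T) * sqrt (LINT t|time_interval T. (f t)\<^sup>2))"
    unfolding cv_def by (rule time_abs_integral_le(2)[OF f m b T])
qed

lemma cv_nonpos: "\<xi> \<le> 0 \<Longrightarrow> cv T k f \<xi> y = 0"
  unfolding cv_def
  by (subst Bochner_Integration.integral_cong[where g = "\<lambda>_. 0"]) (auto simp: indicator_def)

lemma cv_eq_conv:
  assumes f: "causal f" and k: "cont2 k" and "\<xi> \<le> 2 * T"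
  shows "cv T k f \<xi> y = conv (\<lambda>\<sigma>. k \<sigma> y) f \<xi>"
proof (cases "0 \<le> \<xi>")
  case True
  define g where "g \<sigma> = k (\<xi> - \<sigma>) y * f \<sigma>" for \<sigma>
  have g: "continuous_on UNIV g"
    unfolding g_def by (intro continuous_intros cont2_compose[OF k] causal_cont_on[OF f])
  have "cv T k f \<xi> y = prim g (max 0 \<xi>)"
    unfolding cv_def using time_integral_upto[OF g \<open>\<xi> \<le> 2 * T\<close>] by (simp add: g_def mult.assoc)
  moreover have "-1 * prim (\<lambda>s. g (-1 * s + \<xi>)) \<xi> = prim g (-1 * \<xi> + \<xi>) - prim g \<xi>"
    by (rule prim_affine[OF g])
  ultimately show ?thesis
    using True by (simp add: conv_def g_def)
next
  case False
  then show ?thesis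
    using conv_causal[OF f cont2_section(2)[OF k], of 0 \<xi>] f by (simp add: cv_nonpos causal_def)
qed

lemma L2_tendsto_cong:
  assumes "L2_tendsto M f g" "\<And>n x. x \<in> space M \<Longrightarrow> f n x = f' n x" "\<And>x. x \<in> space M \<Longrightarrow> g x = g' x"
  shows "L2_tendsto M f' g'"
proof -
  have s: "square_integrable M h \<longleftrightarrow> square_integrable M h'" if "\<And>x. x \<in> space M \<Longrightarrow> h x = h' x" for h h'
  proof -
    have "h \<in> borel_measurable M \<longleftrightarrow> h' \<in> borel_measurable M"
      by (rule measurable_cong[OF that])
    moreover have "integrable M (\<lambda>x. (h x)\<^sup>2) \<longleftrightarrow> integrable M (\<lambda>x. (h' x)\<^sup>2)"
      by (rule Bochner_Integration.integrable_cong) (simp_all add: that)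
    ultimately show ?thesis by (simp add: square_integrable_def)
  qed
  have "(LINT x|M. (f n x - g x)\<^sup>2) = (LINT x|M. (f' n x - g' x)\<^sup>2)" for n
    by (rule Bochner_Integration.integral_cong) (simp_all add: assms(2,3))
  then show ?thesis
    using assms(1) s[of g g'] s[of "f n" "f' n" for n] assms(2,3) by (simp add: L2_tendsto_def)
qed

lemma L2_tendsto_bounded_linear:
  assumes f: "L2_tendsto M f g" and C: "0 \<le> C"
    and S: "\<And>f. square_integrable M f \<Longrightarrow> square_integrable N (S f) \<and> (LINT x|N. (S f x)\<^sup>2) \<le> C * (LINT x|M. (f x)\<^sup>2)"
    and lin: "\<And>f g x. square_integrable M f \<Longrightarrow> square_integrable M g \<Longrightarrow> x \<in> space N \<Longrightarrow> S (\<lambda>t. f t - g t) x = S f x - S g x"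
  shows "L2_tendsto N (\<lambda>n. S (f n)) (S g)"
proof -
  have si: "square_integrable M (f n)" "square_integrable M g"
    and lim: "(\<lambda>n. LINT x|M. (f n x - g x)\<^sup>2) \<longlonglongrightarrow> 0" for n
    using f by (auto simp: L2_tendsto_def)
  have "(LINT x|N. (S (f n) x - S g x)\<^sup>2) = (LINT x|N. (S (\<lambda>t. f n t - g t) x)\<^sup>2)" for n
    by (rule Bochner_Integration.integral_cong) (simp_all add: lin si)
  then have "\<bar>LINT x|N. (S (f n) x - S g x)\<^sup>2\<bar> \<le> C * (LINT x|M. (f n x - g x)\<^sup>2)" for n
    using S[OF square_integrable_diff[OF si]] by simp
  from tendsto_zero_bound[OF this tendsto_mult_right_zero[OF lim]] show ?thesis
    using S si by (simp add: L2_tendsto_def)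
qed

lemma square_add_le: "(x + y)\<^sup>2 \<le> 2 * x\<^sup>2 + 2 * y\<^sup>2" for x y :: real
  using zero_le_power2[of "x - y"] by (simp add: power2_eq_square algebra_simps)

section \<open>Solution formulas and bounds for square integrable data\<close>

context speed
begin

lemma \<kappa>_bounds: "(\<kappa> (\<theta> x))\<^sup>2 \<le> C1" "1 / (\<kappa> (\<theta> x))\<^sup>2 \<le> 1 / C0"
  using \<kappa>_squared[of x] c_upper[of x] c_lower[of x] C0_pos
  by (auto simp: power2_eq_square intro!: divide_left_mono mult_pos_pos)

text \<open>Common bound of both kernels on [0, 2T]: it is the bound for \<open>H\<close>, and
  \<beta> \<ge> 1 makes it cover \<open>G\<close>.\<close>

definition M :: "real \<Rightarrow> real" where "M T = \<beta> * (m * exp (\<mu> * (2 * T)))"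

lemma kernel_bounds:
  assumes "0 \<le> s" "s \<le> 2 * T"
  shows "\<bar>G s y\<bar> \<le> M T" "\<bar>H s y\<bar> \<le> M T"
proof -
  have e: "m * exp (\<mu> * max 0 s) \<le> m * exp (\<mu> * (2 * T))"
    using assms m_pos \<mu>_pos by (simp add: max_def)
  then show "\<bar>H s y\<bar> \<le> M T"
    unfolding M_def using \<beta>_ge by (intro order_trans[OF H_bound] mult_left_mono[OF e]) auto
  have "m * exp (\<mu> * (2 * T)) \<le> M T"
    unfolding M_def using \<beta>_ge m_pos mult_right_mono[of 1 \<beta> "m * exp (\<mu> * (2 * T))"] by simp
  with e show "\<bar>G s y\<bar> \<le> M T"
    by (intro order_trans[OF G_bound]) linarith
qed

text \<open>For regular data and \<xi> \<le> 2T, \<open>P\<close> and \<open>Q\<close> are half the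
  sum and half the difference of the Riemann invariants (\<open>regular_P\<close>), that is
  \<open>u\<^sub>t / \<kappa>\<close> and \<open>\<kappa> u\<^sub>x\<close>. The pointwise part of
  \<open>W\<^sub>-\<close> is split off as \<open>zero_ext\<close>.\<close>

definition P :: "real \<Rightarrow> (real \<Rightarrow> real) \<Rightarrow> real \<Rightarrow> real \<Rightarrow> real" where
  "P T f \<xi> y = - zero_ext T f \<xi> + (cv T G f \<xi> y + cv T H f \<xi> y) / 2"

definition Q :: "real \<Rightarrow> (real \<Rightarrow> real) \<Rightarrow> real \<Rightarrow> real \<Rightarrow> real" where
  "Q T f \<xi> y = zero_ext T f \<xi> + (cv T G f \<xi> y - cv T H f \<xi> y) / 2"

definition prim_P :: "real \<Rightarrow> (real \<Rightarrow> real) \<Rightarrow> real \<Rightarrow> real \<Rightarrow> real" where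
  "prim_P T f s y = (LINT \<xi>|time_interval T. indicator {..s} \<xi> * P T f \<xi> y)"

definition v :: "real \<Rightarrow> (real \<Rightarrow> real) \<Rightarrow> real \<times> real \<Rightarrow> real" where
  "v T f z = \<kappa> (\<theta> (snd z)) * prim_P T f (fst z - \<theta> (snd z)) (\<theta> (snd z))"

definition vt :: "real \<Rightarrow> (real \<Rightarrow> real) \<Rightarrow> real \<times> real \<Rightarrow> real" where
  "vt T f z = \<kappa> (\<theta> (snd z)) * P T f (fst z - \<theta> (snd z)) (\<theta> (snd z))"

definition vx :: "real \<Rightarrow> (real \<Rightarrow> real) \<Rightarrow> real \<times> real \<Rightarrow> real" where
  "vx T f z = 1 / \<kappa> (\<theta> (snd z)) * Q T f (fst z - \<theta> (snd z)) (\<theta> (snd z))"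

definition \<Lambda> :: "real \<Rightarrow> (real \<Rightarrow> real) \<Rightarrow> real \<Rightarrow> real" where
  "\<Lambda> T f t = prim_P T f t 0"

context
  fixes T :: real
  assumes T: "0 < T"
begin

abbreviation nrm :: "(real \<Rightarrow> real) \<Rightarrow> real" where
  "nrm f \<equiv> sqrt (LINT t|time_interval T. (f t)\<^sup>2)"

lemma cv_kernel:
  assumes f: "square_integrable (time_interval T) f" and "\<xi> \<le> 2 * T"
  shows "\<bar>cv T G f \<xi> y\<bar> \<le> M T * (sqrt (2 * T) * nrm f)" "\<bar>cv T H f \<xi> y\<bar> \<le> M T * (sqrt (2 * T) * nrm f)"
  using cv_bound(2)[OF G_cont f T assms(2) kernel_bounds(1)] cv_bound(2)[OF H_cont f T assms(2) kernel_bounds(2)]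
  by auto

lemma cv_linear:
  assumes f: "square_integrable (time_interval T) f" and g: "square_integrable (time_interval T) g"
    and \<xi>: "\<xi> \<le> 2 * T"
  shows "cv T G (\<lambda>t. p * f t + q * g t) \<xi> y = p * cv T G f \<xi> y + q * cv T G g \<xi> y"
    and "cv T H (\<lambda>t. p * f t + q * g t) \<xi> y = p * cv T H f \<xi> y + q * cv T H g \<xi> y"
proof -
  have lin: "cv T k (\<lambda>t. p * f t + q * g t) \<xi> y = p * cv T k f \<xi> y + q * cv T k g \<xi> y"
    if k: "cont2 k" and M: "\<And>s. 0 \<le> s \<Longrightarrow> s \<le> 2 * T \<Longrightarrow> \<bar>k s y\<bar> \<le> M T" for k
  proof -
    note i = cv_bound(1)[OF k f T \<xi> M] cv_bound(1)[OF k g T \<xi> M]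
    have "(\<lambda>\<sigma>. indicator {..\<xi>} \<sigma> * k (\<xi> - \<sigma>) y * (p * f \<sigma> + q * g \<sigma>))
        = (\<lambda>\<sigma>. p * (indicator {..\<xi>} \<sigma> * k (\<xi> - \<sigma>) y * f \<sigma>) + q * (indicator {..\<xi>} \<sigma> * k (\<xi> - \<sigma>) y * g \<sigma>))"
      by (simp add: fun_eq_iff algebra_simps)
    then show ?thesis
      unfolding cv_def using i by simp
  qed
  show "cv T G (\<lambda>t. p * f t + q * g t) \<xi> y = p * cv T G f \<xi> y + q * cv T G g \<xi> y"
    "cv T H (\<lambda>t. p * f t + q * g t) \<xi> y = p * cv T H f \<xi> y + q * cv T H g \<xi> y"
    by (rule lin[OF G_cont kernel_bounds(1)] lin[OF H_cont kernel_bounds(2)]; assumption)+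
qed

lemma P_linear:
  assumes f: "square_integrable (time_interval T) f" and g: "square_integrable (time_interval T) g"
    and \<xi>: "\<xi> \<le> 2 * T"
  shows "P T (\<lambda>t. p * f t + q * g t) \<xi> y = p * P T f \<xi> y + q * P T g \<xi> y"
    and "Q T (\<lambda>t. p * f t + q * g t) \<xi> y = p * Q T f \<xi> y + q * Q T g \<xi> y"
  unfolding P_def Q_def cv_linear[OF assms] by (simp_all add: zero_ext_def field_simps)

lemma f_measurable: "square_integrable (time_interval T) f \<Longrightarrow> f \<in> borel_measurable (time_interval T)"
  by (simp add: square_integrable_def)

lemma P_measurable:
  assumes f: "square_integrable (time_interval T) f"
  shows "(\<lambda>p. P T f (fst p) (snd p)) \<in> borel_measurable borel" "(\<lambda>p. Q T f (fst p) (snd p)) \<in> borel_measurable borel"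
proof -
  have [measurable]: "(\<lambda>p::real\<times>real. zero_ext T f (fst p)) \<in> borel_measurable borel"
    by (rule measurable_compose[OF _ zero_ext_measurable[OF f_measurable[OF f]]])
       (intro borel_measurable_continuous_onI continuous_intros)
  note cv_measurable[OF G_cont f_measurable[OF f], measurable] cv_measurable[OF H_cont f_measurable[OF f], measurable]
  show "(\<lambda>p. P T f (fst p) (snd p)) \<in> borel_measurable borel" "(\<lambda>p. Q T f (fst p) (snd p)) \<in> borel_measurable borel"
    unfolding P_def Q_def by measurable
qed

lemma P_section:
  assumes f: "square_integrable (time_interval T) f"
  shows "(\<lambda>\<xi>. P T f \<xi> y) \<in> borel_measurable (time_interval T)"
proof -
  have "(\<lambda>\<xi>::real. (\<xi>, y)) \<in> borel_measurable borel"
    by (intro borel_measurable_continuous_onI continuous_intros)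
  from measurable_compose[OF this P_measurable(1)[OF f]] show ?thesis
    unfolding time_interval_def by (intro measurable_restrict_space1) simp
qed

lemma P_bound:
  assumes f: "square_integrable (time_interval T) f" and "\<xi> \<le> 2 * T"
  shows "\<bar>P T f \<xi> y + zero_ext T f \<xi>\<bar> \<le> M T * (sqrt (2 * T) * nrm f)"
    and "\<bar>Q T f \<xi> y - zero_ext T f \<xi>\<bar> \<le> M T * (sqrt (2 * T) * nrm f)"
proof -
  have "\<bar>- z + (g + h) / 2 + z\<bar> \<le> N \<and> \<bar>z + (g - h) / 2 - z\<bar> \<le> N" if "\<bar>g\<bar> \<le> N" "\<bar>h\<bar> \<le> N"
    for z g h N :: real using that by (auto simp: abs_le_iff)
  from this[OF cv_kernel[OF assms]]
  show "\<bar>P T f \<xi> y + zero_ext T f \<xi>\<bar> \<le> M T * (sqrt (2 * T) * nrm f)"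
    "\<bar>Q T f \<xi> y - zero_ext T f \<xi>\<bar> \<le> M T * (sqrt (2 * T) * nrm f)"
    unfolding P_def Q_def by blast+
qed

lemma P_square:
  assumes f: "square_integrable (time_interval T) f" and "\<xi> \<le> 2 * T"
  shows "(P T f \<xi> y)\<^sup>2 \<le> 2 * (zero_ext T f \<xi>)\<^sup>2 + 2 * ((M T)\<^sup>2 * (2 * T) * (nrm f)\<^sup>2)"
    and "(Q T f \<xi> y)\<^sup>2 \<le> 2 * (zero_ext T f \<xi>)\<^sup>2 + 2 * ((M T)\<^sup>2 * (2 * T) * (nrm f)\<^sup>2)"
proof -
  define N where "N = M T * (sqrt (2 * T) * nrm f)"
  have N: "N\<^sup>2 = (M T)\<^sup>2 * (2 * T) * (nrm f)\<^sup>2"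
    using T by (simp add: N_def power_mult_distrib)
  have sq: "x\<^sup>2 \<le> N\<^sup>2" if "\<bar>x\<bar> \<le> N" for x :: real
    using that by (metis abs_ge_zero power2_abs power_mono)
  show "(P T f \<xi> y)\<^sup>2 \<le> 2 * (zero_ext T f \<xi>)\<^sup>2 + 2 * ((M T)\<^sup>2 * (2 * T) * (nrm f)\<^sup>2)"
    using square_add_le[of "- zero_ext T f \<xi>" "P T f \<xi> y + zero_ext T f \<xi>"] sq[of "P T f \<xi> y + zero_ext T f \<xi>"]
      P_bound(1)[OF assms, of y] unfolding N[symmetric] N_def[symmetric] by simp
  show "(Q T f \<xi> y)\<^sup>2 \<le> 2 * (zero_ext T f \<xi>)\<^sup>2 + 2 * ((M T)\<^sup>2 * (2 * T) * (nrm f)\<^sup>2)"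
    using square_add_le[of "zero_ext T f \<xi>" "Q T f \<xi> y - zero_ext T f \<xi>"] sq[of "Q T f \<xi> y - zero_ext T f \<xi>"]
      P_bound(2)[OF assms, of y] unfolding N[symmetric] N_def[symmetric] by simp
qed

lemma P_nonpos: "\<xi> \<le> 0 \<Longrightarrow> P T f \<xi> y = 0" "\<xi> \<le> 0 \<Longrightarrow> Q T f \<xi> y = 0"
  by (simp_all add: P_def Q_def cv_nonpos zero_ext_def)

lemma P_square_integrable:
  assumes f: "square_integrable (time_interval T) f"
  shows "square_integrable (time_interval T) (\<lambda>\<xi>. P T f \<xi> y)"
proof -
  interpret finite_measure "time_interval T" by (rule finite_measure_time_interval)
  have "integrable (time_interval T) (\<lambda>\<xi>. (P T f \<xi> y)\<^sup>2)"
  proof (rule Bochner_Integration.integrable_bound)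
    show "integrable (time_interval T) (\<lambda>\<xi>. 2 * (f \<xi>)\<^sup>2 + 2 * ((M T)\<^sup>2 * (2 * T) * (nrm f)\<^sup>2))"
      using f by (simp add: square_integrable_def)
    show "AE \<xi> in time_interval T. norm ((P T f \<xi> y)\<^sup>2) \<le> norm (2 * (f \<xi>)\<^sup>2 + 2 * ((M T)\<^sup>2 * (2 * T) * (nrm f)\<^sup>2))"
    proof (rule AE_I2)
      fix \<xi> assume "\<xi> \<in> space (time_interval T)"
      then have "\<xi> \<le> 2 * T" "zero_ext T f \<xi> = f \<xi>" by (auto simp: zero_ext_def)
      with P_square(1)[OF f, of \<xi> y]
      have "(P T f \<xi> y)\<^sup>2 \<le> 2 * (f \<xi>)\<^sup>2 + 2 * ((M T)\<^sup>2 * (2 * T) * (nrm f)\<^sup>2)" by simp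
      then show "norm ((P T f \<xi> y)\<^sup>2) \<le> norm (2 * (f \<xi>)\<^sup>2 + 2 * ((M T)\<^sup>2 * (2 * T) * (nrm f)\<^sup>2))"
        unfolding real_norm_def using zero_le_power2[of "P T f \<xi> y"] by linarith
    qed
  qed (use P_section[OF f] in measurable)
  then show ?thesis using P_section[OF f] by (simp add: square_integrable_def)
qed

text \<open>The convolution part of \<open>P\<close> is at most M sqrt (2T) times the norm of the
  data; integrating its square over time gives the second factor 2T, and
  \<open>square_add_le\<close> the factor 2.\<close>

definition K where "K = 2 * (1 + (M T)\<^sup>2 * (2 * T) * (2 * T))"

lemma P_norm:
  assumes f: "square_integrable (time_interval T) f"
  shows "(LINT \<xi>|time_interval T. (P T f \<xi> y)\<^sup>2) \<le> K * (nrm f)\<^sup>2"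
proof -
  have n: "(nrm f)\<^sup>2 = (LINT t|time_interval T. (f t)\<^sup>2)" by simp
  have t: "(LINT t|time_interval T. c) = 2 * T * c" for c :: real
    using T by (subst time_interval_integral) auto
  interpret finite_measure "time_interval T" by (rule finite_measure_time_interval)
  have "(LINT \<xi>|time_interval T. (P T f \<xi> y)\<^sup>2)
      \<le> (LINT \<xi>|time_interval T. 2 * (f \<xi>)\<^sup>2 + 2 * ((M T)\<^sup>2 * (2 * T) * (nrm f)\<^sup>2))"
  proof (rule integral_mono)
    fix \<xi> assume "\<xi> \<in> space (time_interval T)"
    then have "\<xi> \<le> 2 * T" "zero_ext T f \<xi> = f \<xi>" by (auto simp: zero_ext_def)
    with P_square(1)[OF f, of \<xi> y]
    show "(P T f \<xi> y)\<^sup>2 \<le> 2 * (f \<xi>)\<^sup>2 + 2 * ((M T)\<^sup>2 * (2 * T) * (nrm f)\<^sup>2)" by simp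
  qed (use f P_square_integrable[OF f] in \<open>auto simp: square_integrable_def\<close>)
  also have "\<dots> = 2 * (nrm f)\<^sup>2 + 2 * T * (2 * ((M T)\<^sup>2 * (2 * T) * (nrm f)\<^sup>2))"
  proof -
    have "measure (time_interval T) {0<..<2 * T} = 2 * T" using t[of 1] by simp
    then show ?thesis
      using f unfolding n by (subst Bochner_Integration.integral_add) (auto simp: square_integrable_def)
  qed
  also have "\<dots> = K * (nrm f)\<^sup>2" by (simp add: K_def algebra_simps)
  finally show ?thesis .
qed

lemma prim_P_linear:
  assumes f: "square_integrable (time_interval T) f" and g: "square_integrable (time_interval T) g"
  shows "prim_P T (\<lambda>t. p * f t + q * g t) s y = p * prim_P T f s y + q * prim_P T g s y"
proof -
  have i: "integrable (time_interval T) (\<lambda>\<xi>. indicator {..s} \<xi> * P T f \<xi> y)" if f: "square_integrable (time_interval T) f" for f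
  proof (rule time_abs_integral_le(1)[OF P_square_integrable[OF f] _ _ T])
    show "indicator {..s} \<in> borel_measurable (time_interval T)"
      unfolding time_interval_def by (intro measurable_restrict_space1) simp
    show "\<bar>indicator {..s} t\<bar> \<le> (1::real)" for t :: real by (simp add: indicator_def)
  qed
  have "prim_P T (\<lambda>t. p * f t + q * g t) s y
      = (LINT \<xi>|time_interval T. p * (indicator {..s} \<xi> * P T f \<xi> y) + q * (indicator {..s} \<xi> * P T g \<xi> y))"
    unfolding prim_P_def
    by (rule Bochner_Integration.integral_cong) (auto simp: P_linear[OF f g] algebra_simps)
  then show ?thesis using i[OF f] i[OF g] by (simp add: prim_P_def)
qed

lemma prim_P_bound:
  assumes f: "square_integrable (time_interval T) f"
  shows "(prim_P T f s y)\<^sup>2 \<le> 2 * T * (K * (nrm f)\<^sup>2)"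
proof -
  have "\<bar>prim_P T f s y\<bar> \<le> 1 * (sqrt (2 * T) * sqrt (LINT \<xi>|time_interval T. (P T f \<xi> y)\<^sup>2))"
    unfolding prim_P_def
  proof (rule time_abs_integral_le(2)[OF P_square_integrable[OF f] _ _ T])
    show "indicator {..s} \<in> borel_measurable (time_interval T)"
      unfolding time_interval_def by (intro measurable_restrict_space1) simp
    show "\<bar>indicator {..s} t\<bar> \<le> (1::real)" for t :: real by (simp add: indicator_def)
  qed
  then have "\<bar>prim_P T f s y\<bar>\<^sup>2 \<le> (sqrt (2 * T) * sqrt (LINT \<xi>|time_interval T. (P T f \<xi> y)\<^sup>2))\<^sup>2"
    by (intro power_mono) auto
  also have "\<dots> = 2 * T * (LINT \<xi>|time_interval T. (P T f \<xi> y)\<^sup>2)"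
    using T by (simp add: power_mult_distrib)
  also have "\<dots> \<le> 2 * T * (K * (nrm f)\<^sup>2)"
    using P_norm[OF f] T by (intro mult_left_mono) auto
  finally show ?thesis by simp
qed

lemma prim_P_nonpos: "s \<le> 0 \<Longrightarrow> prim_P T f s y = 0"
  unfolding prim_P_def
  by (subst Bochner_Integration.integral_cong[where g = "\<lambda>_. 0"]) (auto simp: indicator_def)

lemma prim_P_measurable:
  assumes f: "square_integrable (time_interval T) f"
  shows "(\<lambda>p. prim_P T f (fst p) (snd p)) \<in> borel_measurable borel"
proof -
  have "(\<lambda>q :: (real \<times> real) \<times> real. (snd q, snd (fst q))) \<in> borel_measurable borel"
    by (intro borel_measurable_continuous_onI continuous_intros)
  from measurable_compose[OF this P_measurable(1)[OF f]]
  have "(\<lambda>q :: (real \<times> real) \<times> real. P T f (snd q) (snd (fst q))) \<in> borel_measurable (borel \<Otimes>\<^sub>M borel)"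
    by (simp add: borel_prod)
  from param_time_integral_measurable[OF this, of "\<lambda>_. 1"] show ?thesis
    by (simp add: prim_P_def)
qed

lemma \<theta>_pair_measurable:
  assumes "(\<lambda>p. h (fst p) (snd p)) \<in> borel_measurable borel"
  shows "(\<lambda>z. h (fst z - \<theta> (snd z)) (\<theta> (snd z)) :: real) \<in> borel_measurable borel"
proof -
  have "(\<lambda>z :: real \<times> real. (fst z - \<theta> (snd z), \<theta> (snd z))) \<in> borel_measurable borel"
    by (intro borel_measurable_continuous_onI continuous_intros \<theta>_cont_on)
  from measurable_compose[OF this assms] show ?thesis by simp
qed

definition R where "R = X (2 * T)"

lemma R: "0 \<le> R" "R < x \<Longrightarrow> 2 * T < \<theta> x"
  using X_mono[of 0 "2 * T"] T \<theta>_less[of R x] by (auto simp: R_def)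

lemma strip_bounds:
  obtains C where "0 \<le> C"
    "\<And>f. square_integrable (time_interval T) f \<Longrightarrow> square_integrable (strip T) (v T f) \<and>
        (LINT z|strip T. (v T f z)\<^sup>2) \<le> C * (LINT t|time_interval T. (f t)\<^sup>2)"
    "\<And>f. square_integrable (time_interval T) f \<Longrightarrow> square_integrable (strip T) (vt T f) \<and>
        (LINT z|strip T. (vt T f z)\<^sup>2) \<le> C * (LINT t|time_interval T. (f t)\<^sup>2)"
    "\<And>f. square_integrable (time_interval T) f \<Longrightarrow> square_integrable (strip T) (vx T f) \<and>
        (LINT z|strip T. (vx T f z)\<^sup>2) \<le> C * (LINT t|time_interval T. (f t)\<^sup>2)"
proof -
  define N where "N = (M T)\<^sup>2 * (2 * T)"
  have N: "0 \<le> N" using T by (simp add: N_def)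
  have K0: "0 \<le> K" using T by (simp add: K_def)
  define D where "D = max C1 (1 / C0)"
  have D: "0 \<le> D" "C1 \<le> D" "1 / C0 \<le> D" using C1_pos by (auto simp: D_def)
  \<comment> \<open>The first entry serves \<open>v\<close>, which is bounded pointwise; the second
    serves \<open>vt\<close> and \<open>vx\<close>, which also contain the shifted data.\<close>
  define C where "C = max (R * (D * (2 * T * K) * (2 * T))) (R * (2 * D + D * (2 * N) * (2 * T)))"
  have nn: "(nrm f)\<^sup>2 = (LINT t|time_interval T. (f t)\<^sup>2)" for f by simp
  \<comment> \<open>All three functions are an amplitude in x, bounded through C0 and C1, times a
    function of the characteristic coordinates that vanishes ahead of the front.\<close>
  have main: "square_integrable (strip T) w \<and> (LINT z|strip T. (w z)\<^sup>2) \<le> C * (LINT t|time_interval T. (f t)\<^sup>2)"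
    if f: "square_integrable (time_interval T) f" and w: "w = (\<lambda>z. k (snd z) * h (fst z - \<theta> (snd z)) (\<theta> (snd z)))"
      and k: "continuous_on UNIV k" "\<And>x. (k x)\<^sup>2 \<le> D"
      and h: "(\<lambda>p. h (fst p) (snd p)) \<in> borel_measurable borel" "\<And>\<xi> y. \<xi> \<le> 0 \<Longrightarrow> h \<xi> y = 0"
      and le: "\<And>\<xi> y. \<xi> \<le> 2 * T \<Longrightarrow> (h \<xi> y)\<^sup>2 \<le> p * (zero_ext T f \<xi>)\<^sup>2 + q * (nrm f)\<^sup>2" "0 \<le> p" "0 \<le> q"
      and C: "R * (D * p + D * q * (2 * T)) \<le> C" for f w k and h :: "real \<Rightarrow> real \<Rightarrow> real" and p q
  proof -
    have m: "w \<in> borel_measurable borel"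
      unfolding w by (intro borel_measurable_times \<theta>_pair_measurable h borel_measurable_continuous_onI
        cont2_compose1[OF k(1)] continuous_intros)
    have z: "w (t, x) = 0" if "t < 2 * T" "R < x" for t x
      using R(2)[OF that(2)] that(1) by (simp add: w h)
    have l: "(w (t, x))\<^sup>2 \<le> D * p * (zero_ext T f (t - \<theta> x))\<^sup>2 + D * q * (nrm f)\<^sup>2" if "0 < t" "t < 2 * T" "0 < x" for t x
    proof -
      have "t - \<theta> x \<le> 2 * T" using \<theta>_nonneg[of x] that by simp
      then have "(w (t, x))\<^sup>2 \<le> D * (p * (zero_ext T f (t - \<theta> x))\<^sup>2 + q * (nrm f)\<^sup>2)"
        unfolding w fst_conv snd_conv power_mult_distrib using k(2) le(1) D by (intro mult_mono) auto
      then show ?thesis by (simp add: algebra_simps)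
    qed
    have nonneg: "0 \<le> D * p" "0 \<le> D * q * (nrm f)\<^sup>2" using D le(2,3) by auto
    note sb = strip_shift_bound[OF f m \<theta>_cont_on[OF continuous_on_id] nonneg R(1) less_imp_le[OF T] l z]
    have "(LINT z|strip T. (w z)\<^sup>2) \<le> R * (D * p * (nrm f)\<^sup>2 + D * q * (nrm f)\<^sup>2 * (2 * T))"
      using sb(2) unfolding nn by simp
    also have "\<dots> = R * (D * p + D * q * (2 * T)) * (nrm f)\<^sup>2" by (simp add: algebra_simps)
    also have "\<dots> \<le> C * (nrm f)\<^sup>2" using C by (intro mult_right_mono) auto
    finally show ?thesis using sb(1) by (simp only: nn)
  qed
  have kc: "continuous_on UNIV (\<lambda>x. \<kappa> (\<theta> x))" "continuous_on UNIV (\<lambda>x. 1 / \<kappa> (\<theta> x))"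
    by (intro continuous_intros \<kappa>_cont_on \<theta>_cont_on; simp add: less_imp_neq[OF \<kappa>_pos, symmetric])+
  have kb: "(\<kappa> (\<theta> x))\<^sup>2 \<le> D" "(1 / \<kappa> (\<theta> x))\<^sup>2 \<le> D" for x
    using \<kappa>_bounds[of x] D by (auto simp: power_divide)
  show ?thesis
  proof (rule that[of C])
    have "0 \<le> R * (D * (2 * T * K) * (2 * T))"
      using R D T K0 by (intro mult_nonneg_nonneg) auto
    then show "0 \<le> C" unfolding C_def by (rule max.coboundedI1)
    fix f assume f: "square_integrable (time_interval T) f"
    show "square_integrable (strip T) (v T f) \<and> (LINT z|strip T. (v T f z)\<^sup>2) \<le> C * (LINT t|time_interval T. (f t)\<^sup>2)"
      using prim_P_bound[OF f] T K0
      by (intro main[OF f _ kc(1) kb(1) prim_P_measurable[OF f] prim_P_nonpos, of "v T f" 0 "2 * T * K"])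
        (auto simp: v_def fun_eq_iff C_def algebra_simps)
    show "square_integrable (strip T) (vt T f) \<and> (LINT z|strip T. (vt T f z)\<^sup>2) \<le> C * (LINT t|time_interval T. (f t)\<^sup>2)"
      using P_square(1)[OF f] N
      by (intro main[OF f _ kc(1) kb(1) P_measurable(1)[OF f] P_nonpos(1), of "vt T f" 2 "2 * N"])
        (auto simp: vt_def fun_eq_iff C_def N_def algebra_simps)
    show "square_integrable (strip T) (vx T f) \<and> (LINT z|strip T. (vx T f z)\<^sup>2) \<le> C * (LINT t|time_interval T. (f t)\<^sup>2)"
      using P_square(2)[OF f] N
      by (intro main[OF f _ kc(2) kb(2) P_measurable(2)[OF f] P_nonpos(2), of "vx T f" 2 "2 * N"])
        (auto simp: vx_def fun_eq_iff C_def N_def algebra_simps)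
  qed
qed

end

end

section \<open>The Neumann-to-Dirichlet operator\<close>

text \<open>A null set of depths sweeps out a null cylinder in space-time.\<close>

lemma AE_halfline_strip:
  assumes "AE x in halfline. P x"
  shows "AE z in strip T. P (snd z)"
proof -
  have h: "{0..} \<inter> space lborel \<in> sets (lborel :: real measure)" by simp
  have s: "({0<..<2 * T} \<times> {0<..}) \<inter> space lborel \<in> sets (lborel :: (real \<times> real) measure)"
    using strip_borel by simp
  have "AE x in lborel. x \<in> {0..} \<longrightarrow> P x"
    using assms unfolding halfline_def AE_restrict_space_iff[OF h] .
  then obtain N where N: "N \<in> null_sets lborel" "{x \<in> space lborel. \<not> (x \<in> {0..} \<longrightarrow> P x)} \<subseteq> N"
    unfolding eventually_ae_filter by blast
  have [measurable]: "N \<in> sets borel" using N(1) by auto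
  have "emeasure (lborel \<Otimes>\<^sub>M lborel) ((UNIV :: real set) \<times> N) = emeasure lborel (UNIV :: real set) * emeasure lborel N"
    by (rule lborel.emeasure_pair_measure_Times) auto
  also have "\<dots> = 0" using N(1) by auto
  finally have "(UNIV :: real set) \<times> N \<in> null_sets lborel"
    by (intro null_setsI) (auto simp: lborel_prod[symmetric])
  then have "AE z in lborel. z \<notin> (UNIV :: real set) \<times> N" by (rule AE_not_in)
  then have "AE z in lborel. z \<in> {0<..<2 * T} \<times> {0<..} \<longrightarrow> P (snd z)"
    by eventually_elim (use N(2) in auto)
  then show ?thesis unfolding strip_def AE_restrict_space_iff[OF s] .
qed

lemma snd_measurable_strip: "snd \<in> strip T \<rightarrow>\<^sub>M halfline"
  unfolding halfline_def
proof (rule measurable_restrict_space2)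
  show "snd \<in> space (strip T) \<rightarrow> {0..}"
    by (auto simp: strip_def space_restrict_space)
  have "snd \<in> borel_measurable (strip T)"
    unfolding strip_def by (rule continuous_measurable_restrict) (intro continuous_intros)
  then show "snd \<in> strip T \<rightarrow>\<^sub>M lborel" by simp
qed

text \<open>\<open>nd_map\<close> works with a chosen representative of the class, which agrees with
  the continuous speed only almost everywhere.\<close>

lemma wave_solution_cong:
  assumes c: "c \<in> borel_measurable halfline" "d \<in> borel_measurable halfline" and eq: "AE x in halfline. c x = d x"
  shows "wave_solution T c f u ut ux = wave_solution T d f u ut ux"
proof -
  have "(LINT z|strip T. ux z * part_x \<phi> z - ut z * part_t \<phi> z / (c (snd z))\<^sup>2)
      = (LINT z|strip T. ux z * part_x \<phi> z - ut z * part_t \<phi> z / (d (snd z))\<^sup>2)"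
    if H: "H1_strip T u ut ux" and \<phi>: "\<phi> \<in> C1_test ({..<2 * T} \<times> UNIV)" for \<phi>
  proof (rule integral_cong_AE)
    have [measurable]: "ux \<in> borel_measurable (strip T)" "ut \<in> borel_measurable (strip T)"
      using H by (auto simp: H1_strip_def square_integrable_def)
    have [measurable]: "part_x \<phi> \<in> borel_measurable (strip T)" "part_t \<phi> \<in> borel_measurable (strip T)"
      using C1_test_strip[OF \<phi>, of T] by (auto simp: square_integrable_def)
    have [measurable]: "(\<lambda>z. c (snd z)) \<in> borel_measurable (strip T)" "(\<lambda>z. d (snd z)) \<in> borel_measurable (strip T)"
      using measurable_compose[OF snd_measurable_strip c(1)] measurable_compose[OF snd_measurable_strip c(2)] by auto
    show "(\<lambda>z. ux z * part_x \<phi> z - ut z * part_t \<phi> z / (c (snd z))\<^sup>2) \<in> borel_measurable (strip T)"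
      "(\<lambda>z. ux z * part_x \<phi> z - ut z * part_t \<phi> z / (d (snd z))\<^sup>2) \<in> borel_measurable (strip T)"
      by measurable
    show "AE z in strip T. ux z * part_x \<phi> z - ut z * part_t \<phi> z / (c (snd z))\<^sup>2
        = ux z * part_x \<phi> z - ut z * part_t \<phi> z / (d (snd z))\<^sup>2"
      using AE_halfline_strip[OF eq] by eventually_elim simp
  qed
  then show ?thesis unfolding wave_solution_def by auto
qed

context speed
begin

context
  fixes T :: real
  assumes T: "0 < T"
begin

lemma regular_input_zero_ext:
  assumes "regular_input T \<delta> f f'"
  shows "zero_ext T f = f"
proof
  fix t
  have "f t = 0" if "t \<notin> {0<..<2 * T}"
  proof -
    have "t \<le> 2 * \<delta> \<or> 2 * T - 2 * \<delta> \<le> t" using that assms by (auto simp: regular_input_def)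
    then show ?thesis using assms by (auto simp: regular_input_def)
  qed
  then show "zero_ext T f t = f t" by (auto simp: zero_ext_def indicator_def)
qed

lemma regular_P:
  assumes f: "regular_input T \<delta> f f'" and \<xi>: "\<xi> \<le> 2 * T"
  shows "P T f \<xi> y = (Z f \<xi> y + Wm f \<xi> y) / 2" "Q T f \<xi> y = (Z f \<xi> y - Wm f \<xi> y) / 2"
  unfolding P_def Q_def regular_input_zero_ext[OF f] cv_eq_conv[OF regular_inputD(1)[OF f] G_cont \<xi>]
    cv_eq_conv[OF regular_inputD(1)[OF f] H_cont \<xi>] Z_def[symmetric] Wm_conv[OF regular_inputD(1)[OF f]]
  by (simp_all add: field_simps)

text \<open>On regular data the formulas for square integrable data reproduce the classical
  solution; this is the starting point of the density argument.\<close>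

lemma regular_v:
  assumes f: "regular_input T \<delta> f f'" and "t \<le> 2 * T" "0 \<le> x"
  shows "v T f (t, x) = u f t x" "vt T f (t, x) = ut f t x" "vx T f (t, x) = ux f t x"
proof -
  note F = regular_inputD[OF f]
  have s: "t - \<theta> x \<le> 2 * T" using \<theta>_nonneg[of x] assms by simp
  have pr: "prim_P T f s y = prim (\<lambda>\<xi>. (Z f \<xi> y + Wm f \<xi> y) / 2) (max 0 s)" if "s \<le> 2 * T" for s y
  proof -
    have c: "continuous_on UNIV (\<lambda>\<xi>. (Z f \<xi> y + Wm f \<xi> y) / 2)"
      by (intro continuous_intros cont2_section(2)[OF Z_cont[OF F(1)]] cont2_section(2)[OF Wm_cont[OF F(1)]]) auto
    have "prim_P T f s y = (LINT \<xi>|time_interval T. indicator {..s} \<xi> * ((Z f \<xi> y + Wm f \<xi> y) / 2))"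
      unfolding prim_P_def by (rule Bochner_Integration.integral_cong) (auto simp: regular_P[OF f])
    then show ?thesis using time_integral_upto[OF c that] by simp
  qed
  show "v T f (t, x) = u f t x"
  proof (cases "0 \<le> t - \<theta> x")
    case True
    have "prim (\<lambda>\<xi>. (Z f \<xi> y + Wm f \<xi> y) / 2) s = prim (\<lambda>\<xi>. Z f \<xi> y + Wm f \<xi> y) s / 2" for s y
      using prim_cmult[of "1 / 2" "\<lambda>\<xi>. Z f \<xi> y + Wm f \<xi> y" s] by simp
    with True show ?thesis by (simp add: v_def pr[OF s] u_def U_def)
  next
    case False
    then have "U f (t - \<theta> x) (\<theta> x) = 0"
      using F(4,5) by (intro U_causal[OF F(1), of 0]) auto
    with False show ?thesis by (simp add: v_def u_def prim_P_nonpos[OF T])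
  qed
  show "vt T f (t, x) = ut f t x" "vx T f (t, x) = ux f t x"
    by (simp_all add: vt_def vx_def ut_def ux_def regular_P[OF f s])
qed

lemma v_diff:
  assumes f: "square_integrable (time_interval T) f" and g: "square_integrable (time_interval T) g" and z: "z \<in> space (strip T)"
  shows "v T (\<lambda>t. f t - g t) z = v T f z - v T g z" "vt T (\<lambda>t. f t - g t) z = vt T f z - vt T g z"
    "vx T (\<lambda>t. f t - g t) z = vx T f z - vx T g z"
proof -
  have s: "fst z - \<theta> (snd z) \<le> 2 * T"
    using z \<theta>_nonneg[of "snd z"] by (auto simp: strip_def space_restrict_space)
  show "v T (\<lambda>t. f t - g t) z = v T f z - v T g z" "vt T (\<lambda>t. f t - g t) z = vt T f z - vt T g z"
    "vx T (\<lambda>t. f t - g t) z = vx T f z - vx T g z"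
    using prim_P_linear[OF T f g, of 1 "-1"] P_linear[OF T f g s, of 1 "-1"]
    by (simp_all add: v_def vt_def vx_def right_diff_distrib diff_divide_distrib)
qed

lemma \<Lambda>_linear:
  assumes f: "square_integrable (time_interval T) f" and g: "square_integrable (time_interval T) g"
  shows "\<Lambda> T (\<lambda>t. p * f t + q * g t) t = p * \<Lambda> T f t + q * \<Lambda> T g t"
  unfolding \<Lambda>_def by (rule prim_P_linear[OF T f g])

lemma \<Lambda>_bound:
  assumes f: "square_integrable (time_interval T) f"
  shows "(\<Lambda> T f t)\<^sup>2 \<le> 2 * T * (K T * (LINT t|time_interval T. (f t)\<^sup>2))"
  using prim_P_bound[OF T f, of t 0] by (simp add: \<Lambda>_def)

lemma K_nonneg: "0 \<le> K T"
  using T by (simp add: K_def[OF T])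

lemma \<Lambda>_norm:
  assumes f: "square_integrable (time_interval T) f"
  shows "square_integrable (time_interval T) (\<Lambda> T f)"
    "(LINT t|time_interval T. (\<Lambda> T f t)\<^sup>2) \<le> 2 * T * (2 * T * K T) * (LINT t|time_interval T. (f t)\<^sup>2)"
proof -
  interpret finite_measure "time_interval T" by (rule finite_measure_time_interval)
  have "(\<lambda>t::real. (t, 0::real)) \<in> borel_measurable borel"
    by (intro borel_measurable_continuous_onI continuous_intros)
  from measurable_compose[OF this prim_P_measurable[OF T f]]
  have m: "\<Lambda> T f \<in> borel_measurable (time_interval T)"
    unfolding time_interval_def \<Lambda>_def[abs_def] by (intro measurable_restrict_space1) simp
  define N where "N = 2 * T * (K T * (LINT t|time_interval T. (f t)\<^sup>2))"
  have b: "(\<Lambda> T f t)\<^sup>2 \<le> N" for t unfolding N_def by (rule \<Lambda>_bound[OF f])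
  have i: "integrable (time_interval T) (\<lambda>t. (\<Lambda> T f t)\<^sup>2)"
    by (rule integrable_const_bound[where B = N]) (use m b in auto)
  with m show "square_integrable (time_interval T) (\<Lambda> T f)" by (simp add: square_integrable_def)
  have "(LINT t|time_interval T. (\<Lambda> T f t)\<^sup>2) \<le> (LINT t|time_interval T. N)"
    by (rule integral_mono[OF i]) (use b in auto)
  also have "\<dots> = 2 * T * N"
    using T by (subst time_interval_integral) auto
  finally show "(LINT t|time_interval T. (\<Lambda> T f t)\<^sup>2) \<le> 2 * T * (2 * T * K T) * (LINT t|time_interval T. (f t)\<^sup>2)"
    by (simp add: N_def mult_ac)
qed

text \<open>Data to solution and data to trace are bounded linear maps in L2, so regular data
  tending to \<open>f\<close> give convergence of the solutions with both derivatives and of the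
  traces. The same approximants \<open>w n\<close> serve for the Sobolev property, both traces and
  the limit in the weak equation.\<close>

lemma solution_exists:
  assumes f: "square_integrable (time_interval T) f"
  shows "wave_solution T c f (v T f) (vt T f) (vx T f)"
    and "has_trace T (v T f) (vt T f) (vx T f) (time_interval T) (\<lambda>t. (t, 0)) (\<Lambda> T f)"
proof -
  obtain \<delta> g g' where g: "\<And>n. regular_input T (\<delta> n) (g n) (g' n)" and gf: "L2_tendsto (time_interval T) g f"
    using regular_inputs_dense[OF f T] by blast
  have "\<exists>w. w \<in> C1_test ({0<..} \<times> UNIV) \<and>
    (\<forall>t x. 0 \<le> x \<longrightarrow> t \<le> 2 * T \<longrightarrow> w (t, x) = u (g n) t x \<and> part_t w (t, x) = ut (g n) t x \<and> part_x w (t, x) = ux (g n) t x)" for n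
    by (rule approximant[OF g[of n]]) blast
  then obtain w where w: "\<And>n. w n \<in> C1_test ({0<..} \<times> UNIV)"
    "\<And>n t x. 0 \<le> x \<Longrightarrow> t \<le> 2 * T \<Longrightarrow> w n (t, x) = u (g n) t x \<and> part_t (w n) (t, x) = ut (g n) t x \<and> part_x (w n) (t, x) = ux (g n) t x"
    by metis
  have w1: "w n \<in> C1_test UNIV" for n
    using w(1)[of n] unfolding C1_test_def by blast
  have eq: "w n z = v T (g n) z" "part_t (w n) z = vt T (g n) z" "part_x (w n) z = vx T (g n) z"
    if "z \<in> space (strip T)" for n z
    using that w(2)[of "snd z" "fst z" n] regular_v[OF g[of n], of "fst z" "snd z"]
    by (auto simp: strip_def space_restrict_space)
  obtain C where C: "0 \<le> C"
    "\<And>f. square_integrable (time_interval T) f \<Longrightarrow> square_integrable (strip T) (v T f) \<and>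
        (LINT z|strip T. (v T f z)\<^sup>2) \<le> C * (LINT t|time_interval T. (f t)\<^sup>2)"
    "\<And>f. square_integrable (time_interval T) f \<Longrightarrow> square_integrable (strip T) (vt T f) \<and>
        (LINT z|strip T. (vt T f z)\<^sup>2) \<le> C * (LINT t|time_interval T. (f t)\<^sup>2)"
    "\<And>f. square_integrable (time_interval T) f \<Longrightarrow> square_integrable (strip T) (vx T f) \<and>
        (LINT z|strip T. (vx T f z)\<^sup>2) \<le> C * (LINT t|time_interval T. (f t)\<^sup>2)"
    using strip_bounds[OF T] by blast
  have lv: "L2_tendsto (strip T) (\<lambda>n. v T (g n)) (v T f)"
    by (rule L2_tendsto_bounded_linear[OF gf C(1,2)]) (simp_all add: v_diff)
  have lvt: "L2_tendsto (strip T) (\<lambda>n. vt T (g n)) (vt T f)"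
    by (rule L2_tendsto_bounded_linear[OF gf C(1,3)]) (simp_all add: v_diff)
  have lvx: "L2_tendsto (strip T) (\<lambda>n. vx T (g n)) (vx T f)"
    by (rule L2_tendsto_bounded_linear[OF gf C(1,4)]) (simp_all add: v_diff)
  have conv: "L2_tendsto (strip T) w (v T f)" "L2_tendsto (strip T) (\<lambda>n. part_t (w n)) (vt T f)"
    "L2_tendsto (strip T) (\<lambda>n. part_x (w n)) (vx T f)"
    using L2_tendsto_cong[OF lv, of w "v T f"] L2_tendsto_cong[OF lvt, of "\<lambda>n. part_t (w n)" "vt T f"]
      L2_tendsto_cong[OF lvx, of "\<lambda>n. part_x (w n)" "vx T f"] eq by simp_all
  have "L2_tendsto (time_interval T) (\<lambda>n. \<Lambda> T (g n)) (\<Lambda> T f)"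
  proof (rule L2_tendsto_bounded_linear[OF gf, of "2 * T * (2 * T * K T)"])
    show "0 \<le> 2 * T * (2 * T * K T)" using T K_nonneg by simp
    show "\<Lambda> T (\<lambda>t. f t - g t) x = \<Lambda> T f x - \<Lambda> T g x"
      if "square_integrable (time_interval T) f" "square_integrable (time_interval T) g" for f g x
      using \<Lambda>_linear[OF that, of 1 "-1" x] by simp
  qed (use \<Lambda>_norm in blast)
  then have "L2_tendsto (time_interval T) (\<lambda>n t. w n (t, 0)) (\<Lambda> T f)"
  proof (rule L2_tendsto_cong)
    fix n t assume "t \<in> space (time_interval T)"
    then have "t \<le> 2 * T" by simp
    then show "\<Lambda> T (g n) t = w n (t, 0)"
      using w(2)[of 0 t n] regular_v(1)[OF g[of n], of t 0] by (simp add: \<Lambda>_def v_def)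
  qed simp
  from has_traceI[OF w1 less_imp_le[OF T] conv, of "time_interval T" "\<lambda>t. (t, 0)", OF this]
  show "has_trace T (v T f) (vt T f) (vx T f) (time_interval T) (\<lambda>t. (t, 0)) (\<Lambda> T f)" .
  have "L2_tendsto halfline (\<lambda>n x. w n (0, x)) (\<lambda>x. 0)"
  proof -
    have z: "w n (0, x) = 0" if "0 \<le> x" for n x
      using w(2)[OF that, of 0 n] T that \<theta>_nonneg[OF that] regular_inputD(4,5)[OF g[of n]]
        u_zero[OF regular_inputD(1)[OF g[of n]], of 0 0 x] by simp
    have "L2_tendsto halfline (\<lambda>n x. 0) (\<lambda>x. 0)"
      by (simp add: L2_tendsto_def square_integrable_def)
    then show ?thesis
      by (rule L2_tendsto_cong) (simp_all add: z halfline_def space_restrict_space)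
  qed
  from has_traceI[OF w1 less_imp_le[OF T] conv, of halfline "\<lambda>x. (0, x)", OF this]
  have tr0: "has_trace T (v T f) (vt T f) (vx T f) halfline (\<lambda>x. (0, x)) (\<lambda>x. 0)" .
  show "wave_solution T c f (v T f) (vt T f) (vx T f)"
    unfolding wave_solution_def
  proof (intro conjI ballI tr0)
    show "H1_strip T (v T f) (vt T f) (vx T f)" using tr0 by (simp add: has_trace_def)
    fix \<phi> assume \<phi>: "\<phi> \<in> C1_test ({..<2 * T} \<times> UNIV)"
    note s = C1_test_strip[OF \<phi>, of T]
    have w2: "square_integrable (strip T) (\<lambda>z. part_t \<phi> z / (c (snd z))\<^sup>2)"
    proof -
      obtain R where "continuous_on UNIV (part_t \<phi>)" "\<And>t x. R \<le> x \<Longrightarrow> part_t \<phi> (t, x) = 0"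
        using C1_testD[OF \<phi>] by metis
      moreover have "continuous_on UNIV (\<lambda>z. part_t \<phi> z / (c (snd z))\<^sup>2)"
        using \<open>continuous_on UNIV (part_t \<phi>)\<close> by (intro continuous_intros c_cont_on) auto
      ultimately show ?thesis
        using strip_square_integrable[of "\<lambda>t x. part_t \<phi> (t, x) / (c x)\<^sup>2" T R] by simp
    qed
    have sg: "square_integrable (time_interval T) (\<lambda>t. \<phi> (t, 0))" by (rule C1_test_time[OF \<phi>])
    let ?L = "\<lambda>a b f. (LINT z|strip T. b z * part_x \<phi> z) - (LINT z|strip T. a z * (part_t \<phi> z / (c (snd z))\<^sup>2))
        + (LINT t|time_interval T. f t * \<phi> (t, 0))"
    have split: "(LINT z|strip T. b z * part_x \<phi> z - a z * part_t \<phi> z / (c (snd z))\<^sup>2)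
        = (LINT z|strip T. b z * part_x \<phi> z) - (LINT z|strip T. a z * (part_t \<phi> z / (c (snd z))\<^sup>2))"
      if "square_integrable (strip T) a" "square_integrable (strip T) b" for a b
      using square_integrable_mult[OF that(1) w2] square_integrable_mult[OF that(2) s(3)] by simp
    have "?L (part_t (w n)) (part_x (w n)) (g n) = 0" for n
    proof -
      have "(LINT z|strip T. ux (g n) (fst z) (snd z) * part_x \<phi> z - ut (g n) (fst z) (snd z) * part_t \<phi> z / (c (snd z))\<^sup>2)
        = (LINT z|strip T. part_x (w n) z * part_x \<phi> z - part_t (w n) z * part_t \<phi> z / (c (snd z))\<^sup>2)"
        by (rule Bochner_Integration.integral_cong)
          (use w(2) in \<open>auto simp: strip_def space_restrict_space\<close>)
      then show ?thesis
        using regular_weak[OF g[of n] less_imp_le[OF T] \<phi>] split[OF C1_test_strip(2,3)[OF w1[of n]]] by simp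
    qed
    then have "(\<lambda>n. ?L (part_t (w n)) (part_x (w n)) (g n)) \<longlonglongrightarrow> 0" by simp
    moreover have "(\<lambda>n. ?L (part_t (w n)) (part_x (w n)) (g n)) \<longlonglongrightarrow> ?L (vt T f) (vx T f) f"
      by (intro tendsto_add tendsto_diff L2_tendsto_integral conv gf s w2 sg)
    ultimately have "?L (vt T f) (vx T f) f = 0" using LIMSEQ_unique by blast
    then show "(LINT z|strip T. vx T f z * part_x \<phi> z - vt T f z * part_t \<phi> z / (c (snd z))\<^sup>2)
        + (LINT t|time_interval T. f t * \<phi> (t, 0)) = 0"
      using split[of "vt T f" "vx T f"] conv by (simp add: L2_tendsto_def)
  qed
qed

text \<open>By \<open>duality\<close>, two traces for the same data have equal pairings with every
  regular \<open>h\<close>. Regular functions converging to the difference \<open>d\<close> itself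
  then give a vanishing integral of its square.\<close>

lemma trace_unique:
  assumes f: "square_integrable (time_interval T) f"
    and w: "wave_solution T c f w wt wx" and tr: "has_trace T w wt wx (time_interval T) (\<lambda>t. (t, 0)) g"
  shows "AE t in time_interval T. g t = \<Lambda> T f t"
proof -
  note ex = solution_exists[OF f]
  have sg: "square_integrable (time_interval T) g" "square_integrable (time_interval T) (\<Lambda> T f)"
    using tr ex(2) by (auto simp: has_trace_def)
  define d where "d t = g t - \<Lambda> T f t" for t
  have sd: "square_integrable (time_interval T) d"
    unfolding d_def by (rule square_integrable_diff[OF sg])
  have orth: "(LINT t|time_interval T. d t * h t) = 0" if h: "regular_input T \<delta> h h'" for \<delta> h h'
  proof -
    have "(LINT t|time_interval T. g t * h t) = (LINT t|time_interval T. \<Lambda> T f t * h t)"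
      using duality[OF h T, of w wt wx g f] duality[OF h T, of "v T f" "vt T f" "vx T f" "\<Lambda> T f" f]
        w tr ex unfolding wave_solution_def by auto
    moreover have sh: "square_integrable (time_interval T) h"
      by (rule time_interval_square_integrable[OF regular_input_cont[OF h]])
    ultimately show ?thesis
      using square_integrable_mult[OF sg(1) sh] square_integrable_mult[OF sg(2) sh]
      by (simp add: d_def left_diff_distrib)
  qed
  obtain \<delta> h h' where h: "\<And>n. regular_input T (\<delta> n) (h n) (h' n)" and lim: "L2_tendsto (time_interval T) h d"
    using regular_inputs_dense[OF sd T] by blast
  have "(LINT t|time_interval T. h n t * d t) = 0" for n
    using orth[OF h[of n]] by (simp add: mult.commute)
  then have "(LINT t|time_interval T. d t * d t) = 0"
    using L2_tendsto_integral[OF lim sd] LIMSEQ_unique[OF _ tendsto_const] by simp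
  then have "(LINT t|time_interval T. (d t)\<^sup>2) = 0" by (simp add: power2_eq_square)
  then have "AE t in time_interval T. (d t)\<^sup>2 = 0"
    using sd integral_nonneg_eq_0_iff_AE[of "time_interval T" "\<lambda>t. (d t)\<^sup>2"] by (simp add: square_integrable_def)
  then show ?thesis by eventually_elim (simp add: d_def)
qed

lemma nd_operator_eq:
  assumes d: "d \<in> borel_measurable halfline" "AE x in halfline. d x = c x"
  shows "nd_operator T d = (\<lambda>F\<in>L2_space (time_interval T). ae_class (time_interval T) (\<Lambda> T (ae_rep F)))"
  unfolding nd_operator_def
proof (rule restrict_ext, rule the_equality)
  fix F assume "F \<in> L2_space (time_interval T)"
  then have f: "square_integrable (time_interval T) (ae_rep F)" by (rule L2_spaceD)
  have cm: "c \<in> borel_measurable halfline"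
    unfolding halfline_def by (rule continuous_measurable_restrict[OF c_cont])
  note cong = wave_solution_cong[OF d(1) cm d(2)]
  show "\<exists>u ut ux g. wave_solution T d (ae_rep F) u ut ux \<and> has_trace T u ut ux (time_interval T) (\<lambda>t. (t, 0)) g \<and>
      ae_class (time_interval T) (\<Lambda> T (ae_rep F)) = ae_class (time_interval T) g"
    unfolding cong using solution_exists[OF f] by blast
  fix G assume "\<exists>u ut ux g. wave_solution T d (ae_rep F) u ut ux \<and> has_trace T u ut ux (time_interval T) (\<lambda>t. (t, 0)) g \<and>
      G = ae_class (time_interval T) g"
  then obtain w wt wx g where w: "wave_solution T c (ae_rep F) w wt wx"
    "has_trace T w wt wx (time_interval T) (\<lambda>t. (t, 0)) g" "G = ae_class (time_interval T) g"
    unfolding cong by blast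
  have "g \<in> borel_measurable (time_interval T)" "\<Lambda> T (ae_rep F) \<in> borel_measurable (time_interval T)"
    using w(2) \<Lambda>_norm(1)[OF f] by (auto simp: has_trace_def square_integrable_def)
  then show "G = ae_class (time_interval T) (\<Lambda> T (ae_rep F))"
    unfolding w(3) using trace_unique[OF f w(1,2)] by (subst ae_class_eq_iff)
qed

text \<open>Equality holds at every t, and not just almost everywhere, because
  \<open>\<Lambda>_bound\<close> is pointwise.\<close>

lemma \<Lambda>_cong:
  assumes f: "square_integrable (time_interval T) f" and g: "square_integrable (time_interval T) g"
    and ae: "AE t in time_interval T. f t = g t"
  shows "\<Lambda> T f = \<Lambda> T g"
proof
  fix t
  have d: "square_integrable (time_interval T) (\<lambda>t. f t - g t)" by (rule square_integrable_diff[OF f g])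
  have "(LINT t|time_interval T. (f t - g t)\<^sup>2) = (LINT t|time_interval T. 0)"
    using ae f g by (intro integral_cong_AE) (auto simp: square_integrable_def)
  then have "(\<Lambda> T (\<lambda>t. f t - g t) t)\<^sup>2 \<le> 0"
    using \<Lambda>_bound[OF d, of t] by simp
  then have "\<Lambda> T (\<lambda>t. f t - g t) t = 0" by simp
  then show "\<Lambda> T f t = \<Lambda> T g t"
    using \<Lambda>_linear[OF f g, of 1 "-1" t] by simp
qed

lemma nd_operator_bounded:
  "(\<lambda>F\<in>L2_space (time_interval T). ae_class (time_interval T) (\<Lambda> T (ae_rep F))) \<in> L2_operators (time_interval T)"
proof -
  let ?N = "time_interval T"
  define S where "S F = ae_class ?N (\<Lambda> T (ae_rep F))" for F
  have mem: "ae_class ?N f \<in> L2_space ?N" if "square_integrable ?N f" for f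
    using that by (auto simp: L2_space_def)
  have S: "S F \<in> L2_space ?N" "AE t in ?N. ae_rep (S F) t = \<Lambda> T (ae_rep F) t" "square_integrable ?N (ae_rep F)"
    "square_integrable ?N (\<Lambda> T (ae_rep F))" "square_integrable ?N (ae_rep (S F))"
    if "F \<in> L2_space ?N" for F
  proof -
    show f: "square_integrable ?N (ae_rep F)" using that by (rule L2_spaceD)
    show l: "square_integrable ?N (\<Lambda> T (ae_rep F))" by (rule \<Lambda>_norm(1)[OF f])
    show m: "S F \<in> L2_space ?N" unfolding S_def by (rule mem[OF l])
    show "AE t in ?N. ae_rep (S F) t = \<Lambda> T (ae_rep F) t"
      unfolding S_def using l by (intro ae_rep_class(2)) (simp add: square_integrable_def)
    show "square_integrable ?N (ae_rep (S F))" by (rule L2_spaceD(1)[OF m])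
  qed
  \<comment> \<open>Additivity and homogeneity at once: p = q = 1 gives the sum, q = 0 the
    multiple.\<close>
  have comb: "S (ae_class ?N (\<lambda>t. p * ae_rep F t + q * ae_rep G t)) = ae_class ?N (\<lambda>t. p * ae_rep (S F) t + q * ae_rep (S G) t)"
    if F: "F \<in> L2_space ?N" and G: "G \<in> L2_space ?N" for F G p q
  proof -
    define h where "h t = p * ae_rep F t + q * ae_rep G t" for t
    have h: "square_integrable ?N h"
      unfolding h_def by (intro square_integrable_add square_integrable_cmult S F G)
    then have hm: "h \<in> borel_measurable ?N" by (simp add: square_integrable_def)
    have "\<Lambda> T (ae_rep (ae_class ?N h)) = \<Lambda> T h"
      by (rule \<Lambda>_cong[OF L2_spaceD(1)[OF mem[OF h]] h ae_rep_class(2)[OF hm]])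
    also have "\<dots> = (\<lambda>t. p * \<Lambda> T (ae_rep F) t + q * \<Lambda> T (ae_rep G) t)"
      unfolding h_def using \<Lambda>_linear[OF S(3)[OF F] S(3)[OF G]] by auto
    finally have "S (ae_class ?N h) = ae_class ?N (\<lambda>t. p * \<Lambda> T (ae_rep F) t + q * \<Lambda> T (ae_rep G) t)"
      by (simp add: S_def)
    also have "\<dots> = ae_class ?N (\<lambda>t. p * ae_rep (S F) t + q * ae_rep (S G) t)"
    proof (subst ae_class_eq_iff)
      show "AE t in ?N. p * \<Lambda> T (ae_rep F) t + q * \<Lambda> T (ae_rep G) t = p * ae_rep (S F) t + q * ae_rep (S G) t"
        using S(2)[OF F] S(2)[OF G] by eventually_elim simp
    qed (use S(4,5)[OF F] S(4,5)[OF G] in \<open>auto simp: square_integrable_def\<close>)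
    finally show ?thesis by (simp add: h_def[abs_def])
  qed
  have add: "S (ae_add ?N F G) = ae_add ?N (S F) (S G)" if "F \<in> L2_space ?N" "G \<in> L2_space ?N" for F G
    using comb[OF that, of 1 1] by (simp add: ae_add_def)
  have scale: "S (ae_scale ?N r F) = ae_scale ?N r (S F)" if "F \<in> L2_space ?N" for F r
    using comb[OF that that, of r 0] by (simp add: ae_scale_def)
  have closed: "ae_add ?N F G \<in> L2_space ?N" "ae_scale ?N r F \<in> L2_space ?N"
    if "F \<in> L2_space ?N" "G \<in> L2_space ?N" for F G r
    unfolding ae_add_def ae_scale_def
    by (intro mem square_integrable_add square_integrable_cmult S(3) that)+
  have norm: "L2_norm ?N (S F) \<le> sqrt (2 * T * (2 * T * K T)) * L2_norm ?N F" if F: "F \<in> L2_space ?N" for F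
  proof -
    have "(LINT t|?N. (ae_rep (S F) t)\<^sup>2) = (LINT t|?N. (\<Lambda> T (ae_rep F) t)\<^sup>2)"
      using S[OF F] by (intro integral_cong_AE) (auto simp: square_integrable_def)
    also have "\<dots> \<le> 2 * T * (2 * T * K T) * (LINT t|?N. (ae_rep F t)\<^sup>2)"
      by (rule \<Lambda>_norm(2)[OF S(3)[OF F]])
    finally show ?thesis
      unfolding L2_norm_def real_sqrt_mult[symmetric] by (rule real_sqrt_le_mono)
  qed
  show ?thesis
    unfolding L2_operators_def S_def[symmetric]
  proof (intro CollectI conjI)
    show "restrict S (L2_space ?N) \<in> L2_space ?N \<rightarrow>\<^sub>E L2_space ?N" using S(1) by auto
    show "\<forall>F\<in>L2_space ?N. \<forall>G\<in>L2_space ?N. restrict S (L2_space ?N) (ae_add ?N F G)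
        = ae_add ?N (restrict S (L2_space ?N) F) (restrict S (L2_space ?N) G)"
      using add closed(1) by simp
    show "\<forall>r. \<forall>F\<in>L2_space ?N. restrict S (L2_space ?N) (ae_scale ?N r F) = ae_scale ?N r (restrict S (L2_space ?N) F)"
      using scale closed(2) by simp
    show "\<exists>K. \<forall>F\<in>L2_space ?N. L2_norm ?N (restrict S (L2_space ?N) F) \<le> K * L2_norm ?N F"
      using norm by (intro exI[of _ "sqrt (2 * T * (2 * T * K T))"]) simp
  qed
qed

end

end

section \<open>Stability of the inverse problem\<close>

text \<open>Going sideways, the kernels at depth \<open>y\<close> depend only on \<open>G(\<sqdot>, 0)\<close> and on the coefficient above
  that depth, and \<open>G(0, y)\<close> returns the coefficient at \<open>y\<close>; the weight \<open>exp (l y)\<close> replaces Gronwall's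
  inequality in \<open>y\<close>.\<close>

lemma profile_stability:
  assumes pa: "profile a A Y" and pb: "profile b A Y"
    and \<sigma>: "\<And>\<xi>. 0 \<le> \<xi> \<Longrightarrow> \<xi> \<le> 2 * Y \<Longrightarrow> \<bar>profile.G a A Y \<xi> 0 - profile.G b A Y \<xi> 0\<bar> \<le> \<sigma>"
  defines "E \<equiv> profile.\<beta> A Y * (A * exp (profile.\<mu> A Y * (2 * Y)))"
  assumes y: "0 \<le> y" "y \<le> Y"
  shows "\<bar>a y - b y\<bar> \<le> 4 * \<sigma> * exp (2 * (E + A) * Y)"
proof -
  interpret p: profile a A Y by (rule pa)
  interpret q: profile b A Y by (rule pb)
  \<comment> \<open>The integral terms carry the factor (E + A) / l; this rate makes it 1 /
    2.\<close>
  define l where "l = 2 * (E + A)"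
  have E0: "0 \<le> E" "A \<le> E"
  proof -
    have 1: "1 * (A * 1) \<le> E"
      unfolding E_def using p.\<beta>_ge p.A_pos p.\<mu>_pos p.Y_pos by (intro mult_mono) auto
    then show "0 \<le> E" "A \<le> E" using p.A_pos by auto
  qed
  have l: "0 < l" using E0 p.A_pos by (simp add: l_def)
  have \<sigma>0: "0 \<le> \<sigma>" using \<sigma>[of 0] p.Y_pos by (meson abs_ge_zero order_trans order_refl zero_le_mult_iff less_imp_le zero_le_numeral)
  have bG: "\<bar>p.G \<xi> r\<bar> \<le> E" "\<bar>q.G \<xi> r\<bar> \<le> E" "\<bar>p.H \<xi> r\<bar> \<le> E" "\<bar>q.H \<xi> r\<bar> \<le> E" if "\<xi> \<le> 2 * Y" for \<xi> r
  proof -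
    have e: "A * exp (p.\<mu> * max 0 \<xi>) \<le> A * exp (p.\<mu> * (2 * Y))"
      using that p.Y_pos p.\<mu>_pos p.A_pos by simp
    have e': "A * exp (p.\<mu> * (2 * Y)) \<le> E"
      unfolding E_def using p.\<beta>_ge p.A_pos mult_right_mono[of 1 p.\<beta> "A * exp (p.\<mu> * (2 * Y))"] by simp
    show "\<bar>p.G \<xi> r\<bar> \<le> E" "\<bar>q.G \<xi> r\<bar> \<le> E"
      using order_trans[OF p.G_bound order_trans[OF e e']] order_trans[OF q.G_bound order_trans[OF e e']] .
    have "p.\<beta> * (A * exp (p.\<mu> * max 0 \<xi>)) \<le> E"
      unfolding E_def using p.\<beta>_ge by (intro mult_left_mono[OF e]) auto
    then show "\<bar>p.H \<xi> r\<bar> \<le> E" "\<bar>q.H \<xi> r\<bar> \<le> E"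
      using order_trans[OF p.H_bound] order_trans[OF q.H_bound] by blast+
  qed
  \<comment> \<open>The region is the triangle determined by boundary values on [0, 2 Y]: the point
    (\<xi>, y) leads back to the boundary time \<xi> + 2 y. Both integral equations stay inside it,
    since \<open>H_eq\<close> moves towards the boundary at fixed \<xi> and
    \<open>G_sideways\<close> at fixed \<xi> + 2 y.\<close>
  define B where "B N \<longleftrightarrow> (\<forall>y \<xi>. 0 \<le> y \<longrightarrow> 0 \<le> \<xi> \<longrightarrow> \<xi> + 2 * y \<le> 2 * Y \<longrightarrow>
     \<bar>a y - b y\<bar> \<le> N * exp (l * y) \<and> \<bar>p.G \<xi> y - q.G \<xi> y\<bar> \<le> N * exp (l * y) \<and> \<bar>p.H \<xi> y - q.H \<xi> y\<bar> \<le> N * exp (l * y))" for N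
  have int: "\<bar>prim (\<lambda>r. a r * k r) y - prim (\<lambda>r. b r * k' r) y\<bar> \<le> N / 2 * exp (l * y)"
    if k: "continuous_on UNIV k" "continuous_on UNIV k'" and "0 \<le> y" "0 \<le> N"
      and bk: "\<And>r. 0 \<le> r \<Longrightarrow> r \<le> y \<Longrightarrow> \<bar>k r\<bar> \<le> E \<and> \<bar>a r - b r\<bar> \<le> N * exp (l * r) \<and> \<bar>k r - k' r\<bar> \<le> N * exp (l * r)"
    for k k' y N
  proof -
    have "prim (\<lambda>r. a r * k r) y - prim (\<lambda>r. b r * k' r) y = prim (\<lambda>r. a r * k r - b r * k' r) y"
      by (intro prim_diff[symmetric] continuous_intros k p.a_cont q.a_cont)
    also have "\<bar>\<dots>\<bar> \<le> prim (\<lambda>r. (E + A) * N * exp (l * r)) y"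
    proof (rule prim_abs_le)
      fix r assume r: "0 \<le> r" "r \<le> y"
      have "\<bar>(a r - b r) * k r\<bar> \<le> N * exp (l * r) * E"
        unfolding abs_mult using bk[OF r] \<open>0 \<le> N\<close> by (intro mult_mono) auto
      moreover have "\<bar>b r * (k r - k' r)\<bar> \<le> A * (N * exp (l * r))"
        unfolding abs_mult using bk[OF r] q.a_bound p.A_pos by (intro mult_mono) auto
      moreover have "a r * k r - b r * k' r = (a r - b r) * k r + b r * (k r - k' r)" by (simp add: algebra_simps)
      moreover have "(E + A) * N * exp (l * r) = N * exp (l * r) * E + A * (N * exp (l * r))" by (simp add: algebra_simps)
      ultimately show "\<bar>a r * k r - b r * k' r\<bar> \<le> (E + A) * N * exp (l * r)" by linarith
    qed (use k p.a_cont q.a_cont \<open>0 \<le> y\<close> in \<open>auto intro!: continuous_intros\<close>)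
    also have "\<dots> = (E + A) * N * ((exp (l * y) - 1) / l)"
      using l by (simp add: prim_cmult prim_exp)
    also have "\<dots> \<le> (E + A) * N * (exp (l * y) / l)"
      using E0 p.A_pos \<open>0 \<le> N\<close> l by (intro mult_left_mono divide_right_mono) auto
    also have "\<dots> = N / 2 * exp (l * y)"
    proof -
      have "E + A = l / 2" by (simp add: l_def)
      then show ?thesis using l by (simp only:) simp
    qed
    finally show ?thesis .
  qed
  \<comment> \<open>For \<open>G\<close> and \<open>H\<close> one round gives \<sigma> plus N / 4 in
    the weighted norm. Recovering \<open>a\<close> as - 2 G (0, y) doubles both, hence the fixed
    term 2 \<sigma> in \<open>halving_bound\<close>.\<close>
  have "B (2 * (2 * \<sigma>))"
  proof (rule halving_bound[where P = B])
    show "B (2 * A + 2 * E)"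
      unfolding B_def
    proof (intro allI impI)
      fix y \<xi> :: real assume *: "0 \<le> y" "0 \<le> \<xi>" "\<xi> + 2 * y \<le> 2 * Y"
      define W where "W = (2 * A + 2 * E) * exp (l * y)"
      have "(2 * A + 2 * E) * 1 \<le> W"
        unfolding W_def using E0 p.A_pos l * by (intro mult_left_mono) auto
      then have "2 * A \<le> W" "2 * E \<le> W" using E0 p.A_pos by auto
      moreover have "\<bar>a y - b y\<bar> \<le> 2 * A"
        using p.a_bound[of y] q.a_bound[of y] by linarith
      moreover have "\<bar>p.G \<xi> y - q.G \<xi> y\<bar> \<le> 2 * E" "\<bar>p.H \<xi> y - q.H \<xi> y\<bar> \<le> 2 * E"
        using bG[of \<xi> y] * by linarith+
      ultimately show "\<bar>a y - b y\<bar> \<le> (2 * A + 2 * E) * exp (l * y) \<and> \<bar>p.G \<xi> y - q.G \<xi> y\<bar> \<le> (2 * A + 2 * E) * exp (l * y)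
        \<and> \<bar>p.H \<xi> y - q.H \<xi> y\<bar> \<le> (2 * A + 2 * E) * exp (l * y)"
        unfolding W_def[symmetric] by (meson order_trans)
    qed
    show "B N" if "\<And>k. B (Z k)" "Z \<longlonglongrightarrow> N" for Z :: "nat \<Rightarrow> real" and N
      unfolding B_def
    proof (intro allI impI)
      fix y \<xi> assume *: "0 \<le> y" "0 \<le> \<xi>" "\<xi> + 2 * y \<le> 2 * Y"
      have c: "w \<le> N * exp (l * y)" if "\<And>k. w \<le> Z k * exp (l * y)" for w
        by (rule LIMSEQ_le_const[OF tendsto_mult_right[OF \<open>Z \<longlonglongrightarrow> N\<close>]]) (use that in auto)
      show "\<bar>a y - b y\<bar> \<le> N * exp (l * y) \<and> \<bar>p.G \<xi> y - q.G \<xi> y\<bar> \<le> N * exp (l * y) \<and> \<bar>p.H \<xi> y - q.H \<xi> y\<bar> \<le> N * exp (l * y)"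
        using that(1) * unfolding B_def by (intro conjI c) blast+
    qed
    fix N :: real assume N: "0 \<le> N" "B N"
    have bd: "\<bar>a y - b y\<bar> \<le> N * exp (l * y)" "\<bar>p.G \<xi> y - q.G \<xi> y\<bar> \<le> N * exp (l * y)"
      "\<bar>p.H \<xi> y - q.H \<xi> y\<bar> \<le> N * exp (l * y)" if "0 \<le> y" "0 \<le> \<xi>" "\<xi> + 2 * y \<le> 2 * Y" for y \<xi>
      using N(2) that unfolding B_def by blast+
    have step: "\<bar>p.G \<xi> y - q.G \<xi> y\<bar> \<le> \<sigma> + N / 4 * exp (l * y) \<and> \<bar>p.H \<xi> y - q.H \<xi> y\<bar> \<le> \<sigma> + N / 4 * exp (l * y)"
      if *: "0 \<le> y" "0 \<le> \<xi>" "\<xi> + 2 * y \<le> 2 * Y" for y \<xi>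
    proof
      have "\<bar>prim (\<lambda>r. a r * p.G \<xi> r) y - prim (\<lambda>r. b r * q.G \<xi> r) y\<bar> \<le> N / 2 * exp (l * y)"
      proof (rule int)
        fix r assume r: "0 \<le> r" "r \<le> y"
        then show "\<bar>p.G \<xi> r\<bar> \<le> E \<and> \<bar>a r - b r\<bar> \<le> N * exp (l * r) \<and> \<bar>p.G \<xi> r - q.G \<xi> r\<bar> \<le> N * exp (l * r)"
          using * by (intro conjI bG bd(1)[of r \<xi>] bd(2)) auto
      qed (use N * cont2_section(1)[OF p.G_cont] cont2_section(1)[OF q.G_cont] in auto)
      moreover have "\<bar>p.G \<xi> 0 - q.G \<xi> 0\<bar> \<le> \<sigma>" using * by (intro \<sigma>) auto
      ultimately show "\<bar>p.H \<xi> y - q.H \<xi> y\<bar> \<le> \<sigma> + N / 4 * exp (l * y)"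
        unfolding p.H_eq q.H_eq by linarith
      have "\<bar>prim (\<lambda>r. a r * p.H (\<xi> + 2 * (y - r)) r) y - prim (\<lambda>r. b r * q.H (\<xi> + 2 * (y - r)) r) y\<bar> \<le> N / 2 * exp (l * y)"
      proof (rule int)
        show "continuous_on UNIV (\<lambda>r. p.H (\<xi> + 2 * (y - r)) r)" "continuous_on UNIV (\<lambda>r. q.H (\<xi> + 2 * (y - r)) r)"
          by (intro p.H_cont_on q.H_cont_on continuous_intros)+
        fix r assume r: "0 \<le> r" "r \<le> y"
        then show "\<bar>p.H (\<xi> + 2 * (y - r)) r\<bar> \<le> E \<and> \<bar>a r - b r\<bar> \<le> N * exp (l * r) \<and>
            \<bar>p.H (\<xi> + 2 * (y - r)) r - q.H (\<xi> + 2 * (y - r)) r\<bar> \<le> N * exp (l * r)"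
          using * by (intro conjI bG bd(1)[of r \<xi>] bd(3)) auto
      qed (use N * in auto)
      moreover have "\<bar>p.G (\<xi> + 2 * y) 0 - q.G (\<xi> + 2 * y) 0\<bar> \<le> \<sigma>" using * by (intro \<sigma>) auto
      ultimately show "\<bar>p.G \<xi> y - q.G \<xi> y\<bar> \<le> \<sigma> + N / 4 * exp (l * y)"
        unfolding p.G_sideways[OF *(2,1)] q.G_sideways[OF *(2,1)] by linarith
    qed
    show "B (2 * \<sigma> + N / 2)"
      unfolding B_def
    proof (intro allI impI)
      fix y \<xi> assume *: "0 \<le> y" "0 \<le> \<xi>" "\<xi> + 2 * y \<le> 2 * Y"
      have x: "1 \<le> exp (l * y)" using l * by simp
      have s: "\<sigma> \<le> \<sigma> * exp (l * y)" using \<sigma>0 x mult_left_mono[OF x \<sigma>0] by simp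
      have n: "0 \<le> N * exp (l * y)" using N by simp
      have "\<bar>p.G 0 y - q.G 0 y\<bar> \<le> \<sigma> + N / 4 * exp (l * y)" using step[of y 0] * by simp
      then have "\<bar>a y - b y\<bar> \<le> 2 * \<sigma> + N / 2 * exp (l * y)"
        unfolding p.G_diagonal q.G_diagonal by linarith
      moreover have "(2 * \<sigma> + N / 2) * exp (l * y) = 2 * (\<sigma> * exp (l * y)) + N * exp (l * y) / 2"
        by (simp add: algebra_simps)
      ultimately show "\<bar>a y - b y\<bar> \<le> (2 * \<sigma> + N / 2) * exp (l * y) \<and> \<bar>p.G \<xi> y - q.G \<xi> y\<bar> \<le> (2 * \<sigma> + N / 2) * exp (l * y)
        \<and> \<bar>p.H \<xi> y - q.H \<xi> y\<bar> \<le> (2 * \<sigma> + N / 2) * exp (l * y)"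
        using step[OF *] s n \<sigma>0 by auto
    qed
  qed (use E0 p.A_pos \<sigma>0 in auto)
  from this[unfolded B_def, rule_format, of y 0]
  have "\<bar>a y - b y\<bar> \<le> 4 * \<sigma> * exp (l * y)"
    using y by simp
  also have "\<dots> \<le> 4 * \<sigma> * exp (l * Y)"
    using \<sigma>0 l y by (intro mult_left_mono) auto
  finally show ?thesis by (simp add: l_def)
qed

lemma exp_diff_le:
  fixes s t :: real
  assumes "exp s \<le> C" "exp t \<le> C"
  shows "\<bar>exp s - exp t\<bar> \<le> C * \<bar>s - t\<bar>"
proof -
  have *: "exp u - exp w \<le> exp u * (u - w)" for u w :: real
  proof -
    have "1 - exp (w - u) \<le> u - w" using exp_ge_add_one_self[of "w - u"] by linarith
    then have "exp u * (1 - exp (w - u)) \<le> exp u * (u - w)" by (intro mult_left_mono) auto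
    then show ?thesis by (simp add: algebra_simps exp_diff)
  qed
  show ?thesis
  proof (cases "t \<le> s")
    case True
    have "exp s - exp t \<le> C * (s - t)"
      using *[of s t] mult_right_mono[OF assms(1), of "s - t"] True by simp
    with True show ?thesis by simp
  next
    case False
    have "exp t - exp s \<le> C * (t - s)"
    proof -
      have "exp t * (t - s) \<le> C * (t - s)" using assms(2) False by (intro mult_right_mono) auto
      with *[of t s] show ?thesis by linarith
    qed
    with False show ?thesis by simp
  qed
qed

text \<open>The mean value theorem applied to successive differences. It turns smallness of values
  of a third primitive into smallness of the function itself at one nearby point.\<close>

lemma third_difference:
  fixes e d k g :: "real \<Rightarrow> real"
  assumes e: "\<And>t. (e has_real_derivative d t) (at t)" and d: "\<And>t. (d has_real_derivative k t) (at t)"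
    and k: "\<And>t. (k has_real_derivative g t) (at t)" and h: "0 < h"
  shows "\<exists>z. t < z \<and> z < t + 3 * h \<and> e (t + 3 * h) - 3 * e (t + 2 * h) + 3 * e (t + h) - e t = h ^ 3 * g z"
proof -
  have shift: "((\<lambda>s. f (s + r)) has_real_derivative f' (s + r)) (at s)"
    if "\<And>t. (f has_real_derivative f' t) (at t)" for f f' :: "real \<Rightarrow> real" and r s
    using that[of "s + r"] by (simp add: DERIV_shift)
  have mvt: "\<exists>z. s < z \<and> z < s + h \<and> f (s + h) - f s = h * f' z"
    if "\<And>t. (f has_real_derivative f' t) (at t)" for f f' :: "real \<Rightarrow> real" and s
    using MVT2[of s "s + h" f f'] that h by auto
  have e3: "((\<lambda>s. e (s + 2 * h) - 2 * e (s + h) + e s) has_real_derivative d (s + 2 * h) - 2 * d (s + h) + d s) (at s)" for s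
    by (intro DERIV_add DERIV_diff DERIV_cmult shift e)
  obtain z1 where z1: "t < z1" "z1 < t + h"
    "e (t + h + 2 * h) - 2 * e (t + h + h) + e (t + h) - (e (t + 2 * h) - 2 * e (t + h) + e t)
      = h * (d (z1 + 2 * h) - 2 * d (z1 + h) + d z1)"
    using mvt[OF e3, of t] by blast
  have d2: "((\<lambda>s. d (s + h) - d s) has_real_derivative k (s + h) - k s) (at s)" for s
    by (intro DERIV_diff shift d)
  obtain z2 where z2: "z1 < z2" "z2 < z1 + h" "d (z1 + h + h) - d (z1 + h) - (d (z1 + h) - d z1) = h * (k (z2 + h) - k z2)"
    using mvt[OF d2, of z1] by blast
  obtain z3 where z3: "z2 < z3" "z3 < z2 + h" "k (z2 + h) - k z2 = h * g z3"
    using mvt[OF k, of z2] by blast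
  have a: "t + h + 2 * h = t + 3 * h" "t + h + h = t + 2 * h" "z1 + h + h = z1 + 2 * h" by simp_all
  have "d (z1 + 2 * h) - 2 * d (z1 + h) + d z1 = h * (h * g z3)"
    using z2(3) z3(3) unfolding a by simp
  then have "e (t + 3 * h) - 3 * e (t + 2 * h) + 3 * e (t + h) - e t = h * (h * (h * g z3))"
    using z1(3) unfolding a by simp
  then show ?thesis
    using z1 z2 z3 by (intro exI[of _ z3]) (auto simp: power3_eq_cube)
qed

section \<open>From the response to the constant 1 to the kernel and the speed\<close>

context speed
begin

text \<open>At depth 0 the kernels coincide, so \<open>P\<close> for the constant 1 is - 1 plus the
  primitive of the boundary trace of \<open>G\<close>. The constant is not causal, hence the
  computation uses \<open>cv\<close> directly.\<close>

lemma \<Lambda>_one: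
  assumes T: "0 < T" and t: "0 \<le> t" "t \<le> 2 * T"
  shows "\<Lambda> T (\<lambda>_. 1) t = prim (\<lambda>\<xi>. prim (\<lambda>\<sigma>. G \<sigma> 0) \<xi> - 1) t"
proof -
  have s: "continuous_on UNIV (\<lambda>\<sigma>. G \<sigma> 0)" by (rule cont2_section(2)[OF G_cont])
  have k: "cv T k (\<lambda>_. 1) \<xi> 0 = prim (\<lambda>\<sigma>. k \<sigma> 0) \<xi>" if k: "cont2 k" and \<xi>: "0 \<le> \<xi>" "\<xi> \<le> 2 * T" for k \<xi>
  proof -
    have c: "continuous_on UNIV (\<lambda>\<sigma>. k (\<xi> - \<sigma>) 0)" by (intro cont2_compose[OF k] continuous_intros)
    have "cv T k (\<lambda>_. 1) \<xi> 0 = prim (\<lambda>\<sigma>. k (\<xi> - \<sigma>) 0) \<xi>"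
      using time_integral_upto[OF c \<xi>(2)] \<xi>(1) by (simp add: cv_def)
    moreover have "-1 * prim (\<lambda>s. k (-1 * s + \<xi>) 0) \<xi> = prim (\<lambda>\<sigma>. k \<sigma> 0) (-1 * \<xi> + \<xi>) - prim (\<lambda>\<sigma>. k \<sigma> 0) \<xi>"
      by (rule prim_affine[OF cont2_section(2)[OF k]])
    ultimately show ?thesis by simp
  qed
  have c: "continuous_on UNIV (\<lambda>\<xi>. prim (\<lambda>\<sigma>. G \<sigma> 0) \<xi> - 1)"
    by (intro continuous_intros prim_continuous_on cont2_compose1[OF s])
  have "\<Lambda> T (\<lambda>_. 1) t = (LINT \<xi>|time_interval T. indicator {..t} \<xi> * (prim (\<lambda>\<sigma>. G \<sigma> 0) \<xi> - 1))"
    unfolding \<Lambda>_def prim_P_def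
  proof (rule Bochner_Integration.integral_cong)
    fix \<xi> assume "\<xi> \<in> space (time_interval T)"
    then show "indicator {..t} \<xi> * P T (\<lambda>_. 1) \<xi> 0 = indicator {..t} \<xi> * (prim (\<lambda>\<sigma>. G \<sigma> 0) \<xi> - 1)"
      by (simp add: P_def k[OF G_cont] k[OF H_cont] H_0 zero_ext_def)
  qed simp
  then show ?thesis using time_integral_upto[OF c t(2)] t(1) by simp
qed

end

text \<open>The exponential factor is that of \<open>profile_stability\<close> and bounds the
  difference of the coefficients. C1 Y converts it into a bound on the speeds as functions of travel
  time, a further Y into one on the depths reached, and m is the slope with which a difference of
  depths enters the speed.\<close>

definition speed_stability :: "real \<Rightarrow> real \<Rightarrow> real \<Rightarrow> real \<Rightarrow> real" where
  "speed_stability C0 C1 L m = (let Y = L / C0; E = profile.\<beta> m Y * (m * exp (profile.\<mu> m Y * (2 * Y)))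
     in 4 * exp (2 * (E + m) * Y) * (C1 * Y + m * (C1 * Y * Y)))"

text \<open>Equal travel times belong to different depths under the two speeds. With y the travel
  time of x under the first speed, the value of \<open>d\<close> at its own depth for y is inserted
  between c x and d x: one step compares speeds at equal travel time, the other compares
  depths.\<close>

lemma speed_stable:
  assumes s1: "speed c c' C0 C1 L m" and s2: "speed d d' C0 C1 L m"
    and \<sigma>: "\<And>\<xi>. 0 \<le> \<xi> \<Longrightarrow> \<xi> \<le> 2 * (L / C0) \<Longrightarrow>
      \<bar>profile.G (speed.a c c') m (L / C0) \<xi> 0 - profile.G (speed.a d d') m (L / C0) \<xi> 0\<bar> \<le> \<sigma>"
  shows "\<bar>c x - d x\<bar> \<le> \<sigma> * speed_stability C0 C1 L m"
proof -
  interpret p: speed c c' C0 C1 L m by (rule s1)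
  interpret q: speed d d' C0 C1 L m by (rule s2)
  define Y where "Y = L / C0"
  have Y: "0 < Y" using p.L_pos p.C0_pos by (simp add: Y_def)
  define E where "E = profile.\<beta> m Y * (m * exp (profile.\<mu> m Y * (2 * Y)))"
  define \<epsilon> where "\<epsilon> = 4 * \<sigma> * exp (2 * (E + m) * Y)"
  have ab: "\<bar>p.a y - q.a y\<bar> \<le> \<epsilon>" if "0 \<le> y" "y \<le> Y" for y
    using profile_stability[OF p.a_profile q.a_profile \<sigma>, of y] that by (simp add: \<epsilon>_def E_def Y_def)
  have \<epsilon>: "0 \<le> \<epsilon>" using ab[of 0] Y by simp
  have pr: "\<bar>prim p.a y - prim q.a y\<bar> \<le> \<epsilon> * Y" if "0 \<le> y" "y \<le> Y" for y
  proof -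
    have "prim p.a y - prim q.a y = prim (\<lambda>r. p.a r - q.a r) y"
      by (rule prim_diff[symmetric]) (rule p.a_cont q.a_cont)+
    also have "\<bar>\<dots>\<bar> \<le> \<epsilon> * \<bar>y\<bar>"
      using that by (intro prim_abs_le_const continuous_intros p.a_cont q.a_cont ab)
        (auto simp: closed_segment_eq_real_ivl)
    also have "\<dots> \<le> \<epsilon> * Y" using that \<epsilon> by (intro mult_left_mono) auto
    finally show ?thesis .
  qed
  have ct: "\<bar>c (p.X y) - d (q.X y)\<bar> \<le> C1 * Y * \<epsilon>" if "0 \<le> y" "y \<le> Y" for y
  proof -
    have "\<bar>c (p.X y) - d (q.X y)\<bar> \<le> C1 * \<bar>prim p.a y - prim q.a y\<bar>"
      unfolding p.c_X q.c_X using p.c_upper[of "p.X y"] q.c_upper[of "q.X y"]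
      by (intro exp_diff_le) (simp_all add: p.c_X q.c_X)
    also have "\<dots> \<le> C1 * (\<epsilon> * Y)" using pr[OF that] p.C1_pos by (intro mult_left_mono) auto
    finally show ?thesis by (simp add: mult_ac)
  qed
  have cc: "continuous_on UNIV (\<lambda>y. c (p.X y))" "continuous_on UNIV (\<lambda>y. d (q.X y))"
    by (intro p.c_cont_on q.c_cont_on p.X_cont q.X_cont)+
  have X: "\<bar>p.X y - q.X y\<bar> \<le> C1 * Y * Y * \<epsilon>" if "0 \<le> y" "y \<le> Y" for y
  proof -
    have "p.X y - q.X y = prim (\<lambda>y. c (p.X y)) y - prim (\<lambda>y. d (q.X y)) y"
      using prim_FTC[OF p.X_deriv, of y] prim_FTC[OF q.X_deriv, of y] by simp
    also have "\<dots> = prim (\<lambda>y. c (p.X y) - d (q.X y)) y"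
      by (rule prim_diff[symmetric]) (rule cc)+
    also have "\<bar>\<dots>\<bar> \<le> C1 * Y * \<epsilon> * \<bar>y\<bar>"
      using that by (intro prim_abs_le_const continuous_intros cc ct) (auto simp: closed_segment_eq_real_ivl)
    also have "\<dots> \<le> C1 * Y * \<epsilon> * Y" using that \<epsilon> p.C1_pos Y by (intro mult_left_mono) auto
    finally show ?thesis by (simp add: mult_ac)
  qed
  have total: "\<epsilon> * (C1 * Y + m * (C1 * Y * Y)) = \<sigma> * speed_stability C0 C1 L m"
    by (simp add: speed_stability_def Let_def \<epsilon>_def E_def Y_def)
  have "\<bar>c x - d x\<bar> \<le> \<epsilon> * (C1 * Y + m * (C1 * Y * Y))"
  proof (cases "0 \<le> x \<and> x \<le> L")
    case False
    then have "c x = 1" "d x = 1" by (auto intro: p.c_one q.c_one)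
    then show ?thesis using \<epsilon> p.C1_pos Y p.m_pos by simp
  next
    case True
    define y where "y = p.\<theta> x"
    have y: "0 \<le> y" "y \<le> Y"
    proof -
      have "x / C0 \<le> L / C0" using True p.C0_pos by (intro divide_right_mono) auto
      then show "0 \<le> y" "y \<le> Y"
        using True p.\<theta>_nonneg[of x] p.\<theta>_diff_upper[of 0 x] by (auto simp: y_def Y_def)
    qed
    have "\<bar>d (q.X y) - d x\<bar> \<le> m * \<bar>q.X y - x\<bar>"
    proof -
      have "norm (d (q.X y) - d x) \<le> m * norm (q.X y - x)"
        by (rule field_differentiable_bound[of UNIV d d'])
          (use q.c_deriv q.c'_bound in auto)
      then show ?thesis by simp
    qed
    also have "\<dots> \<le> m * (C1 * Y * Y * \<epsilon>)"
      using X[OF y] p.m_pos by (intro mult_left_mono) (auto simp: y_def abs_minus_commute)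
    finally have "\<bar>d (q.X y) - d x\<bar> \<le> m * (C1 * Y * Y * \<epsilon>)" .
    moreover have "\<bar>c x - d (q.X y)\<bar> \<le> C1 * Y * \<epsilon>" using ct[OF y] by (simp add: y_def)
    ultimately have "\<bar>c x - d x\<bar> \<le> C1 * Y * \<epsilon> + m * (C1 * Y * Y * \<epsilon>)" by linarith
    then show ?thesis by (simp add: algebra_simps)
  qed
  then show ?thesis unfolding total .
qed

lemma speed_G_Lipschitz:
  assumes s: "speed c c' C0 C1 L m" and T: "0 < T" and x: "0 \<le> x" "x \<le> z" "z \<le> 2 * T"
  defines "\<beta> \<equiv> profile.\<beta> m (L / C0)" and "\<mu> \<equiv> profile.\<mu> m (L / C0)"
  shows "\<bar>profile.G (speed.a c c') m (L / C0) z 0 - profile.G (speed.a c c') m (L / C0) x 0\<bar>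
    \<le> (m * C1 / 2 + m * (\<beta> * (m * exp (\<mu> * (2 * T)))) / 2) * exp (\<mu> * (2 * T)) * (z - x)"
proof -
  interpret p: speed c c' C0 C1 L m by (rule s)
  show ?thesis
    using p.G_Lipschitz[OF p.a_Lipschitz x(1), of "z - x" "2 * T" 0] x by (simp add: \<beta>_def \<mu>_def)
qed

text \<open>An interpolation argument. The difference \<open>e\<close> of the two responses is a
  second primitive of the kernel difference \<open>g\<close>. If \<open>e\<close> is small in L2,
  its primitive \<open>w\<close> is small everywhere, a third difference makes \<open>g\<close>
  small at some z near \<xi>, and the uniform Lipschitz bound carries this back to \<xi>.\<close>

lemma kernel_stable:
  assumes "0 < C0" "0 < L" "0 < m" "L / C0 < T" "0 < \<epsilon>"
  shows "\<exists>\<eta>>0. \<forall>c c' d d' \<xi>. speed c c' C0 C1 L m \<longrightarrow> speed d d' C0 C1 L m \<longrightarrow>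
    sqrt (LINT t|time_interval T. (speed.\<Lambda> c c' C0 L m T (\<lambda>_. 1) t - speed.\<Lambda> d d' C0 L m T (\<lambda>_. 1) t)\<^sup>2) \<le> \<eta> \<longrightarrow>
    0 \<le> \<xi> \<longrightarrow> \<xi> \<le> 2 * (L / C0) \<longrightarrow>
    \<bar>profile.G (speed.a c c') m (L / C0) \<xi> 0 - profile.G (speed.a d d') m (L / C0) \<xi> 0\<bar> \<le> \<epsilon>"
proof -
  define Y where "Y = L / C0"
  define \<beta> where "\<beta> = profile.\<beta> m Y"
  define \<mu> where "\<mu> = profile.\<mu> m Y"
  have T: "0 < T" using assms by (meson divide_pos_pos less_trans)
  define r where "r = (m * C1 / 2 + m * (\<beta> * (m * exp (\<mu> * (2 * T)))) / 2) * exp (\<mu> * (2 * T))"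
  define \<rho> where "\<rho> = \<bar>r\<bar> + 1"
  have \<rho>: "0 < \<rho>" by (simp add: \<rho>_def)
  \<comment> \<open>The first entry keeps the Lipschitz error of both kernels over a distance 3 h,
    in total 6 \<rho> h, below \<epsilon> / 2; the second keeps \<xi> + 3 h within 2T and is
    positive because L / C0 < T.\<close>
  define h where "h = min (\<epsilon> / (12 * \<rho>)) ((2 * T - 2 * Y) / 3)"
  have h: "0 < h" "3 * h \<le> 2 * T - 2 * Y" "6 * \<rho> * h \<le> \<epsilon> / 2"
  proof -
    show "0 < h" using assms \<rho> by (simp add: h_def Y_def)
    have "h \<le> (2 * T - 2 * Y) / 3" "h \<le> \<epsilon> / (12 * \<rho>)"
      unfolding h_def by (rule min.cobounded2 min.cobounded1)+
    then show "3 * h \<le> 2 * T - 2 * Y" "6 * \<rho> * h \<le> \<epsilon> / 2"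
      using \<rho> by (simp_all add: field_simps)
  qed
  \<comment> \<open>Solves 8 sqrt (2T) \<eta> / h ^ 3 = \<epsilon> / 2, where 8 = 1 + 3 + 3 + 1 sums
    the absolute coefficients of the third difference.\<close>
  define \<eta> where "\<eta> = \<epsilon> * h ^ 3 / (16 * sqrt (2 * T))"
  have \<eta>: "0 < \<eta>" using assms h T by (simp add: \<eta>_def)
  have "\<bar>profile.G (speed.a c c') m Y \<xi> 0 - profile.G (speed.a d d') m Y \<xi> 0\<bar> \<le> \<epsilon>"
    if s1: "speed c c' C0 C1 L m" and s2: "speed d d' C0 C1 L m"
      and le: "sqrt (LINT t|time_interval T. (speed.\<Lambda> c c' C0 L m T (\<lambda>_. 1) t - speed.\<Lambda> d d' C0 L m T (\<lambda>_. 1) t)\<^sup>2) \<le> \<eta>"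
      and \<xi>: "0 \<le> \<xi>" "\<xi> \<le> 2 * Y" for c c' d d' \<xi>
  proof -
    interpret p: speed c c' C0 C1 L m by (rule s1)
    interpret q: speed d d' C0 C1 L m by (rule s2)
    define g where "g \<sigma> = p.G \<sigma> 0 - q.G \<sigma> 0" for \<sigma>
    define k where "k = prim g"
    define e where "e = prim k"
    define w where "w = prim e"
    have gc: "continuous_on UNIV (\<lambda>\<sigma>. p.G \<sigma> 0)" "continuous_on UNIV (\<lambda>\<sigma>. q.G \<sigma> 0)"
      by (rule cont2_section(2)[OF p.G_cont] cont2_section(2)[OF q.G_cont])+
    have g: "continuous_on UNIV g"
      unfolding g_def by (intro continuous_intros gc)
    have dk: "(k has_real_derivative g t) (at t)" for t unfolding k_def by (rule has_derivative_prim[OF g])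
    then have k: "continuous_on UNIV k" by (meson DERIV_isCont continuous_at_imp_continuous_on)
    have de: "(e has_real_derivative k t) (at t)" for t unfolding e_def by (rule has_derivative_prim[OF k])
    then have ec: "continuous_on UNIV e" by (meson DERIV_isCont continuous_at_imp_continuous_on)
    have dw: "(w has_real_derivative e t) (at t)" for t unfolding w_def by (rule has_derivative_prim[OF ec])
    have e_eq: "p.\<Lambda> T (\<lambda>_. 1) t - q.\<Lambda> T (\<lambda>_. 1) t = e t" if "0 \<le> t" "t \<le> 2 * T" for t
    proof -
      have c: "continuous_on UNIV (\<lambda>\<xi>. prim (\<lambda>\<sigma>. p.G \<sigma> 0) \<xi> - 1)" "continuous_on UNIV (\<lambda>\<xi>. prim (\<lambda>\<sigma>. q.G \<sigma> 0) \<xi> - 1)"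
        by (intro continuous_intros prim_continuous_on cont2_compose1[OF gc(1)] cont2_compose1[OF gc(2)])+
      have "e t = prim (\<lambda>\<xi>. (prim (\<lambda>\<sigma>. p.G \<sigma> 0) \<xi> - 1) - (prim (\<lambda>\<sigma>. q.G \<sigma> 0) \<xi> - 1)) t"
      proof -
        have "prim g = (\<lambda>\<xi>. prim (\<lambda>\<sigma>. p.G \<sigma> 0) \<xi> - prim (\<lambda>\<sigma>. q.G \<sigma> 0) \<xi>)"
          by (rule ext) (simp add: g_def[abs_def] prim_diff[OF gc])
        then show ?thesis by (simp add: e_def k_def)
      qed
      then show ?thesis
        using prim_diff[OF c, of t] p.\<Lambda>_one[OF T that] q.\<Lambda>_one[OF T that] by simp
    qed
    have "(LINT t|time_interval T. (p.\<Lambda> T (\<lambda>_. 1) t - q.\<Lambda> T (\<lambda>_. 1) t)\<^sup>2) = (LINT t|time_interval T. (e t)\<^sup>2)"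
      by (rule Bochner_Integration.integral_cong) (auto simp: e_eq)
    then have ne: "sqrt (LINT t|time_interval T. (e t)\<^sup>2) \<le> \<eta>" using le by simp
    have wb: "\<bar>w t\<bar> \<le> sqrt (2 * T) * \<eta>" if t: "0 \<le> t" "t \<le> 2 * T" for t
    proof -
      have "w t = (LINT s|time_interval T. indicator {..t} s * e s)"
        using time_integral_upto[OF ec t(2)] t(1) by (simp add: w_def)
      also have "\<bar>\<dots>\<bar> \<le> 1 * (sqrt (2 * T) * sqrt (LINT t|time_interval T. (e t)\<^sup>2))"
      proof (rule time_abs_integral_le(2)[OF time_interval_square_integrable[OF ec] _ _ T])
        show "indicator {..t} \<in> borel_measurable (time_interval T)"
          unfolding time_interval_def by (intro measurable_restrict_space1) simp
        show "\<bar>indicator {..t} s\<bar> \<le> (1::real)" for s :: real by (simp add: indicator_def)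
      qed
      also have "\<dots> \<le> sqrt (2 * T) * \<eta>" using ne T by simp
      finally show ?thesis .
    qed
    obtain z where z: "\<xi> < z" "z < \<xi> + 3 * h"
      "w (\<xi> + 3 * h) - 3 * w (\<xi> + 2 * h) + 3 * w (\<xi> + h) - w \<xi> = h ^ 3 * g z"
      using third_difference[OF dw de dk h(1)] by blast
    have rng: "0 \<le> \<xi> + 3 * h \<and> \<xi> + 3 * h \<le> 2 * T" "0 \<le> \<xi> + 2 * h \<and> \<xi> + 2 * h \<le> 2 * T"
      "0 \<le> \<xi> + h \<and> \<xi> + h \<le> 2 * T" "0 \<le> \<xi> \<and> \<xi> \<le> 2 * T"
      using h \<xi> by auto
    have "\<bar>h ^ 3 * g z\<bar> \<le> 8 * (sqrt (2 * T) * \<eta>)"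
      unfolding z(3)[symmetric] using wb[of "\<xi> + 3 * h"] wb[of "\<xi> + 2 * h"] wb[of "\<xi> + h"] wb[of \<xi>] rng
      by linarith
    also have "\<dots> = h ^ 3 * (\<epsilon> / 2)"
      using T by (simp add: \<eta>_def)
    finally have gz: "\<bar>g z\<bar> \<le> \<epsilon> / 2"
      using h(1) by (simp add: abs_mult)
    have lip: "\<bar>P z - P \<xi>\<bar> \<le> \<rho> * (3 * h)"
      if "\<bar>P z - P \<xi>\<bar> \<le> r * (z - \<xi>)" for P :: "real \<Rightarrow> real"
    proof -
      have "\<bar>P z - P \<xi>\<bar> \<le> \<rho> * (z - \<xi>)"
      proof -
        have "r * (z - \<xi>) \<le> \<rho> * (z - \<xi>)"
          using z(1) by (intro mult_right_mono) (auto simp: \<rho>_def)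
        with that show ?thesis by linarith
      qed
      also have "\<dots> \<le> \<rho> * (3 * h)" using z \<rho> by (intro mult_left_mono) auto
      finally show ?thesis .
    qed
    have zr: "\<xi> \<le> z" "z \<le> 2 * T" using z h \<xi> by auto
    have "\<bar>p.G z 0 - p.G \<xi> 0\<bar> \<le> \<rho> * (3 * h)" "\<bar>q.G z 0 - q.G \<xi> 0\<bar> \<le> \<rho> * (3 * h)"
      using lip[of "\<lambda>\<xi>. p.G \<xi> 0"] speed_G_Lipschitz[OF s1 T \<xi>(1) zr]
        lip[of "\<lambda>\<xi>. q.G \<xi> 0"] speed_G_Lipschitz[OF s2 T \<xi>(1) zr]
      unfolding r_def \<beta>_def \<mu>_def Y_def by blast+
    moreover have "\<rho> * (3 * h) + \<rho> * (3 * h) = 6 * \<rho> * h" by simp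
    ultimately have "\<bar>g \<xi>\<bar> \<le> \<epsilon>"
      using gz h(3) unfolding g_def by linarith
    then show ?thesis by (simp add: g_def Y_def)
  qed
  with \<eta> show ?thesis unfolding Y_def by (intro exI[of _ \<eta>]) auto
qed

section \<open>Wave speeds\<close>

text \<open>Each of the three suprema is nonnegative, hence at most their sum; boundedness of the
  derivatives makes the suprema genuine upper bounds.\<close>

lemma C2_norm_bounds:
  assumes c: "c \<in> C2_halfline" "C2_norm c \<le> m" and "0 \<le> x" "k \<le> 2"
  shows "\<bar>(half_deriv ^^ k) c x\<bar> \<le> m"
proof -
  define S where "S k = (SUP x\<in>{0..}. \<bar>(half_deriv ^^ k) c x\<bar>)" for k
  have up: "\<bar>(half_deriv ^^ k) c x\<bar> \<le> S k" if "k \<le> 2" "0 \<le> x" for k x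
  proof -
    have "bounded ((half_deriv ^^ k) c ` {0..})" using c(1) that by (auto simp: C2_halfline_def)
    then have "bdd_above ((\<lambda>x. \<bar>(half_deriv ^^ k) c x\<bar>) ` {0..})"
      unfolding bounded_iff bdd_above_def by (auto simp: real_norm_def)
    then show ?thesis unfolding S_def using that by (intro cSUP_upper) auto
  qed
  have "S k \<le> (\<Sum>k\<le>2. S k)"
    using assms(4) order_trans[OF abs_ge_zero up[of _ 0]] by (intro member_le_sum) auto
  also have "\<dots> \<le> m" using c(2) by (simp add: C2_norm_def S_def)
  finally show ?thesis using up[OF assms(4,3)] by simp
qed

text \<open>The given representative is differentiable only relative to the half-line, and its
  values at negative x are arbitrary. It is 1 on the half-line outside a compact set K inside (0,
  L); the complement of K is open, so replacing it by 1 there gives a function differentiable on the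
  whole line.\<close>

lemma wave_speed_extension:
  assumes F: "F \<in> wave_speeds C0 C1 L m" and pos: "0 < C0" "0 < L" "0 < m"
  shows "\<exists>c c'. speed c c' C0 C1 L m \<and> F = ae_class halfline c"
proof -
  obtain b where b: "F = ae_class halfline b" "\<And>x. 0 \<le> x \<Longrightarrow> C0 \<le> b x \<and> b x \<le> C1" "b \<in> C2_halfline" "C2_norm b \<le> m"
    and b1: "(\<lambda>x. b x - 1) \<in> C2_compact L"
    using F unfolding wave_speeds_def by blast
  obtain K where K: "compact K" "K \<subseteq> {0<..<L}" "\<And>x. 0 \<le> x \<Longrightarrow> x \<notin> K \<Longrightarrow> b x = 1"
    using b1 unfolding C2_compact_def by fastforce
  define c where "c x = (if x \<in> K then b x else 1)" for x
  define c' where "c' x = (if x \<in> K then half_deriv b x else 0)" for x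
  have cb: "c x = b x" if "0 \<le> x" for x using K(3)[OF that] by (simp add: c_def)
  have within: "at x within {0..} = at x" if "0 < x" for x :: real
    using that by (intro at_within_interior) auto
  have db: "(b has_real_derivative half_deriv b x) (at x)" and d2b: "(half_deriv b has_real_derivative half_deriv (half_deriv b) x) (at x)"
    if "0 < x" for x
  proof -
    have "b differentiable (at x within {0..})" "half_deriv b differentiable (at x within {0..})"
      using b(3) that by (auto simp: C2_halfline_def differentiable_on_def)
    then show "(b has_real_derivative half_deriv b x) (at x)" "(half_deriv b has_real_derivative half_deriv (half_deriv b) x) (at x)"
      unfolding half_deriv_def[of b] half_deriv_def[of "\<lambda>x. vector_derivative b (at x within {0..})"]
      unfolding within[OF that] has_real_derivative_iff_has_vector_derivative
      by (simp_all add: vector_derivative_works[symmetric] half_deriv_def[abs_def])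
  qed
  have oK: "open (- K)" using K(1) by (simp add: compact_imp_closed open_Compl)
  have dc: "(c has_real_derivative c' x) (at x)" for x
  proof (cases "x \<in> K")
    case True
    then have x: "0 < x" using K(2) by auto
    have "(c has_real_derivative half_deriv b x) (at x)"
      by (rule has_field_derivative_transform_within_open[OF db[OF x], of "{0<..}"]) (use x cb in auto)
    then show ?thesis using True by (simp add: c'_def)
  next
    case False
    have "(c has_real_derivative 0) (at x)"
      by (rule has_field_derivative_transform_within_open[of "\<lambda>_. 1" _ _ "- K"]) (use False oK in \<open>auto simp: c_def\<close>)
    then show ?thesis using False by (simp add: c'_def)
  qed
  have c'b: "c' x = half_deriv b x" if "0 < x" for x
  proof -
    have "(b has_real_derivative c' x) (at x)"
      by (rule has_field_derivative_transform_within_open[OF dc, of "{0<..}"]) (use that cb in auto)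
    then show ?thesis using db[OF that] by (rule DERIV_unique)
  qed
  define c'' where "c'' x = (if x \<in> K then half_deriv (half_deriv b) x else 0)" for x
  have dc': "(c' has_real_derivative c'' x) (at x)" for x
  proof (cases "x \<in> K")
    case True
    then have x: "0 < x" using K(2) by auto
    have "(c' has_real_derivative half_deriv (half_deriv b) x) (at x)"
      by (rule has_field_derivative_transform_within_open[OF d2b[OF x], of "{0<..}"]) (use x c'b in auto)
    then show ?thesis using True by (simp add: c''_def)
  next
    case False
    have "(c' has_real_derivative 0) (at x)"
      by (rule has_field_derivative_transform_within_open[of "\<lambda>_. 0" _ _ "- K"]) (use False oK in \<open>auto simp: c'_def\<close>)
    then show ?thesis using False by (simp add: c''_def)
  qed
  have bnd: "\<bar>half_deriv b x\<bar> \<le> m" "\<bar>half_deriv (half_deriv b) x\<bar> \<le> m" if "0 \<le> x" for x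
    using C2_norm_bounds[OF b(3,4) that, of 1] C2_norm_bounds[OF b(3,4) that, of 2]
    by (simp_all add: numeral_2_eq_2)
  have one: "C0 \<le> 1" "1 \<le> C1" 
  proof -
    have "0 \<notin> K" using K(2) by auto
    then show "C0 \<le> 1" "1 \<le> C1" using b(2)[of 0] K(3)[of 0] by auto
  qed
  have "speed c c' C0 C1 L m"
  proof
    show "(c has_real_derivative c' x) (at x)" for x by (rule dc)
    show "C0 \<le> c x" "c x \<le> C1" for x
      using b(2)[of x] one K(2) by (auto simp: c_def)
    show "\<bar>c' x\<bar> \<le> m" for x using bnd(1)[of x] K(2) pos by (auto simp: c'_def)
    show "\<bar>c' x - c' z\<bar> \<le> m * \<bar>x - z\<bar>" for x z
    proof -
      have "\<bar>c'' x\<bar> \<le> m" for x using bnd(2)[of x] K(2) pos by (auto simp: c''_def)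
      then have "norm (c' x - c' z) \<le> m * norm (x - z)"
        using dc' by (intro field_differentiable_bound[of UNIV c' c'']) auto
      then show ?thesis by simp
    qed
    show "c x = 1" "c' x = 0" if "x \<le> 0 \<or> L \<le> x" for x
      using that K(2) by (auto simp: c_def c'_def)
  qed (use pos in auto)
  moreover have "F = ae_class halfline c"
  proof -
    have "ae_class halfline b = ae_class halfline c"
      unfolding ae_class_def halfline_def
      by (intro Collect_cong conj_cong refl AE_cong) (auto simp: space_restrict_space cb)
    then show ?thesis using b(1) by simp
  qed
  ultimately show ?thesis by blast
qed

section \<open>The Neumann-to-Dirichlet map on classes of wave speeds\<close>

lemma nd_map_speed:
  assumes s: "speed c c' C0 C1 L m" and F: "F = ae_class halfline c" and T: "0 < T"
  shows "nd_map T F = (\<lambda>G\<in>L2_space (time_interval T).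
      ae_class (time_interval T) (speed.\<Lambda> c c' C0 L m T (ae_rep G)))"
proof -
  interpret speed c c' C0 C1 L m by (rule s)
  have "c \<in> borel_measurable halfline"
    unfolding halfline_def by (rule continuous_measurable_restrict[OF c_cont])
  note r = ae_rep_class[OF this]
  show ?thesis
    unfolding nd_map_def F by (rule nd_operator_eq[OF T r])
qed

lemma nd_map_bounded:
  assumes "F \<in> wave_speeds C0 C1 L m" "0 < C0" "0 < L" "0 < m" "0 < T"
  shows "nd_map T F \<in> L2_operators (time_interval T)"
proof -
  obtain c c' where c: "speed c c' C0 C1 L m" "F = ae_class halfline c"
    using wave_speed_extension[OF assms(1-4)] by blast
  interpret speed c c' C0 C1 L m by (rule c(1))
  show ?thesis
    unfolding nd_map_speed[OF c assms(5)] by (rule nd_operator_bounded[OF assms(5)])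
qed

text \<open>A single input carries the estimate: the operator norm dominates the L2 distance of the
  two responses to the constant 1, whose norm is sqrt (2T).\<close>

lemma nd_map_stable:
  assumes pos: "0 < C0" "0 < L" "0 < m" "L / C0 < T" and \<epsilon>: "0 < \<epsilon>"
  shows "\<exists>\<eta>>0. \<forall>F\<in>wave_speeds C0 C1 L m. \<forall>G\<in>wave_speeds C0 C1 L m.
    op_dist (time_interval T) (nd_map T F) (nd_map T G) < \<eta> \<longrightarrow> Linf_dist halfline F G \<le> \<epsilon>"
proof -
  let ?N = "time_interval T"
  have T: "0 < T" using pos by (meson divide_pos_pos less_trans)
  define S where "S = \<bar>speed_stability C0 C1 L m\<bar> + 1"
  have S: "0 < S" by (simp add: S_def)
  obtain \<eta> where \<eta>: "0 < \<eta>" "\<And>c c' d d' \<xi>. speed c c' C0 C1 L m \<Longrightarrow> speed d d' C0 C1 L m \<Longrightarrow>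
    sqrt (LINT t|?N. (speed.\<Lambda> c c' C0 L m T (\<lambda>_. 1) t - speed.\<Lambda> d d' C0 L m T (\<lambda>_. 1) t)\<^sup>2) \<le> \<eta> \<Longrightarrow>
    0 \<le> \<xi> \<Longrightarrow> \<xi> \<le> 2 * (L / C0) \<Longrightarrow>
    \<bar>profile.G (speed.a c c') m (L / C0) \<xi> 0 - profile.G (speed.a d d') m (L / C0) \<xi> 0\<bar> \<le> \<epsilon> / S"
    using kernel_stable[OF pos, of "\<epsilon> / S" C1] \<epsilon> S by (auto simp: divide_pos_pos)
  show ?thesis
  proof (intro exI conjI ballI impI)
    show "0 < \<eta> / sqrt (2 * T)" using \<eta>(1) T by simp
    fix F G assume F: "F \<in> wave_speeds C0 C1 L m" and G: "G \<in> wave_speeds C0 C1 L m"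
      and op: "op_dist ?N (nd_map T F) (nd_map T G) < \<eta> / sqrt (2 * T)"
    obtain c c' where c: "speed c c' C0 C1 L m" "F = ae_class halfline c"
      using wave_speed_extension[OF F pos(1-3)] by blast
    obtain d d' where d: "speed d d' C0 C1 L m" "G = ae_class halfline d"
      using wave_speed_extension[OF G pos(1-3)] by blast
    interpret p: speed c c' C0 C1 L m by (rule c(1))
    interpret q: speed d d' C0 C1 L m by (rule d(1))
    have s1: "square_integrable ?N (\<lambda>_. 1)"
      by (rule time_interval_square_integrable) (rule continuous_on_const)
    have m1: "(\<lambda>_. 1) \<in> borel_measurable ?N" using s1 by (simp add: square_integrable_def)
    define one where "one = ae_class ?N (\<lambda>_. 1)"
    have one: "one \<in> L2_space ?N" unfolding one_def L2_space_def using s1 by blast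
    have r: "AE t in ?N. ae_rep one t = 1" unfolding one_def by (rule ae_rep_class(2)[OF m1])
    note sO = L2_spaceD(1)[OF one]
    have l1: "(LINT t|?N. (ae_rep one t)\<^sup>2) = 2 * T"
    proof -
      have "(LINT t|?N. (ae_rep one t)\<^sup>2) = (LINT t|?N. 1)"
        using r sO by (intro integral_cong_AE) (auto simp: square_integrable_def)
      also have "\<dots> = 2 * T" using T by (subst time_interval_integral) auto
      finally show ?thesis .
    qed
    have a1: "p.\<Lambda> T (ae_rep one) = p.\<Lambda> T (\<lambda>_. 1)" "q.\<Lambda> T (ae_rep one) = q.\<Lambda> T (\<lambda>_. 1)"
      by (rule p.\<Lambda>_cong[OF T sO s1 r] q.\<Lambda>_cong[OF T sO s1 r])+
    have lm: "p.\<Lambda> T (\<lambda>_. 1) \<in> borel_measurable ?N" "q.\<Lambda> T (\<lambda>_. 1) \<in> borel_measurable ?N"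
      using p.\<Lambda>_norm(1)[OF T s1] q.\<Lambda>_norm(1)[OF T s1] by (auto simp: square_integrable_def)
    have nF: "nd_map T F one = ae_class ?N (p.\<Lambda> T (\<lambda>_. 1))" "nd_map T G one = ae_class ?N (q.\<Lambda> T (\<lambda>_. 1))"
      using one by (simp_all add: nd_map_speed[OF c T] nd_map_speed[OF d T] a1)
    have "(LINT t|?N. (ae_rep (nd_map T F one) t - ae_rep (nd_map T G one) t)\<^sup>2)
        = (LINT t|?N. (p.\<Lambda> T (\<lambda>_. 1) t - q.\<Lambda> T (\<lambda>_. 1) t)\<^sup>2)"
    proof (rule integral_cong_AE)
      show "AE t in ?N. (ae_rep (nd_map T F one) t - ae_rep (nd_map T G one) t)\<^sup>2 = (p.\<Lambda> T (\<lambda>_. 1) t - q.\<Lambda> T (\<lambda>_. 1) t)\<^sup>2"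
        unfolding nF using ae_rep_class(2)[OF lm(1)] ae_rep_class(2)[OF lm(2)] by eventually_elim simp
    qed (use lm ae_rep_class(1)[OF lm(1)] ae_rep_class(1)[OF lm(2)] in \<open>auto simp: nF\<close>)
    then have "sqrt (LINT t|?N. (p.\<Lambda> T (\<lambda>_. 1) t - q.\<Lambda> T (\<lambda>_. 1) t)\<^sup>2) = L2_dist ?N (nd_map T F one) (nd_map T G one)"
      by (simp add: L2_dist_def)
    also have "\<dots> \<le> op_dist ?N (nd_map T F) (nd_map T G) * L2_norm ?N one"
      by (intro op_dist_bound nd_map_bounded[OF F] nd_map_bounded[OF G] pos T one)
    also have "\<dots> \<le> \<eta> / sqrt (2 * T) * sqrt (2 * T)"
      using op T unfolding L2_norm_def l1 by (intro mult_right_mono) auto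
    also have "\<dots> = \<eta>" using T by simp
    finally have close: "sqrt (LINT t|?N. (p.\<Lambda> T (\<lambda>_. 1) t - q.\<Lambda> T (\<lambda>_. 1) t)\<^sup>2) \<le> \<eta>" .
    have le: "\<bar>c x - d x\<bar> \<le> \<epsilon>" for x
    proof -
      have "\<bar>c x - d x\<bar> \<le> \<epsilon> / S * speed_stability C0 C1 L m"
        by (rule speed_stable[OF c(1) d(1) \<eta>(2)[OF c(1) d(1) close]])
      also have "\<dots> \<le> \<epsilon> / S * S"
        using \<epsilon> S by (intro mult_left_mono) (auto simp: S_def)
      finally show ?thesis using S by simp
    qed
    have cm: "c \<in> borel_measurable halfline" "d \<in> borel_measurable halfline"
      unfolding halfline_def by (rule continuous_measurable_restrict[OF p.c_cont] continuous_measurable_restrict[OF q.c_cont])+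
    show "Linf_dist halfline F G \<le> \<epsilon>"
    proof (rule Linf_dist_le)
      show "F \<in> Linf_space halfline" "G \<in> Linf_space halfline" using F G by (auto simp: wave_speeds_def)
      show "AE x in halfline. \<bar>ae_rep F x - ae_rep G x\<bar> \<le> \<epsilon>"
        unfolding c(2) d(2) using ae_rep_class(2)[OF cm(1)] ae_rep_class(2)[OF cm(2)]
        by eventually_elim (simp add: le)
    qed (use \<epsilon> in auto)
  qed
qed

theorem theorem1:
  fixes C0 C1 L m T :: real
  assumes "C0 > 0" and "C1 > 0" and "L > 0" and "m > 0" and "T > L / C0"
  shows "nd_map T \<in> wave_speeds C0 C1 L m \<rightarrow> L2_operators (time_interval T) \<and>
    inj_on (nd_map T) (wave_speeds C0 C1 L m) \<and>
    continuous_map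
      (subtopology (Y_topology T) (nd_map T ` wave_speeds C0 C1 L m))
      (subtopology X_topology (wave_speeds C0 C1 L m))
      (inv_into (wave_speeds C0 C1 L m) (nd_map T))"
proof (intro conjI)
  let ?W = "wave_speeds C0 C1 L m" and ?N = "time_interval T"
  have T: "0 < T" using assms by (meson divide_pos_pos less_trans)
  show maps: "nd_map T \<in> ?W \<rightarrow> L2_operators ?N"
    using nd_map_bounded[OF _ assms(1,3,4) T] by blast
  interpret X: Metric_space "Linf_space halfline" "Linf_dist halfline" by (rule Metric_space_Linf)
  interpret Y: Metric_space "L2_operators ?N" "op_dist ?N" by (rule Metric_space_L2_operators)
  have sub: "?W \<subseteq> Linf_space halfline" by (auto simp: wave_speeds_def)
  note stable = nd_map_stable[OF assms(1,3,4,5), of _ C1]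
  show inj: "inj_on (nd_map T) ?W"
  proof (rule inj_onI)
    fix F G assume F: "F \<in> ?W" and G: "G \<in> ?W" and eq: "nd_map T F = nd_map T G"
    have "op_dist ?N (nd_map T F) (nd_map T G) = 0"
      using maps F G eq by (subst Y.zero) auto
    then have "Linf_dist halfline F G \<le> \<epsilon>" if "0 < \<epsilon>" for \<epsilon>
      using stable[OF that] F G by auto
    then have "Linf_dist halfline F G \<le> 0" by (rule field_le_epsilon) simp
    then have "Linf_dist halfline F G = 0" using X.nonneg[of F G] by simp
    then show "F = G" using X.zero F G sub by blast
  qed
  show "continuous_map (subtopology (Y_topology T) (nd_map T ` ?W)) (subtopology X_topology ?W) (inv_into ?W (nd_map T))"
    unfolding continuous_map_in_subtopology
  proof
    \<comment> \<open>The range carries the restricted metric, which makes the \<epsilon>-\<delta>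
      criterion available for the subspace topology.\<close>
    interpret SY: Submetric "L2_operators ?N" "op_dist ?N" "nd_map T ` ?W"
      by unfold_locales (use maps in auto)
    have top: "subtopology (Y_topology T) (nd_map T ` ?W) = SY.sub.mtopology"
      by (simp add: Y_topology_def SY.mtopology_submetric)
    show "inv_into ?W (nd_map T) \<in> topspace (subtopology (Y_topology T) (nd_map T ` ?W)) \<rightarrow> ?W"
      by (auto simp: inv_into_into)
    show "continuous_map (subtopology (Y_topology T) (nd_map T ` ?W)) X_topology (inv_into ?W (nd_map T))"
      unfolding top X_topology_def
    proof (subst SY.sub.metric_continuous_map[OF X.Metric_space_axioms], intro conjI ballI allI impI)
      show "inv_into ?W (nd_map T) ` nd_map T ` ?W \<subseteq> Linf_space halfline"
        using sub inj by auto
      fix B \<epsilon> assume B: "B \<in> nd_map T ` ?W" and \<epsilon>: "0 < (\<epsilon>::real)"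
      \<comment> \<open>\<open>nd_map_stable\<close> ends in a weak inequality; half of \<epsilon>
        makes it strict.\<close>
      obtain \<eta> where \<eta>: "0 < \<eta>" "\<And>F G. F \<in> ?W \<Longrightarrow> G \<in> ?W \<Longrightarrow> op_dist ?N (nd_map T F) (nd_map T G) < \<eta> \<Longrightarrow> Linf_dist halfline F G \<le> \<epsilon> / 2"
        using stable[of "\<epsilon> / 2"] \<epsilon> by auto
      show "\<exists>\<delta>>0. \<forall>y. y \<in> nd_map T ` ?W \<and> op_dist ?N B y < \<delta> \<longrightarrow>
          Linf_dist halfline (inv_into ?W (nd_map T) B) (inv_into ?W (nd_map T) y) < \<epsilon>"
      proof (intro exI[of _ \<eta>] conjI allI impI)
        fix D assume D: "D \<in> nd_map T ` ?W \<and> op_dist ?N B D < \<eta>"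
        then have "Linf_dist halfline (inv_into ?W (nd_map T) B) (inv_into ?W (nd_map T) D) \<le> \<epsilon> / 2"
          using B by (intro \<eta>(2)) (auto simp: inv_into_into f_inv_into_f)
        then show "Linf_dist halfline (inv_into ?W (nd_map T) B) (inv_into ?W (nd_map T) D) < \<epsilon>"
          using \<epsilon> by simp
      qed (rule \<eta>(1))
    qed
  qed
qed

end
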